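(* Let $n\ge 1$, let $\mathbf i\in\Sigma_{n+1}$ be a reduced word of the longest element $w_0$ of $\mathfrak S_{n+1}$, and let $\lambda=\lambda_1\varpi_1+\cdots+\lambda_n\varpi_n$ be a regular dominant integral weight (all $\lambda_i$ positive integers). The following are equivalent: (1) the string polytope $\Delta_{\mathbf i}(\lambda)$ is unimodularly equivalent to the Gelfand–Cetlin polytope $GC(\lambda)$; (2) $\Delta_{\mathbf i}(\lambda)$ has exactly $n(n+1)$ facets; (3) the string cone $C_{\mathbf i}$ is simplicial; (4) there exists $(\sigma_1,\dots,\sigma_n)\in\{A,D\}^n$ such that $\mathrm{ind}_{\sigma_k}\big(C_{\sigma_{k+1}}\circ\cdots\circ C_{\sigma_n}(\mathbf i)\big)=0$ for all $k=n,n-1,\dots,1$ (for $k=n$ this reads $\mathrm{ind}_{\sigma_n}(\mathbf i)=0$).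
   Context: $N=n(n+1)/2$. $s_i=(i,i+1)\in\mathfrak S_{n+1}$; $\Sigma_{n+1}$ is the set of $\mathbf i=(i_1,\dots,i_N)\in[n]^N$ with $w_0=s_{i_1}\cdots s_{i_N}$. Wiring diagram $G(\mathbf i)$: $n+1$ wires $\ell_1,\dots,\ell_{n+1}$ run from top to bottom through positions $1,\dots,n+1$ (left to right); at the top $\ell_k$ is in position $k$. Reading the diagram from top to bottom, the $j$-th crossing (node) $t_j$ swaps the two wires currently in positions $i_j,i_j+1$ (the node lies in column $i_j$). Every two wires cross exactly once; at the bottom $\ell_k$ is in position $n+2-k$ and ends at its lower end $L_k$. The symbol $t_j$ also denotes the $j$-th coordinate of $\mathbb R^N$. Rigorous paths: for $k\in[n]$, $G(\mathbf i,k)$ is $G(\mathbf i)$ with $\ell_1,\dots,\ell_k$ oriented upward and $\ell_{k+1},\dots,\ell_{n+1}$ downward. A rigorous path in $G(\mathbf i,k)$ starts at $L_k$, ends at $L_{k+1}$, moves along wires in their orientation, may switch from one wire to the other only at the node where they cross, passes each node at most once, and never passes straight (without switching) through the node $\ell_a\cap\ell_b$ while travelling on $\ell_a$ when both wires are oriented downward with $a>b$, or both upward with $a<b$. $\mathcal{GP}(\mathbf i)$ is the set of all rigorous paths (all $k$). String inequality of a rigorous path $P$: $\sum_j a_jt_j\ge 0$, where $a_j=1$ if $P$ switches at $t_j$ from $\ell_r$ to $\ell_s$ with $r<s$, $a_j=-1$ if it switches with $r>s$, and $a_j=0$ if $P$ does not switch at $t_j$. The string cone $C_{\mathbf i}\subset\mathbb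 R^N$ is the set of points satisfying all string inequalities. $C_{\mathbf i}$ is simplicial if it has exactly $N$ facets. $\lambda=\sum\lambda_i\varpi_i$ ($\varpi_i$ fundamental weights of $\mathfrak{sl}_{n+1}$) is dominant if all $\lambda_i\ge0$, integral if all $\lambda_i\in\mathbb Z$, regular if all $\lambda_i\neq0$. The $\lambda$-inequality of node $t_j$ is $t_j\le\lambda_{i_j}+\sum_{k>j}a_kt_k$ with $a_k=1$ if $|i_k-i_j|=1$, $a_k=-2$ if $i_k=i_j$, $a_k=0$ otherwise. The string polytope $\Delta_{\mathbf i}(\lambda)$ is the set of points of $\mathbb R^N$ satisfying all string inequalities and all $N$ $\lambda$-inequalities. Gelfand–Cetlin polytope $GC(\lambda)\subset\mathbb R^N$ (coordinates $x_{k,j}$, $1\le j\le k\le n$): all $x$ with $x_{k+1,j}\ge x_{k,j}\ge x_{k+1,j+1}$ for $1\le j\le k\le n$, where $x_{n+1,j}:=\lambda_j+\cdots+\lambda_n$ and $x_{n+1,n+1}:=0$. Two polyhedra in $\mathbb R^N$ are unimodularly equivalent if an affine map $x\mapsto Mx+v$ with $M\in GL_N(\mathbb Z)$, $v\in\mathbb Z^N$ maps one onto the other. Indices and contractions: a 2-move exchanges adjacent letters $i,j$ with $|i-j|>1$; $\sim$ is the equivalence relation generated by 2-moves. $D_n=(n,n-1,\dots,1)$, $A_n=(1,2,\dots,n)$. Every $\mathbf i\in\Sigma_{n+1}$ satisfies $\mathbf i\sim\mathbf i_D^-\,D_n\,\mathbf i_D^+$ and $\mathbf i\sim\mathbf i_A^-\,A_n\,\mathbf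 i_A^+$ (concatenations) for some words $\mathbf i_D^\pm,\mathbf i_A^\pm$; $\mathrm{ind}_D(\mathbf i):=|\mathbf i_D^+|$ and $\mathrm{ind}_A(\mathbf i):=|\mathbf i_A^+|$ (lengths; independent of choices). For a word $\mathbf w$, $\mathbf w\pm1$ adds $\pm1$ to every letter. Contractions $C_D(\mathbf i):=\mathbf i_D^-(\mathbf i_D^+-1)\in\Sigma_n$ and $C_A(\mathbf i):=(\mathbf i_A^--1)\mathbf i_A^+\in\Sigma_n$ (well defined up to $\sim$; the wiring diagram of $C_D(\mathbf i)$ is $G(\mathbf i)$ with $\ell_{n+1}$ deleted, that of $C_A(\mathbf i)$ is $G(\mathbf i)$ with $\ell_1$ deleted and wires relabeled). Indices are invariant under $\sim$. $\Sigma_2=\{(1)\}$ and both indices of $(1)$ are $0$. *)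

theory Defs
  imports "HOL-Analysis.Analysis"
begin

definition sw :: "nat \<Rightarrow> nat \<Rightarrow> nat" where
  "sw a x = (if x = a then a + 1 else if x = a + 1 then a else x)"

definition word_perm :: "nat list \<Rightarrow> nat \<Rightarrow> nat" where
  "word_perm w = foldr (\<lambda>a f. sw a \<circ> f) w id"

definition red_w0 :: "nat \<Rightarrow> nat list set" where
  "red_w0 m = {w. length w = m * (m + 1) div 2 \<and> set w \<subseteq> {1..m} \<and>
                  (\<forall>x\<in>{1..m+1}. word_perm w x = m + 2 - x)}"

(* wpos w j p = the wire in position p after the first j crossings (0-indexed nodes) *)
fun wpos :: "nat list \<Rightarrow> nat \<Rightarrow> nat \<Rightarrow> nat" where
  "wpos w 0 = id"
| "wpos w (Suc j) = wpos w j \<circ> sw (w ! j)"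

(* the two wires crossing at node t_{j+1} (0-indexed j) *)
definition lw :: "nat list \<Rightarrow> nat \<Rightarrow> nat" where
  "lw w j = wpos w j (w ! j)"
definition rw :: "nat list \<Rightarrow> nat \<Rightarrow> nat" where
  "rw w j = wpos w j (w ! j + 1)"

definition on_wire :: "nat list \<Rightarrow> nat \<Rightarrow> nat \<Rightarrow> bool" where
  "on_wire w j a \<longleftrightarrow> j < length w \<and> (a = lw w j \<or> a = rw w j)"

definition other :: "nat list \<Rightarrow> nat \<Rightarrow> nat \<Rightarrow> nat" where
  "other w j a = (if a = lw w j then rw w j else lw w j)"

(* In G(i,k), wires 1..k go upward, wires k+1..n+1 go downward.
   Next node reached when leaving node j along wire b (None = end of the wire). *)
definition next_node :: "nat list \<Rightarrow> nat \<Rightarrow> nat \<Rightarrow> nat \<Rightarrow> nat option" where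
  "next_node w k b j =
     (if b \<le> k then
        (if \<exists>j'<j. on_wire w j' b then Some (Max {j'. j' < j \<and> on_wire w j' b}) else None)
      else
        (if \<exists>j'>j. on_wire w j' b then Some (Min {j'. j < j' \<and> on_wire w j' b}) else None))"

(* A rigorous path in G(w,k): list of (node j, arriving wire a, leaving wire b). *)
definition rigorous :: "nat list \<Rightarrow> nat \<Rightarrow> (nat \<times> nat \<times> nat) list \<Rightarrow> bool" where
  "rigorous w k ps \<longleftrightarrow>
     ps \<noteq> [] \<and>
     \<comment> \<open>start at L_k, going up along wire k\<close>
     fst (snd (ps ! 0)) = k \<and> next_node w k k (length w) = Some (fst (ps ! 0)) \<and>
     \<comment> \<open>each step lies on the wire and either continues or switches\<close>
     (\<forall>(j, a, b)\<in>set ps. on_wire w j a \<and> (b = a \<or> b = other w j a)) \<and>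
     \<comment> \<open>consecutive nodes follow the orientation\<close>
     (\<forall>i. Suc i < length ps \<longrightarrow>
          fst (snd (ps ! Suc i)) = snd (snd (ps ! i)) \<and>
          next_node w k (snd (snd (ps ! i))) (fst (ps ! i)) = Some (fst (ps ! Suc i))) \<and>
     \<comment> \<open>end at L_{k+1}\<close>
     snd (snd (last ps)) = k + 1 \<and> next_node w k (k + 1) (fst (last ps)) = None \<and>
     \<comment> \<open>each node at most once\<close>
     distinct (map fst ps) \<and>
     \<comment> \<open>forbidden straight passes\<close>
     (\<forall>(j, a, b)\<in>set ps. b = a \<longrightarrow>
        (let c = other w j a in
          \<not> (k < a \<and> k < c \<and> c < a) \<and> \<not> (a \<le> k \<and> c \<le> k \<and> a < c)))"

(* coefficient a_j of the string inequality at a node passed from wire a to wire b *)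
definition sw_coef :: "nat \<Rightarrow> nat \<Rightarrow> real" where
  "sw_coef a b = (if a < b then 1 else if b < a then -1 else 0)"

(* e enumerates the coordinates: t_{j+1} is the coordinate e j, for j < N *)
definition string_cone :: "nat \<Rightarrow> nat list \<Rightarrow> (nat \<Rightarrow> 'm::finite) \<Rightarrow> (real^'m) set" where
  "string_cone n w e = {x. \<forall>k\<in>{1..n}. \<forall>ps. rigorous w k ps \<longrightarrow>
       0 \<le> sum_list (map (\<lambda>(j, a, b). sw_coef a b * x $ e j) ps)}"

definition lam_coef :: "nat list \<Rightarrow> nat \<Rightarrow> nat \<Rightarrow> real" where
  "lam_coef w j k = (if w ! k = w ! j + 1 \<or> w ! j = w ! k + 1 then 1
                     else if w ! k = w ! j then -2 else 0)"

definition string_polytope ::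
  "nat \<Rightarrow> nat list \<Rightarrow> (nat \<Rightarrow> int) \<Rightarrow> (nat \<Rightarrow> 'm::finite) \<Rightarrow> (real^'m) set" where
  "string_polytope n w lam e = string_cone n w e \<inter>
     {x. \<forall>j<length w. x $ e j \<le> of_int (lam (w ! j)) +
            (\<Sum>k\<in>{j<..<length w}. lam_coef w j k * x $ e k)}"

(* coordinate index of x_{k,j}, 1 <= j <= k <= n *)
definition gc_idx :: "nat \<Rightarrow> nat \<Rightarrow> nat" where
  "gc_idx k j = (k - 1) * k div 2 + (j - 1)"

(* x_{k,j}, with x_{n+1,j} = lam_j + ... + lam_n (so x_{n+1,n+1} = 0) *)
definition gc_val :: "nat \<Rightarrow> (nat \<Rightarrow> int) \<Rightarrow> (nat \<Rightarrow> 'm::finite) \<Rightarrow> real^'m \<Rightarrow> nat \<Rightarrow> nat \<Rightarrow> real" where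
  "gc_val n lam e x k j = (if k = n + 1 then of_int (\<Sum>i\<in>{j..n}. lam i) else x $ e (gc_idx k j))"

definition GC_polytope :: "nat \<Rightarrow> (nat \<Rightarrow> int) \<Rightarrow> (nat \<Rightarrow> 'm::finite) \<Rightarrow> (real^'m) set" where
  "GC_polytope n lam e = {x. \<forall>k\<in>{1..n}. \<forall>j\<in>{1..k}.
      gc_val n lam e x (k + 1) (j + 1) \<le> gc_val n lam e x k j \<and>
      gc_val n lam e x k j \<le> gc_val n lam e x (k + 1) j}"

definition int_matrix :: "real^'m^'m \<Rightarrow> bool" where
  "int_matrix M \<longleftrightarrow> (\<forall>i j. M $ i $ j \<in> \<int>)"

definition unimod_equiv :: "(real^'m) set \<Rightarrow> (real^'m) set \<Rightarrow> bool" where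
  "unimod_equiv P Q \<longleftrightarrow> (\<exists>M M' v. int_matrix M \<and> int_matrix M' \<and>
       M ** M' = mat 1 \<and> M' ** M = mat 1 \<and> (\<forall>i. v $ i \<in> \<int>) \<and>
       (\<lambda>x. M *v x + v) ` P = Q)"

definition num_facets :: "'a::euclidean_space set \<Rightarrow> nat" where
  "num_facets P = card {F. F facet_of P}"

definition two_move :: "nat list \<Rightarrow> nat list \<Rightarrow> bool" where
  "two_move u v \<longleftrightarrow> (\<exists>xs ys a b. u = xs @ [a, b] @ ys \<and> v = xs @ [b, a] @ ys \<and>
                        (b + 1 < a \<or> a + 1 < b))"

definition comm_eq :: "nat list \<Rightarrow> nat list \<Rightarrow> bool" where
  "comm_eq = two_move\<^sup>*\<^sup>*"

definition Dword :: "nat \<Rightarrow> nat list" where "Dword m = rev [1..<m+1]"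
definition Aword :: "nat \<Rightarrow> nat list" where "Aword m = [1..<m+1]"

datatype AD = A | D

(* for a word in Sigma_{m+1} *)
definition ind :: "AD \<Rightarrow> nat \<Rightarrow> nat list \<Rightarrow> nat" where
  "ind s m w = (LEAST l. \<exists>u v. comm_eq w (u @ (if s = A then Aword m else Dword m) @ v)
                              \<and> length v = l)"

definition contr :: "AD \<Rightarrow> nat \<Rightarrow> nat list \<Rightarrow> nat list" where
  "contr s m w = (if s = D
     then (SOME x. \<exists>u v. comm_eq w (u @ Dword m @ v) \<and> x = u @ map (\<lambda>a. a - 1) v)
     else (SOME x. \<exists>u v. comm_eq w (u @ Aword m @ v) \<and> x = map (\<lambda>a. a - 1) u @ v))"

definition contr_from :: "(nat \<Rightarrow> AD) \<Rightarrow> nat \<Rightarrow> nat \<Rightarrow> nat list \<Rightarrow> nat list" where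
  "contr_from \<sigma> n k w = fold (\<lambda>j x. contr (\<sigma> j) j x) (rev [k+1..<n+1]) w"

end

(*
  A rigorous path is determined by the list of wires it travels on, and which lists occur depends
  only on the order of the crossings along each wire, that is, on the heights of the crossings of
  the wires 1 <= a < b < c <= n + 1, where ac lies between ab and bc.

  Facets.  The lambda-inequalities cut out a simplicial cone whose apex lies in the interior of the
  string cone, while 0 lies in the interior of the former; so no inequality becomes redundant and
  the string polytope has N more facets than the string cone.  In the same way the Gelfand-Cetlin
  polytope is the intersection of two simplicial cones and has 2N facets.  Hence (1) => (2) <=> (3).

  (4) => (1).  ind_D = 0 means that wire n + 1 makes all its crossings after the other ones.  Then
  the only paths using it are [k, n + 1, k + 1] and [n, n + 1]; the string cone is the product of
  the cone of the contraction and the chain cone of the last n coordinates, and these coordinates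
  turn unimodularly into the top row of a Gelfand-Cetlin pattern.  ind_A = 0 is the mirror image.

  (3) => (4).  The vectors of the paths span the dual space, so if the cone is simplicial, N of them
  form a basis that generates the dual cone.  Restricting to faces, the same holds for the paths on
  every interval p, ..., q of wires.  By induction on q - p it follows that on each interval either q
  crosses the others last (ZD) or p does (ZA): given this for p, ..., q - 1 and p + 1, ..., q, either
  the order axiom gives the claim, or two paths can be exchanged at the crossing of p and q, which
  gives a relation between four extreme rays, or q = p + 3 and one of three explicit relations
  contradicts independence.  Contracting along these intervals gives (4).
*)
theory Submission
  imports Defs
begin

section \<open>Counting facets\<close>

text \<open>Independence of the generators helps only once particular paths are known to be
  generators. Two pairings supply this. Pairing with \<open>tvec\<close> of a step function detects
  the type k of a path, so the expansion of a path contains generators of its own type only, and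
  relations split by type. Pairing with the vector of a path P counts the switches shared with P
  (those in the opposite direction negatively), so a path whose switches are contained in no other
  path of its type must itself be a generator. Shrinking an interval of wires is passing to a face
  because an end wire of the interval has a fixed orientation: q points downward and p upward for
  all types k with p \<le> k < q. Each visit to such a wire therefore runs through it in a known
  direction, and weights that decrease from top to bottom on its nodes give every visit a positive
  value.\<close>

lemma num_facets_irredundant:
  fixes a :: "'i \<Rightarrow> 'a::euclidean_space"
  assumes fin: "finite I" and P: "P = {x. \<forall>i\<in>I. b i \<le> a i \<bullet> x}"
    and z: "\<forall>i\<in>I. b i < a i \<bullet> z"
    and irr: "\<And>i. i \<in> I \<Longrightarrow> \<exists>x. a i \<bullet> x < b i \<and> (\<forall>j\<in>I-{i}. b j \<le> a j \<bullet> x)"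
  shows "num_facets P = card I"
proof -
  \<comment> \<open>The facet criterion speaks of a set of half-spaces, the lemma of an index set;
    \<open>h\<close> has to be injective in order to carry \<open>a\<close> and \<open>b\<close>
    over.\<close>
  define h where "h i = {x. (- a i) \<bullet> x \<le> - b i}" for i
  have inj: "inj_on h I"
  proof (rule inj_onI, rule ccontr)
    fix i j assume ij: "i \<in> I" "j \<in> I" "h i = h j" "i \<noteq> j"
    obtain x where x: "a i \<bullet> x < b i" "\<forall>j\<in>I-{i}. b j \<le> a j \<bullet> x" using irr ij by blast
    have "x \<in> h j" using x ij by (auto simp: h_def)
    moreover have "x \<notin> h i" using x by (auto simp: h_def)
    ultimately show False using ij by simp
  qed
  define A where "A H = - a (the_inv_into I h H)" for H
  define B where "B H = - b (the_inv_into I h H)" for H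
  have AB: "A (h i) = - a i" "B (h i) = - b i" if "i \<in> I" for i
    using that by (simp_all add: A_def B_def the_inv_into_f_f[OF inj])
  have "open {x. \<forall>i\<in>I. b i < a i \<bullet> x}"
  proof -
    have "{x. \<forall>i\<in>I. b i < a i \<bullet> x} = (\<Inter>i\<in>I. {x. b i < a i \<bullet> x})" by auto
    then show ?thesis using fin by (auto intro!: open_INT open_halfspace_gt)
  qed
  then have "z \<in> interior P"
    by (rule interiorI) (use z P in \<open>auto intro: less_imp_le\<close>)
  then have aff: "affine hull P = UNIV"
    using affine_hull_nonempty_interior by blast
  have PF: "P = \<Inter>(h ` I)" by (auto simp: P h_def)
  have nz: "a i \<noteq> 0" if "i \<in> I" for i
    using irr[OF that] z that by (force simp: not_less[symmetric])
  have ex: "C facet_of P \<longleftrightarrow> (\<exists>H. H \<in> h ` I \<and> C = P \<inter> {x. A H \<bullet> x = B H})" for C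
  proof (rule facet_of_polyhedron_explicit)
    show "finite (h ` I)" using fin by simp
    show "P = affine hull P \<inter> \<Inter>(h ` I)" using aff PF by simp
    show "A H \<noteq> 0 \<and> H = {x. A H \<bullet> x \<le> B H}" if "H \<in> h ` I" for H
      using that AB nz by (auto simp: h_def)
    fix F' assume F': "F' \<subset> h ` I"
    then obtain i where i: "i \<in> I" "h i \<notin> F'" by blast
    obtain x where x: "a i \<bullet> x < b i" "\<forall>j\<in>I-{i}. b j \<le> a j \<bullet> x" using irr i by blast
    have "x \<in> \<Inter>F'"
    proof
      fix H assume "H \<in> F'"
      then obtain j where "j \<in> I" "H = h j" "j \<noteq> i" using F' i by blast
      then show "x \<in> H" using x by (auto simp: h_def)
    qed
    moreover have "x \<notin> P" using x i by (force simp: P)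
    moreover have "P \<subseteq> \<Inter>F'" using PF F' by auto
    ultimately show "P \<subset> affine hull P \<inter> \<Inter>F'" using aff by auto
  qed
  have "{C. C facet_of P} = (\<lambda>i. P \<inter> {x. a i \<bullet> x = b i}) ` I"
    by (auto simp: ex AB)
  moreover have "inj_on (\<lambda>i. P \<inter> {x. a i \<bullet> x = b i}) I"
  proof (rule inj_onI, rule ccontr)
    fix i j assume ij: "i \<in> I" "j \<in> I" "P \<inter> {x. a i \<bullet> x = b i} = P \<inter> {x. a j \<bullet> x = b j}" "i \<noteq> j"
    obtain x where x: "a i \<bullet> x < b i" "\<forall>j\<in>I-{i}. b j \<le> a j \<bullet> x" using irr ij by blast
    \<comment> \<open>The point \<open>w\<close> is where the segment from the interior point
      \<open>z\<close> to \<open>x\<close> meets the hyperplane of \<open>i\<close>. All other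
      inequalities are strict there, so \<open>w\<close> lies on no other facet.\<close>
    define t where "t = (a i \<bullet> z - b i) / (a i \<bullet> z - a i \<bullet> x)"
    have zi: "b i < a i \<bullet> z" using z ij by blast
    have t: "0 < t" "t < 1" using zi x by (auto simp: t_def field_simps)
    define w where "w = (1 - t) *\<^sub>R z + t *\<^sub>R x"
    have "a i \<bullet> w = a i \<bullet> z - t * (a i \<bullet> z - a i \<bullet> x)"
      by (simp add: w_def inner_add_right algebra_simps)
    then have wi: "a i \<bullet> w = b i" using zi x by (simp add: t_def)
    have wl: "b l < a l \<bullet> w" if "l \<in> I" "l \<noteq> i" for l
    proof -
      have "(1 - t) * b l < (1 - t) * (a l \<bullet> z)" using t z that by simp
      moreover have "t * b l \<le> t * (a l \<bullet> x)" using t x that by simp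
      moreover have "a l \<bullet> w = (1 - t) * (a l \<bullet> z) + t * (a l \<bullet> x)" by (simp add: w_def inner_add_right)
      ultimately show ?thesis by (simp add: algebra_simps)
    qed
    have "w \<in> P" using wi wl by (fastforce simp: P)
    then have "w \<in> P \<inter> {x. a j \<bullet> x = b j}" using ij wi by blast
    then show False using ij wl[of j] by auto
  qed
  ultimately show ?thesis by (simp add: num_facets_def card_image)
qed

section \<open>Cones given by inequalities, and intersections of two cones\<close>

definition cone_at :: "'a::euclidean_space set \<Rightarrow> 'a \<Rightarrow> 'a set" where
  "cone_at E p = {x. \<forall>a\<in>E. 0 \<le> a \<bullet> (x - p)}"

definition irredundant :: "'a::euclidean_space set \<Rightarrow> bool" where
  "irredundant M \<longleftrightarrow> (\<forall>a\<in>M. \<exists>x. a \<bullet> x < 0 \<and> (\<forall>b\<in>M-{a}. 0 \<le> b \<bullet> x))"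

text \<open>Redundancy among homogeneous inequalities does not depend on the apex, so one subset
  serves for every \<open>p\<close>.\<close>

lemma irredundant_subset_exists:
  assumes "finite E"
  obtains M where "M \<subseteq> E" "irredundant M" "\<And>p. cone_at M p = cone_at E p"
proof -
  have "\<exists>M. M \<subseteq> E \<and> irredundant M \<and> (\<forall>p. cone_at M p = cone_at E p)"
    using assms
  proof (induction E rule: finite_psubset_induct)
    case (psubset E)
    show ?case
    proof (cases "irredundant E")
      case False
      then obtain a where a: "a \<in> E" "\<And>x. \<forall>b\<in>E-{a}. 0 \<le> b \<bullet> x \<Longrightarrow> 0 \<le> a \<bullet> x"
        unfolding irredundant_def by (metis not_le)
      have "cone_at (E - {a}) p = cone_at E p" for p
        unfolding cone_at_def using a by blast
      moreover obtain M where "M \<subseteq> E - {a}" "irredundant M" "\<forall>p. cone_at M p = cone_at (E - {a}) p"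
        using psubset.IH[of "E - {a}"] a by blast
      ultimately show ?thesis by blast
    qed blast
  qed
  then show ?thesis using that by blast
qed

lemma num_facets_cone_at:
  assumes "finite M" "irredundant M" "\<forall>a\<in>M. 0 < a \<bullet> (z - p)"
  shows "num_facets (cone_at M p) = card M"
proof (rule num_facets_irredundant[where a = id and b = "\<lambda>a. a \<bullet> p"])
  show "cone_at M p = {x. \<forall>i\<in>M. i \<bullet> p \<le> id i \<bullet> x}" by (auto simp: cone_at_def inner_diff_right)
  show "\<forall>i\<in>M. i \<bullet> p < id i \<bullet> z" using assms by (auto simp: inner_diff_right)
  fix i assume i: "i \<in> M"
  obtain x where x: "i \<bullet> x < 0 \<and> (\<forall>b\<in>M-{i}. 0 \<le> b \<bullet> x)" using assms i by (auto simp: irredundant_def)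
  show "\<exists>x. id i \<bullet> x < i \<bullet> p \<and> (\<forall>j\<in>M - {i}. j \<bullet> p \<le> id j \<bullet> x)"
    by (rule exI[of _ "x + p"]) (use x in \<open>auto simp: inner_add_right\<close>)
qed (use assms in auto)

lemma small_perturbation:
  fixes u v :: "'i \<Rightarrow> real"
  assumes "finite G" "\<forall>g\<in>G. 0 < u g"
  shows "\<exists>\<epsilon>>0. \<forall>g\<in>G. 0 \<le> u g + \<epsilon> * v g"
  using assms
proof (induction G rule: finite_induct)
  case (insert g G)
  then obtain \<epsilon> where e: "\<epsilon> > 0" "\<forall>g\<in>G. 0 \<le> u g + \<epsilon> * v g" by auto
  \<comment> \<open>The summand 1 keeps the denominator positive when \<open>v g\<close>
    vanishes.\<close>
  define \<delta> where "\<delta> = min \<epsilon> (u g / (\<bar>v g\<bar> + 1))"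
  have ug: "0 < u g" using insert by auto
  have d: "0 < \<delta>" "\<delta> \<le> \<epsilon>" using e ug by (auto simp: \<delta>_def)
  have "\<delta> * (\<bar>v g\<bar> + 1) \<le> u g"
    using ug mult_right_mono[of \<delta> "u g / (\<bar>v g\<bar> + 1)" "\<bar>v g\<bar> + 1"] by (simp add: \<delta>_def)
  moreover have "- (\<delta> * v g) \<le> \<delta> * (\<bar>v g\<bar> + 1)"
  proof -
    have "\<delta> * (- v g) \<le> \<delta> * (\<bar>v g\<bar> + 1)" using d by (intro mult_left_mono) auto
    then show ?thesis by simp
  qed
  ultimately have "0 \<le> u g + \<delta> * v g" by linarith
  moreover have "0 \<le> u g' + \<delta> * v g'" if "g' \<in> G" for g'
  proof (cases "0 \<le> v g'")
    case True
    then show ?thesis using insert.prems that d by (intro add_nonneg_nonneg mult_nonneg_nonneg) (auto intro: less_imp_le)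
  next
    case False
    then have "\<epsilon> * v g' \<le> \<delta> * v g'" using d by (simp add: mult_right_mono_neg)
    moreover have "0 \<le> u g' + \<epsilon> * v g'" using e that by blast
    ultimately show ?thesis by linarith
  qed
  ultimately show ?case using d by auto
qed (auto intro: exI[of _ 1])

text \<open>At the apex of one cone all inequalities of the other are strict. A direction that
  violates exactly one inequality of the first cone, scaled down enough, therefore violates exactly
  that one of the intersection.\<close>

lemma num_facets_two_cones:
  fixes p q :: "'a::euclidean_space"
  assumes fin: "finite E" "finite G"
    and pq: "\<forall>g\<in>G. 0 < g \<bullet> (p - q)" and qp: "\<forall>a\<in>E. 0 < a \<bullet> (q - p)"
  shows "num_facets (cone_at E p \<inter> cone_at G q) = num_facets (cone_at E p) + num_facets (cone_at G q)"
proof -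
  obtain M where M: "M \<subseteq> E" "irredundant M" "\<And>p. cone_at M p = cone_at E p"
    using irredundant_subset_exists fin by metis
  obtain L where L: "L \<subseteq> G" "irredundant L" "\<And>p. cone_at L p = cone_at G p"
    using irredundant_subset_exists fin by metis
  have finML: "finite M" "finite L" using M(1) L(1) fin by (auto dest: finite_subset)
  have 1: "num_facets (cone_at M p) = card M"
    using num_facets_cone_at[OF finML(1) M(2)] M qp by blast
  have 2: "num_facets (cone_at L q) = card L"
    using num_facets_cone_at[OF finML(2) L(2)] L pq by blast
  \<comment> \<open>A disjoint sum indexes the inequalities, since the same normal may occur in both
    cones with different bounds.\<close>
  define a where "a = case_sum (\<lambda>m::'a. m) (\<lambda>l::'a. l)"
  define b where "b = case_sum (\<lambda>m. m \<bullet> p) (\<lambda>l. l \<bullet> q)"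
  have abs: "a (Inl m) = m" "a (Inr m) = m" "b (Inl m) = m \<bullet> p" "b (Inr m) = m \<bullet> q" for m
    by (auto simp: a_def b_def)
  have "num_facets (cone_at M p \<inter> cone_at L q) = card (M <+> L)"
  proof (rule num_facets_irredundant[where a = a and b = b and z = "(1/2) *\<^sub>R (p + q)"])
    show "finite (M <+> L)" using finML by simp
    show "cone_at M p \<inter> cone_at L q = {x. \<forall>i\<in>M <+> L. b i \<le> a i \<bullet> x}"
      unfolding Plus_def ball_Un ball_simps cone_at_def by (auto simp: abs inner_diff_right)
    have "0 < m \<bullet> (q - p)" if "m \<in> M" for m using that M qp by blast
    moreover have "0 < l \<bullet> (p - q)" if "l \<in> L" for l using that L pq by blast
    ultimately show "\<forall>i\<in>M <+> L. b i < a i \<bullet> (1 / 2) *\<^sub>R (p + q)"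
      by (auto simp: abs inner_diff_right inner_add_right)
    fix i assume "i \<in> M <+> L"
    then consider m where "i = Inl m" "m \<in> M" | m where "i = Inr m" "m \<in> L" by blast
    then show "\<exists>x. a i \<bullet> x < b i \<and> (\<forall>j\<in>(M <+> L) - {i}. b j \<le> a j \<bullet> x)"
    proof cases
      case 1
      obtain x where x: "m \<bullet> x < 0" "\<forall>b\<in>M-{m}. 0 \<le> b \<bullet> x" using M 1 by (auto simp: irredundant_def)
      obtain \<epsilon> where e: "\<epsilon> > 0" "\<forall>l\<in>L. 0 \<le> l \<bullet> (p - q) + \<epsilon> * (l \<bullet> x)"
        using small_perturbation[OF finML(2), of "\<lambda>l. l \<bullet> (p - q)" "\<lambda>l. l \<bullet> x"] L pq by blast
      show ?thesis
        by (rule exI[of _ "p + \<epsilon> *\<^sub>R x"])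
          (use 1 x e in \<open>auto simp: abs inner_add_right inner_diff_right mult_less_0_iff zero_le_mult_iff\<close>)
    next
      case 2
      obtain x where x: "m \<bullet> x < 0" "\<forall>b\<in>L-{m}. 0 \<le> b \<bullet> x" using L 2 by (auto simp: irredundant_def)
      obtain \<epsilon> where e: "\<epsilon> > 0" "\<forall>l\<in>M. 0 \<le> l \<bullet> (q - p) + \<epsilon> * (l \<bullet> x)"
        using small_perturbation[OF finML(1), of "\<lambda>l. l \<bullet> (q - p)" "\<lambda>l. l \<bullet> x"] M qp by blast
      show ?thesis
        by (rule exI[of _ "q + \<epsilon> *\<^sub>R x"])
          (use 2 x e in \<open>auto simp: abs inner_add_right inner_diff_right mult_less_0_iff zero_le_mult_iff\<close>)
    qed
  qed
  then show ?thesis using 1 2 M L finML by (simp add: card_Plus)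
qed

text \<open>The vectors \<open>y i\<close> form the negative of a dual family of the normals: each
  violates one inequality and makes the others tight, which gives irredundancy at once.\<close>

lemma num_facets_simplicial_cone:
  fixes a :: "'i \<Rightarrow> 'a::euclidean_space"
  assumes "finite I"
    and y: "\<And>i j. i \<in> I \<Longrightarrow> j \<in> I \<Longrightarrow> a j \<bullet> y i = (if j = i then -1 else 0)"
    and z: "\<forall>i\<in>I. 0 < a i \<bullet> (z - p)"
  shows "num_facets (cone_at (a ` I) p) = card I"
proof -
  have "inj_on a I"
  proof (rule inj_onI, rule ccontr)
    fix i j assume "i \<in> I" "j \<in> I" "a i = a j" "i \<noteq> j"
    then show False using y[of i i] y[of i j] by auto
  qed
  moreover have "irredundant (a ` I)"
    unfolding irredundant_def
  proof
    fix x assume "x \<in> a ` I"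
    then obtain i where i: "i \<in> I" "x = a i" by blast
    show "\<exists>xa. x \<bullet> xa < 0 \<and> (\<forall>b\<in>a ` I - {x}. 0 \<le> b \<bullet> xa)"
      by (rule exI[of _ "y i"]) (use i y in \<open>auto split: if_splits\<close>)
  qed
  ultimately show ?thesis
    using num_facets_cone_at[of "a ` I" z p] assms by (simp add: card_image)
qed

section \<open>Wires and crossings of a reduced word\<close>

text \<open>The position of a wire, inverse to \<open>wpos\<close>. It composes on the left, so that
  following one wire downward is a plain recursion.\<close>

fun wp :: "nat list \<Rightarrow> nat \<Rightarrow> nat \<Rightarrow> nat" where
  "wp w 0 = id"
| "wp w (Suc j) = sw (w ! j) \<circ> wp w j"

lemma sw_sw [simp]: "sw a (sw a x) = x"
  by (auto simp: sw_def)

lemma wpos_wp [simp]: "wpos w j (wp w j c) = c"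
  by (induction j) auto

lemma wp_wpos [simp]: "wp w j (wpos w j p) = p"
  by (induction j arbitrary: p) auto

lemma wp_eq_iff [simp]: "wp w j c = wp w j d \<longleftrightarrow> c = d"
  by (metis wpos_wp)

lemma word_perm_append: "word_perm (u @ v) = word_perm u \<circ> word_perm v"
  by (induction u) (auto simp: word_perm_def)

lemma wpos_eq_word_perm: "j \<le> length w \<Longrightarrow> wpos w j = word_perm (take j w)"
proof (induction j)
  case (Suc j)
  then have "take (Suc j) w = take j w @ [w ! j]" by (simp add: take_Suc_conv_app_nth)
  then show ?case using Suc by (simp add: word_perm_append) (simp add: word_perm_def)
qed (simp add: word_perm_def)

lemma wpos_append: "j \<le> length u \<Longrightarrow> wpos (u @ v) j = wpos u j"
  by (induction j) (auto simp: nth_append)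

lemma lw_append: "j < length u \<Longrightarrow> lw (u @ v) j = lw u j"
  and rw_append: "j < length u \<Longrightarrow> rw (u @ v) j = rw u j"
  by (simp_all add: lw_def rw_def wpos_append nth_append)

definition pairs_upto :: "nat \<Rightarrow> (nat \<times> nat) set" where
  "pairs_upto m = {(a, b). 1 \<le> a \<and> a < b \<and> b \<le> m}"

lemma finite_pairs_upto [simp]: "finite (pairs_upto m)"
  by (rule finite_subset[of _ "{..m} \<times> {..m}"]) (auto simp: pairs_upto_def)

lemma card_pairs_upto: "card (pairs_upto (n + 1)) = n * (n + 1) div 2"
proof (induction n)
  case 0
  have "pairs_upto 1 = {}" by (auto simp: pairs_upto_def)
  then show ?case by simp
next
  case (Suc n)
  have "pairs_upto (Suc n + 1) = pairs_upto (n + 1) \<union> (\<lambda>a. (a, n + 2)) ` {1..n+1}"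
    by (auto simp: pairs_upto_def image_iff)
  moreover have "pairs_upto (n + 1) \<inter> (\<lambda>a. (a, n + 2)) ` {1..n+1} = {}"
    by (auto simp: pairs_upto_def)
  moreover have "card ((\<lambda>a. (a, n + 2)) ` {1..n+1}) = n + 1"
    by (subst card_image) (auto simp: inj_on_def)
  ultimately have "card (pairs_upto (Suc n + 1)) = n * (n + 1) div 2 + (n + 1)"
    using Suc by (simp add: card_Un_disjoint)
  then show ?case by simp
qed

text \<open>The virtual wire \<open>0\<close> stands for the bottom of the diagram.\<close>

definition nd :: "nat list \<Rightarrow> nat \<Rightarrow> nat \<Rightarrow> nat" where
  "nd w a b = (if a = 0 \<or> b = 0 then length w
     else THE j. j < length w \<and> {lw w j, rw w j} = {a, b})"

lemma nd_sym: "nd w a b = nd w b a"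
  by (simp add: nd_def insert_commute disj_commute)

lemma nd_0 [simp]: "nd w a 0 = length w" "nd w 0 a = length w"
  by (simp_all add: nd_def)

text \<open>The axiom of admissible orders of inversions (each triple is ordered lexicographically
  or in reverse), stated for heights. Only crossings with a common wire are compared.\<close>

definition arr :: "nat \<Rightarrow> (nat \<Rightarrow> nat \<Rightarrow> nat) \<Rightarrow> bool" where
  "arr m h \<longleftrightarrow> (\<forall>a b. h a b = h b a) \<and>
     (\<forall>a b c. 1 \<le> a \<and> a < b \<and> b < c \<and> c \<le> m \<longrightarrow>
        (h a b < h a c \<and> h a c < h b c) \<or> (h b c < h a c \<and> h a c < h a b))"

locale rword =
  fixes n :: nat and w :: "nat list"
  assumes red: "w \<in> red_w0 n"
begin

lemma length_w: "length w = n * (n + 1) div 2" using red by (simp add: red_w0_def)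

lemma letter: "j < length w \<Longrightarrow> 1 \<le> w ! j \<and> w ! j \<le> n"
proof -
  assume "j < length w"
  then have "w ! j \<in> {1..n}" using red nth_mem[of j w] unfolding red_w0_def by blast
  then show ?thesis by simp
qed

lemma wp_range: "j \<le> length w \<Longrightarrow> wp w j c \<in> {1..n+1} \<longleftrightarrow> c \<in> {1..n+1}"
proof (induction j)
  case (Suc j)
  then have "wp w (Suc j) c \<in> {1..n+1} \<longleftrightarrow> wp w j c \<in> {1..n+1}"
    using letter[of j] by (auto simp: sw_def)
  then show ?case using Suc by simp
qed simp

lemma wpos_range: "j \<le> length w \<Longrightarrow> wpos w j p \<in> {1..n+1} \<longleftrightarrow> p \<in> {1..n+1}"
  using wp_range[of j "wpos w j p"] by simp

lemma wpos_end: "p \<in> {1..n+1} \<Longrightarrow> wpos w (length w) p = n + 2 - p"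
  using red by (simp add: wpos_eq_word_perm red_w0_def)

lemma wp_end: "c \<in> {1..n+1} \<Longrightarrow> wp w (length w) c = n + 2 - c"
proof -
  assume c: "c \<in> {1..n+1}"
  then have "wpos w (length w) (n + 2 - c) = c" by (subst wpos_end) auto
  then show ?thesis by (metis wp_wpos)
qed

lemma lw_rw_range: "j < length w \<Longrightarrow> lw w j \<in> {1..n+1}" "j < length w \<Longrightarrow> rw w j \<in> {1..n+1}"
  using wpos_range[of j "w ! j"] wpos_range[of j "w ! j + 1"] letter[of j] by (auto simp: lw_def rw_def)

lemma lw_neq_rw: "lw w j \<noteq> rw w j"
  by (metis lw_def rw_def wp_wpos n_not_Suc_n Suc_eq_plus1)

definition inv_set :: "nat \<Rightarrow> (nat \<times> nat) set" where
  "inv_set t = {(a, b) \<in> pairs_upto (n + 1). wp w t b < wp w t a}"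

lemma finite_inv_set [simp]: "finite (inv_set t)"
  by (rule finite_subset[OF _ finite_pairs_upto]) (auto simp: inv_set_def)

lemma wp_Suc: "wp w (Suc j) c = (if c = lw w j then w ! j + 1 else if c = rw w j then w ! j else wp w j c)"
proof -
  have "wp w j c = w ! j \<longleftrightarrow> c = lw w j" "wp w j c = w ! j + 1 \<longleftrightarrow> c = rw w j"
    by (metis lw_def wp_wpos wpos_wp, metis rw_def wp_wpos wpos_wp)
  then show ?thesis by (auto simp: sw_def)
qed

lemma wp_lw: "wp w j (lw w j) = w ! j" and wp_rw: "wp w j (rw w j) = w ! j + 1"
  by (simp_all add: lw_def rw_def)

lemma wp_Suc_less:
  assumes "{a, b} \<noteq> {lw w j, rw w j}" "a \<noteq> b"
  shows "wp w (Suc j) b < wp w (Suc j) a \<longleftrightarrow> wp w j b < wp w j a"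
proof -
  have "wp w j a = w ! j \<longleftrightarrow> a = lw w j" "wp w j a = w ! j + 1 \<longleftrightarrow> a = rw w j"
    "wp w j b = w ! j \<longleftrightarrow> b = lw w j" "wp w j b = w ! j + 1 \<longleftrightarrow> b = rw w j"
    by (metis lw_def wp_wpos wpos_wp, metis rw_def wp_wpos wpos_wp,
        metis lw_def wp_wpos wpos_wp, metis rw_def wp_wpos wpos_wp)
  then have ne: "wp w j a \<noteq> w ! j \<or> wp w j b \<noteq> w ! j + 1" "wp w j b \<noteq> w ! j \<or> wp w j a \<noteq> w ! j + 1"
    using assms by auto
  have "wp w j a \<noteq> wp w j b" using assms by simp
  then show ?thesis using ne by (auto simp: sw_def)
qed

lemma inv_set_Suc:
  assumes "j < length w"
  shows "inv_set (Suc j) = (if lw w j < rw w j then insert (lw w j, rw w j) (inv_set j)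
           else inv_set j - {(rw w j, lw w j)})"
proof -
  have r: "lw w j \<in> {1..n+1}" "rw w j \<in> {1..n+1}" "lw w j \<noteq> rw w j"
    using lw_rw_range assms lw_neq_rw by auto
  have "x \<in> inv_set (Suc j) \<longleftrightarrow> x \<in> inv_set j"
    if "x \<noteq> (lw w j, rw w j)" "x \<noteq> (rw w j, lw w j)" for x
  proof (cases x)
    case (Pair a b)
    then have "a < b \<Longrightarrow> {a, b} \<noteq> {lw w j, rw w j}" using that by (auto simp: doubleton_eq_iff)
    then show ?thesis using wp_Suc_less[of a b j] Pair by (auto simp: inv_set_def pairs_upto_def)
  qed
  moreover have "(lw w j, rw w j) \<in> inv_set (Suc j) \<longleftrightarrow> lw w j < rw w j"
    using r by (auto simp: inv_set_def pairs_upto_def wp_Suc simp del: wp.simps)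
  moreover have "(rw w j, lw w j) \<notin> inv_set (Suc j)"
    using r by (auto simp: inv_set_def pairs_upto_def wp_Suc simp del: wp.simps)
  moreover have "(lw w j, rw w j) \<notin> inv_set j"
    by (auto simp: inv_set_def wp_lw wp_rw)
  moreover have "(rw w j, lw w j) \<in> inv_set j \<longleftrightarrow> rw w j < lw w j"
    using r by (auto simp: inv_set_def pairs_upto_def wp_lw wp_rw)
  ultimately have "x \<in> inv_set (Suc j) \<longleftrightarrow> x \<in> (if lw w j < rw w j then insert (lw w j, rw w j) (inv_set j)
           else inv_set j - {(rw w j, lw w j)})" for x
    using r by (cases "x = (lw w j, rw w j)"; cases "x = (rw w j, lw w j)") auto
  then show ?thesis by blast
qed

lemma inv_set_0: "inv_set 0 = {}" by (auto simp: inv_set_def pairs_upto_def)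

lemma inv_set_end: "inv_set (length w) = pairs_upto (n + 1)"
  by (auto simp: inv_set_def pairs_upto_def wp_end)

lemma card_inv_set_Suc: "j < length w \<Longrightarrow> card (inv_set (Suc j)) \<le> Suc (card (inv_set j))"
  by (auto simp: inv_set_Suc card_insert_if intro: order_trans[OF card_Diff1_le])

text \<open>A crossing raises the number of inversions by at most one, and the
  \<open>length w\<close> crossings have to produce all pairs, which are equally many; so each
  crossing raises it by exactly one. In particular no two wires cross back.\<close>

lemma card_inv_set: "j \<le> length w \<Longrightarrow> card (inv_set j) = j"
proof -
  assume j: "j \<le> length w"
  have up: "i \<le> length w \<Longrightarrow> card (inv_set i) \<le> i" for i
    by (induction i) (use card_inv_set_Suc inv_set_0 in \<open>auto simp: Suc_le_eq intro: le_trans\<close>)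
  have "i \<le> length w \<Longrightarrow> length w \<le> card (inv_set i) + (length w - i)" for i
  proof (induction "length w - i" arbitrary: i)
    case 0
    then have "i = length w" by simp
    then show ?case using inv_set_end card_pairs_upto length_w by simp
  next
    case (Suc d)
    then have "length w \<le> card (inv_set (Suc i)) + (length w - Suc i)" by simp
    then show ?case using card_inv_set_Suc[of i] Suc.hyps(2) Suc.prems by linarith
  qed
  then show ?thesis using up[OF j] j by fastforce
qed

lemma lw_less_rw: "j < length w \<Longrightarrow> lw w j < rw w j"
proof (rule ccontr)
  assume j: "j < length w" "\<not> lw w j < rw w j"
  then have "card (inv_set (Suc j)) \<le> card (inv_set j)"
    by (simp add: inv_set_Suc card_Diff1_le)
  then show False using card_inv_set[of j] card_inv_set[of "Suc j"] j by simp
qed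

lemma inv_set_eq: "t \<le> length w \<Longrightarrow> inv_set t = (\<lambda>j. (lw w j, rw w j)) ` {..<t}"
  by (induction t) (auto simp: inv_set_0 inv_set_Suc lw_less_rw lessThan_Suc)

lemma inj_crossing: "inj_on (\<lambda>j. (lw w j, rw w j)) {..<length w}"
  by (rule eq_card_imp_inj_on) (simp_all add: inv_set_eq[symmetric] card_inv_set)

lemma nd_lw_rw: "j < length w \<Longrightarrow> nd w (lw w j) (rw w j) = j"
proof -
  assume j: "j < length w"
  have "lw w j \<noteq> 0" "rw w j \<noteq> 0" using lw_rw_range[OF j] by auto
  moreover have "(THE i. i < length w \<and> {lw w i, rw w i} = {lw w j, rw w j}) = j"
  proof (rule the_equality)
    fix i assume i: "i < length w \<and> {lw w i, rw w i} = {lw w j, rw w j}"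
    then have "(lw w i, rw w i) = (lw w j, rw w j)"
      using lw_less_rw[of i] lw_less_rw[of j] j by (auto simp: doubleton_eq_iff)
    then show "i = j" using inj_crossing i j by (auto dest: inj_onD)
  qed (use j in auto)
  ultimately show ?thesis by (simp add: nd_def)
qed

lemma nd_less:
  assumes "1 \<le> a" "a < b" "b \<le> n + 1"
  shows "nd w a b < length w" "lw w (nd w a b) = a" "rw w (nd w a b) = b"
proof -
  have "(a, b) \<in> inv_set (length w)" using assms by (auto simp: inv_set_end pairs_upto_def)
  then obtain j where "j < length w" "lw w j = a" "rw w j = b" by (auto simp: inv_set_eq)
  then show "nd w a b < length w" "lw w (nd w a b) = a" "rw w (nd w a b) = b"
    using nd_lw_rw by auto
qed

lemma nd_less': "a \<in> {1..n+1} \<Longrightarrow> b \<in> {1..n+1} \<Longrightarrow> a \<noteq> b \<Longrightarrow> nd w a b < length w"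
  using nd_less[of a b] nd_less[of b a] nd_sym[of w a b] by (cases a b rule: linorder_cases) auto

lemma nd_wires: "a \<in> {1..n+1} \<Longrightarrow> b \<in> {1..n+1} \<Longrightarrow> a \<noteq> b \<Longrightarrow>
   {lw w (nd w a b), rw w (nd w a b)} = {a, b}"
  using nd_less[of a b] nd_less[of b a] nd_sym[of w a b] by (cases a b rule: linorder_cases) auto

lemma nd_inj:
  assumes "a \<in> {1..n+1}" "b \<in> {1..n+1}" "a \<noteq> b" "c \<in> {1..n+1}" "d \<in> {1..n+1}" "c \<noteq> d" "nd w a b = nd w c d"
  shows "{a, b} = {c, d}"
  using nd_wires[of a b] nd_wires[of c d] assms by simp

lemma crossed_iff:
  assumes "1 \<le> a" "a < b" "b \<le> n + 1" "t \<le> length w"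
  shows "wp w t b < wp w t a \<longleftrightarrow> nd w a b < t"
proof -
  have "wp w t b < wp w t a \<longleftrightarrow> (a, b) \<in> inv_set t" using assms by (auto simp: inv_set_def pairs_upto_def)
  also have "\<dots> \<longleftrightarrow> nd w a b < t"
  proof
    assume "(a, b) \<in> inv_set t"
    then show "nd w a b < t" using nd_lw_rw assms by (auto simp: inv_set_eq)
  next
    assume "nd w a b < t"
    then show "(a, b) \<in> inv_set t" using nd_less[of a b] assms by (force simp: inv_set_eq)
  qed
  finally show ?thesis .
qed

text \<open>If ac were the first of the three crossings, the positions right after it would satisfy
  a < b < c < a; if it were the last, those right before it would satisfy c < b < a < c.\<close>

lemma arr_nd: "arr (n + 1) (nd w)"
  unfolding arr_def
proof (intro conjI allI impI)
  fix a b c assume abc: "1 \<le> a \<and> a < b \<and> b < c \<and> c \<le> n + 1"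
  have ne: "nd w a b \<noteq> nd w a c" "nd w a c \<noteq> nd w b c" "nd w a b \<noteq> nd w b c"
  proof -
    have "{a, b} \<noteq> {a, c}" "{a, c} \<noteq> {b, c}" "{a, b} \<noteq> {b, c}" using abc by auto
    moreover have "a \<in> {1..n+1}" "b \<in> {1..n+1}" "c \<in> {1..n+1}" "a \<noteq> b" "b \<noteq> c" "a \<noteq> c" using abc by auto
    ultimately show "nd w a b \<noteq> nd w a c" "nd w a c \<noteq> nd w b c" "nd w a b \<noteq> nd w b c"
      using nd_inj[of a b a c] nd_inj[of a c b c] nd_inj[of a b b c] by blast+
  qed
  have l: "nd w a c < length w" using nd_less abc by auto
  have neg: "wp w t b < wp w t a \<longleftrightarrow> nd w a b < t" "wp w t c < wp w t a \<longleftrightarrow> nd w a c < t"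
    "wp w t c < wp w t b \<longleftrightarrow> nd w b c < t" if "t \<le> length w" for t
    using crossed_iff that abc by auto
  have "\<not> (nd w a c < nd w a b \<and> nd w a c < nd w b c)"
    using neg[of "Suc (nd w a c)"] l wp_eq_iff[of w "Suc (nd w a c)"] abc by (auto simp: less_Suc_eq simp del: wp.simps wp_eq_iff)
  moreover have "\<not> (nd w a b < nd w a c \<and> nd w b c < nd w a c)"
    using neg[of "nd w a c"] l by auto
  ultimately show "nd w a b < nd w a c \<and> nd w a c < nd w b c \<or> nd w b c < nd w a c \<and> nd w a c < nd w a b"
    using ne by linarith
qed (rule nd_sym)

lemma on_wire_iff: "b \<in> {1..n+1} \<Longrightarrow> on_wire w j b \<longleftrightarrow> (\<exists>c\<in>{1..n+1}-{b}. j = nd w b c)"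
proof
  assume b: "b \<in> {1..n+1}" and "on_wire w j b"
  then have j: "j < length w" "b = lw w j \<or> b = rw w j" by (auto simp: on_wire_def)
  have "j = nd w (lw w j) (rw w j)" "j = nd w (rw w j) (lw w j)"
    using nd_lw_rw[OF j(1)] nd_sym by metis+
  then show "\<exists>c\<in>{1..n+1}-{b}. j = nd w b c"
    using j lw_rw_range[OF j(1)] lw_less_rw[OF j(1)] by auto
next
  assume b: "b \<in> {1..n+1}" and "\<exists>c\<in>{1..n+1}-{b}. j = nd w b c"
  then show "on_wire w j b" using nd_wires[of b] nd_less'[of b] by (fastforce simp: on_wire_def)
qed

lemma other_nd: "b \<in> {1..n+1} \<Longrightarrow> c \<in> {1..n+1} \<Longrightarrow> b \<noteq> c \<Longrightarrow> other w (nd w b c) b = c"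
  using nd_wires[of b c] by (auto simp: other_def doubleton_eq_iff)

end

section \<open>Switch lists\<close>

text \<open>
  A rigorous path is recorded by the list of wires it travels on. Between two switches it runs
  straight along a wire, so only the wires on which a straight pass is forbidden matter:
  \<open>turn h k x b c\<close> says that a path in \<open>G(k)\<close> that has come onto wire \<open>b\<close> from wire \<open>x\<close> may
  continue along \<open>b\<close> up to the crossing with \<open>c\<close>, where \<open>h a b\<close> is the height (counted from the
  top) of the crossing of \<open>a\<close> and \<open>b\<close>. The first and the last segment are unconstrained.
\<close>

definition turn :: "(nat \<Rightarrow> nat \<Rightarrow> nat) \<Rightarrow> nat \<Rightarrow> nat \<Rightarrow> nat \<Rightarrow> nat \<Rightarrow> bool" where
  "turn h k x b c \<longleftrightarrow> (if k < b
     then h b x < h b c \<and> (\<forall>d. k < d \<and> d < b \<longrightarrow> \<not> (h b x < h b d \<and> h b d < h b c))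
     else h b c < h b x \<and> (\<forall>d. b < d \<and> d \<le> k \<longrightarrow> \<not> (h b c < h b d \<and> h b d < h b x)))"

fun turns :: "(nat \<Rightarrow> nat \<Rightarrow> nat) \<Rightarrow> nat \<Rightarrow> nat list \<Rightarrow> bool" where
  "turns h k (x # b # c # bs) \<longleftrightarrow> x \<noteq> b \<and> turn h k x b c \<and> turns h k (b # c # bs)"
| "turns h k [x, b] \<longleftrightarrow> x \<noteq> b"
| "turns h k [x] \<longleftrightarrow> True"
| "turns h k [] \<longleftrightarrow> True"

text \<open>Restricting the wires to p..q gives the paths of the subdiagram on these wires: the
  wires that can forbid a straight pass on b lie between b and k, hence in the interval too.
  Arguments on intervals can thus stay inside one diagram.\<close>

definition gp :: "(nat \<Rightarrow> nat \<Rightarrow> nat) \<Rightarrow> nat \<Rightarrow> nat \<Rightarrow> nat \<Rightarrow> nat list \<Rightarrow> bool" where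
  "gp h p q k bs \<longleftrightarrow> bs \<noteq> [] \<and> hd bs = k \<and> last bs = Suc k \<and> set bs \<subseteq> {p..q} \<and> turns h k bs"

fun val :: "(nat \<Rightarrow> nat \<Rightarrow> 'a::comm_monoid_add) \<Rightarrow> nat list \<Rightarrow> 'a" where
  "val f (x # y # bs) = f x y + val f (y # bs)"
| "val f [x] = 0"
| "val f [] = 0"

lemma gp_range: "gp h p q k bs \<Longrightarrow> p \<le> k \<and> k < q"
  unfolding gp_def using hd_in_set[of bs] last_in_set[of bs] by auto

lemma turns_ConsD: "turns h k (x # bs) \<Longrightarrow> turns h k bs"
  by (cases bs; cases "tl bs") auto

lemma turns_hd_neq: "turns h k (x # b # bs) \<Longrightarrow> x \<noteq> b"
  by (cases bs) auto

text \<open>\<open>turn\<close> compares only crossings on one wire. This is what carries paths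
  along 2-moves, contractions and relabellings.\<close>

lemma turns_cong:
  assumes "\<And>b c d. \<lbrakk>b \<in> {p..q}; c \<in> {p..q}; d \<in> {p..q}; b \<noteq> c; b \<noteq> d\<rbrakk> \<Longrightarrow> h b c < h b d \<longleftrightarrow> h' b c < h' b d"
    and "set bs \<subseteq> {p..q}" "k \<in> {p..q}"
  shows "turns h k bs \<longleftrightarrow> turns h' k bs"
  using assms(2)
proof (induction bs rule: induct_list012)
  case (3 x b zs)
  show ?case
  proof (cases "x \<noteq> b \<and> zs \<noteq> [] \<and> b \<noteq> hd zs")
    case True
    then obtain c bs where zs: "zs = c # bs" by (cases zs) auto
    note 1 = 3[unfolded zs] and True = True[unfolded zs, simplified]
    have "turn h k x b c \<longleftrightarrow> turn h' k x b c"
    proof (cases "k < b")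
      case kb: True
      have "h b x < h b d \<longleftrightarrow> h' b x < h' b d" "h b d < h b c \<longleftrightarrow> h' b d < h' b c"
        if "k < d" "d < b" for d
        using assms(1)[of b x d] assms(1)[of b d c] 1(3) True that assms(3) by auto
      moreover have "h b x < h b c \<longleftrightarrow> h' b x < h' b c" using assms(1)[of b x c] 1(3) True by auto
      ultimately show ?thesis using kb unfolding turn_def by auto
    next
      case kb: False
      have "h b c < h b d \<longleftrightarrow> h' b c < h' b d" "h b d < h b x \<longleftrightarrow> h' b d < h' b x"
        if "b < d" "d \<le> k" for d
        using assms(1)[of b c d] assms(1)[of b d x] 1(3) True that assms(3) by auto
      moreover have "h b c < h b x \<longleftrightarrow> h' b c < h' b x" using assms(1)[of b c x] 1(3) True by auto
      ultimately show ?thesis using kb unfolding turn_def by auto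
    qed
    then show ?thesis using 1 zs by simp
  next
    case False
    then show ?thesis using turns_hd_neq[of _ k b "hd zs" "tl zs"] by (cases zs) auto
  qed
qed auto

lemma gp_cong:
  assumes "\<And>b c d. \<lbrakk>b \<in> {p..q}; c \<in> {p..q}; d \<in> {p..q}; b \<noteq> c; b \<noteq> d\<rbrakk> \<Longrightarrow> h b c < h b d \<longleftrightarrow> h' b c < h' b d"
  shows "gp h p q k bs \<longleftrightarrow> gp h' p q k bs"
proof (cases "set bs \<subseteq> {p..q} \<and> bs \<noteq> [] \<and> hd bs = k")
  case True
  then have "k \<in> {p..q}" using hd_in_set[of bs] by blast
  then show ?thesis using turns_cong[of p q h h' bs k] assms True by (simp add: gp_def)
qed (auto simp: gp_def)

lemma turn_shift: "turn h (Suc k) (Suc x) (Suc b) (Suc c) \<longleftrightarrow> turn (\<lambda>a b. h (Suc a) (Suc b)) k x b c"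
proof -
  have 1: "(\<forall>d. Suc k < d \<and> d < Suc b \<longrightarrow> P d) \<longleftrightarrow> (\<forall>d. k < d \<and> d < b \<longrightarrow> P (Suc d))" for P
    by (metis Suc_less_eq Suc_less_eq2 less_nat_zero_code not0_implies_Suc)
  have 2: "(\<forall>d. Suc b < d \<and> d \<le> Suc k \<longrightarrow> P d) \<longleftrightarrow> (\<forall>d. b < d \<and> d \<le> k \<longrightarrow> P (Suc d))" for P
    by (metis Suc_le_mono Suc_less_eq Suc_less_eq2)
  show ?thesis unfolding turn_def 1 2 by simp
qed

lemma turns_shift: "turns h (Suc k) (map Suc bs) \<longleftrightarrow> turns (\<lambda>a b. h (Suc a) (Suc b)) k bs"
  by (induction h k bs rule: turns.induct) (auto simp: turn_shift)

lemma gp_shift: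
  "gp h (Suc p) (Suc q) (Suc k) (map Suc bs) \<longleftrightarrow> gp (\<lambda>a b. h (Suc a) (Suc b)) p q k bs"
  by (auto simp: gp_def turns_shift hd_map last_map image_subset_iff)

lemma val_map: "val f (map g bs) = val (\<lambda>a b. f (g a) (g b)) bs"
  by (induction "\<lambda>a b. f (g a) (g b)" bs rule: val.induct) auto

lemma val_cong:
  assumes "\<And>a b. a \<in> set bs \<Longrightarrow> b \<in> set bs \<Longrightarrow> f a b = g a b"
  shows "val f bs = val g bs"
  using assms by (induction f bs rule: val.induct) auto

lemma val_telescope:
  fixes \<mu> :: "nat \<Rightarrow> 'a::ab_group_add"
  shows "bs \<noteq> [] \<Longrightarrow> val (\<lambda>a b. \<mu> b - \<mu> a) bs = \<mu> (last bs) - \<mu> (hd bs)"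
  by (induction "\<lambda>a b. \<mu> b - \<mu> a" bs rule: val.induct) auto

text \<open>A topological numbering of \<open>G(k)\<close>: it increases along every wire in the
  direction of travel, which is downward for b > k and upward otherwise.\<close>

definition potential :: "nat \<Rightarrow> (nat \<Rightarrow> nat \<Rightarrow> nat) \<Rightarrow> nat \<Rightarrow> (nat \<Rightarrow> nat \<Rightarrow> real) \<Rightarrow> bool" where
  "potential m h k \<Phi> \<longleftrightarrow>
     (\<forall>b\<in>{1..m}. \<forall>c\<in>{1..m}-{b}. \<Phi> b c = \<Phi> c b) \<and>
     (\<forall>b\<in>{1..m}. \<forall>c\<in>{1..m}-{b}. \<forall>d\<in>{1..m}-{b}. h b c < h b d \<longrightarrow>
        (if k < b then \<Phi> b c < \<Phi> b d else \<Phi> b d < \<Phi> b c))"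

lemma arr_triple:
  assumes "arr m h" "1 \<le> a" "a < b" "b < c" "c \<le> m"
  shows "(h a b < h a c \<and> h b a < h b c \<and> h c a < h c b) \<or> (h a c < h a b \<and> h b c < h b a \<and> h c b < h c a)"
proof -
  have "h a b = h b a" "h a c = h c a" "h b c = h c b" using assms by (auto simp: arr_def)
  moreover have "(h a b < h a c \<and> h a c < h b c) \<or> (h b c < h a c \<and> h a c < h a b)"
    using assms unfolding arr_def by blast
  ultimately show ?thesis by linarith
qed

lemma arr_neq:
  assumes "arr m h" "a \<in> {1..m}" "b \<in> {1..m}" "c \<in> {1..m}" "a \<noteq> b" "b \<noteq> c" "a \<noteq> c"
  shows "h a b \<noteq> h a c"
proof -
  have t: "x \<in> {1..m} \<Longrightarrow> y \<in> {1..m} \<Longrightarrow> z \<in> {1..m} \<Longrightarrow> x < y \<Longrightarrow> y < z \<Longrightarrow>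
     h x y \<noteq> h x z \<and> h y x \<noteq> h y z \<and> h z x \<noteq> h z y" for x y z
    using arr_triple[of m h x y z] assms(1) by auto
  consider "a < b" "b < c" | "a < c" "c < b" | "b < a" "a < c" | "b < c" "c < a" | "c < a" "a < b" | "c < b" "b < a"
    using assms(5-7) by linarith
  then show ?thesis
    using t[of a b c] t[of a c b] t[of b a c] t[of b c a] t[of c a b] t[of c b a] assms(2-4) by cases metis+
qed

text \<open>
  The acyclicity of \<open>G(k)\<close>: turning wire \<open>k + 1\<close> upside down amounts to performing all crossings
  on one side of it first, then those on it in reverse order, then the remaining ones.
\<close>

lemma potential_exists:
  assumes arr: "arr m h"
  shows "\<exists>\<Phi>. potential m h k \<Phi>"
proof (induction k)
  case 0
  have "potential m h 0 (\<lambda>a b. real (h a b))"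
    using arr by (auto simp: potential_def arr_def)
  then show ?case by blast
next
  case (Suc k)
  then obtain \<Phi> where "potential m h k \<Phi>" by blast
  then have sym: "\<Phi> b c = \<Phi> c b" if "b \<in> {1..m}" "c \<in> {1..m}" "b \<noteq> c" for b c
    using that unfolding potential_def by auto
  have mono: "if k < b then \<Phi> b c < \<Phi> b d else \<Phi> b d < \<Phi> b c"
    if "b \<in> {1..m}" "c \<in> {1..m}" "d \<in> {1..m}" "b \<noteq> c" "b \<noteq> d" "h b c < h b d" for b c d
    using \<open>potential m h k \<Phi>\<close> that unfolding potential_def by auto
  define K where "K = Suc k"
  \<comment> \<open>\<open>R\<close> bounds all values, so shifts by \<open>2 * R\<close> separate
    three blocks: the crossings on one side of wire \<open>K\<close>, those on \<open>K\<close> with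
    reversed sign, and those on the other side.\<close>
  define R where "R = 1 + (\<Sum>x\<in>{1..m}\<times>{1..m}. \<bar>\<Phi> (fst x) (snd x)\<bar>)"
  have R: "\<bar>\<Phi> a b\<bar> < R" if "a \<in> {1..m}" "b \<in> {1..m}" for a b
    using member_le_sum[of "(a, b)" "{1..m}\<times>{1..m}" "\<lambda>x. \<bar>\<Phi> (fst x) (snd x)\<bar>"] that by (simp add: R_def)
  define B where "B c d \<longleftrightarrow> \<Phi> c d < \<Phi> c K" for c d
  define \<Psi> where "\<Psi> c d = (if c = K \<or> d = K then - \<Phi> c d else if B c d then \<Phi> c d - 2 * R else \<Phi> c d + 2 * R)" for c d
  \<comment> \<open>The side of \<open>K\<close> on which the crossing of c and d lies is read off
    on c; the order axiom for c, d and \<open>K\<close> shows that d gives the same answer.\<close>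
  have B: "B c d \<longleftrightarrow> B d c" if cd: "c \<in> {1..m}" "d \<in> {1..m}" "c < d" "c \<noteq> K" "d \<noteq> K" and K: "K \<in> {1..m}" for c d
  proof -
    have m: "h b x < h b y \<Longrightarrow> b \<noteq> x \<Longrightarrow> b \<noteq> y \<Longrightarrow> (if k < b then \<Phi> b x < \<Phi> b y else \<Phi> b y < \<Phi> b x)"
      if "b \<in> {c, d, K}" "x \<in> {c, d, K}" "y \<in> {c, d, K}" for b x y
      using mono[of b x y] that cd K by auto
    consider "K < c" | "c < K" "K < d" | "d < K" using cd by linarith
    then show ?thesis
    proof cases
      case 1
      then show ?thesis
        using arr_triple[OF arr, of K c d] m[of c d K] m[of c K d] m[of d c K] m[of d K c] cd K
        unfolding B_def by (auto simp: K_def)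
    next
      case 2
      then show ?thesis
        using arr_triple[OF arr, of c K d] m[of c d K] m[of c K d] m[of d c K] m[of d K c] cd K
        unfolding B_def by (auto simp: K_def)
    next
      case 3
      then show ?thesis
        using arr_triple[OF arr, of c d K] m[of c d K] m[of c K d] m[of d c K] m[of d K c] cd K
        unfolding B_def by (auto simp: K_def)
    qed
  qed
  show ?case
  proof (cases "K \<in> {1..m}")
    case False
    then have "potential m h (Suc k) \<Phi>"
      using sym mono by (auto simp: potential_def K_def dest: less_antisym)
    then show ?thesis by blast
  next
    case K: True
    have "\<Psi> b c = \<Psi> c b" if "b \<in> {1..m}" "c \<in> {1..m}" "b \<noteq> c" for b c
      using that B[of b c] B[of c b] sym[of b c] K by (cases b c rule: linorder_cases) (auto simp: \<Psi>_def)
    moreover have step: "\<Psi> b c < \<Psi> b d" if "b \<in> {1..m}" "c \<in> {1..m}" "d \<in> {1..m}" "b \<noteq> K" "\<Phi> b c < \<Phi> b d" for b c d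
      using that R[of b c] R[of b d] R[of b K] K by (auto simp: \<Psi>_def B_def)
    moreover have "if Suc k < b then \<Psi> b c < \<Psi> b d else \<Psi> b d < \<Psi> b c"
      if "b \<in> {1..m}" "c \<in> {1..m}" "d \<in> {1..m}" "b \<noteq> c" "b \<noteq> d" "h b c < h b d" for b c d
    proof (cases "b = K")
      case True
      then show ?thesis using mono[OF that] by (auto simp: \<Psi>_def K_def)
    next
      case False
      then have "k < b \<longleftrightarrow> Suc k < b" by (auto simp: K_def)
      then show ?thesis using mono[OF that] step[of b c d] step[of b d c] that False by auto
    qed
    ultimately have "potential m h (Suc k) \<Psi>" by (auto simp: potential_def)
    then show ?thesis by blast
  qed
qed

text \<open>Successive switches climb the potential; so no path switches twice at the same node, and
  a wire cannot be revisited against its direction.\<close>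

lemma turns_increasing:
  assumes pot: "potential m h k \<Phi>" and "set bs \<subseteq> {1..m}" "turns h k bs"
  shows "sorted_wrt (\<lambda>(a, b) (c, d). \<Phi> a b < \<Phi> c d) (zip bs (tl bs))"
  using assms(2,3)
proof (induction bs rule: induct_list012)
  case (3 x b zs)
  have IH: "sorted_wrt (\<lambda>(a, b) (c, d). \<Phi> a b < \<Phi> c d) (zip (b # zs) (tl (b # zs)))"
    using 3 turns_ConsD by auto
  show ?case
  proof (cases zs)
    case (Cons c r)
    have t: "turn h k x b c" "x \<noteq> b" "turns h k (b # c # r)" using 3(4) Cons by auto
    have bc: "b \<noteq> c" using t turns_hd_neq by blast
    have r: "b \<in> {1..m}" "x \<in> {1..m} - {b}" "c \<in> {1..m} - {b}" using 3(3) Cons t bc by auto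
    have "if k < b then \<Phi> b y < \<Phi> b z else \<Phi> b z < \<Phi> b y"
      if "y \<in> {1..m} - {b}" "z \<in> {1..m} - {b}" "h b y < h b z" for y z
      using pot r(1) that unfolding potential_def by blast
    then have "\<Phi> b x < \<Phi> b c" using t(1) r unfolding turn_def by meson
    moreover have "\<Phi> x b = \<Phi> b x" using pot r unfolding potential_def by (metis DiffD1 r(1,2))
    moreover have "transp (\<lambda>(a, b) (c, d). \<Phi> a b < (\<Phi> c d :: real))" by (auto simp: transp_def)
    ultimately show ?thesis using IH Cons by (auto simp: sorted_wrt2 intro: less_trans)
  qed auto
qed auto

section \<open>Rigorous paths as switch lists\<close>

definition passable :: "nat \<Rightarrow> nat \<Rightarrow> nat \<Rightarrow> bool" where
  "passable k a c \<longleftrightarrow> \<not> (k < a \<and> k < c \<and> c < a) \<and> \<not> (a \<le> k \<and> c \<le> k \<and> a < c)"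

text \<open>Recursive form of \<open>rigorous\<close>: the path is on wire b and has just left node
  j. The start at the lower end of wire k corresponds to j = \<open>length w\<close>.\<close>

fun rpath :: "nat list \<Rightarrow> nat \<Rightarrow> nat \<Rightarrow> nat \<Rightarrow> (nat \<times> nat \<times> nat) list \<Rightarrow> bool" where
  "rpath w k b j [] \<longleftrightarrow> b = k + 1 \<and> next_node w k b j = None"
| "rpath w k b j ((i, a, b') # ps) \<longleftrightarrow> a = b \<and> next_node w k b j = Some i \<and>
     (b' = b \<or> b' = other w i b) \<and> (b' = b \<longrightarrow> passable k b (other w i b)) \<and> rpath w k b' i ps"

lemma next_node_Some_iff:
  "next_node w k b j = Some i \<longleftrightarrow> on_wire w i b \<and>
     (if b \<le> k then i < j \<and> (\<forall>l. on_wire w l b \<and> l < j \<longrightarrow> l \<le> i)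
      else j < i \<and> (\<forall>l. on_wire w l b \<and> j < l \<longrightarrow> i \<le> l))"
proof -
  have fin: "finite {l. l < j \<and> on_wire w l b}" "finite {l. j < l \<and> on_wire w l b}"
    by (auto intro: finite_subset[of _ "{..<length w}"] simp: on_wire_def)
  have 1: "Max {l. l < j \<and> on_wire w l b} = i \<longleftrightarrow> on_wire w i b \<and> i < j \<and> (\<forall>l. on_wire w l b \<and> l < j \<longrightarrow> l \<le> i)"
    if "\<exists>l<j. on_wire w l b"
    using that fin(1) by (subst Max_eq_iff) auto
  have 2: "Min {l. j < l \<and> on_wire w l b} = i \<longleftrightarrow> on_wire w i b \<and> j < i \<and> (\<forall>l. on_wire w l b \<and> j < l \<longrightarrow> i \<le> l)"
    if "\<exists>l>j. on_wire w l b"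
    using that fin(2) by (subst Min_eq_iff) auto
  show ?thesis using 1 2 unfolding next_node_def by auto
qed

lemma next_node_None_iff:
  "next_node w k b j = None \<longleftrightarrow> \<not> (\<exists>i. on_wire w i b \<and> (if b \<le> k then i < j else j < i))"
  by (auto simp: next_node_def)

lemma rpath_iff:
  "ps \<noteq> [] \<Longrightarrow> rpath w k b j ps \<longleftrightarrow>
     fst (snd (ps ! 0)) = b \<and> next_node w k b j = Some (fst (ps ! 0)) \<and>
     (\<forall>(j, a, b)\<in>set ps. on_wire w j a \<and> (b = a \<or> b = other w j a)) \<and>
     (\<forall>i. Suc i < length ps \<longrightarrow>
          fst (snd (ps ! Suc i)) = snd (snd (ps ! i)) \<and>
          next_node w k (snd (snd (ps ! i))) (fst (ps ! i)) = Some (fst (ps ! Suc i))) \<and>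
     snd (snd (last ps)) = k + 1 \<and> next_node w k (k + 1) (fst (last ps)) = None \<and>
     (\<forall>(j, a, b)\<in>set ps. b = a \<longrightarrow> passable k a (other w j a))"
proof (induction ps arbitrary: b j)
  case (Cons p ps)
  note IH = Cons.IH
  obtain i a b' where p: "p = (i, a, b')" by (cases p)
  have on: "next_node w k b j = Some i \<Longrightarrow> on_wire w i b" by (simp add: next_node_Some_iff)
  show ?case
  proof (cases ps)
    case Nil
    then show ?thesis using p on by auto
  next
    case (Cons q qs)
    have all: "(\<forall>l. Suc l < length (p # ps) \<longrightarrow> P ((p # ps) ! l) ((p # ps) ! Suc l)) \<longleftrightarrow>
        P p q \<and> (\<forall>l. Suc l < length ps \<longrightarrow> P (ps ! l) (ps ! Suc l))" for P
      unfolding Cons by (auto simp: nth_Cons split: nat.split)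
    have ne: "ps \<noteq> []" using Cons by simp
    show ?thesis
      unfolding p rpath.simps IH[OF ne]
      unfolding all[of "\<lambda>x y. fst (snd y) = snd (snd x) \<and> next_node w k (snd (snd x)) (fst x) = Some (fst y)", unfolded p]
      using on Cons by auto
  qed
qed simp

lemma rigorous_iff: "rigorous w k ps \<longleftrightarrow> rpath w k k (length w) ps \<and> distinct (map fst ps)"
proof (cases "ps = []")
  case False
  have "(\<forall>(j, a, b)\<in>set ps. b = a \<longrightarrow>
        (let c = other w j a in
          \<not> (k < a \<and> k < c \<and> c < a) \<and> \<not> (a \<le> k \<and> c \<le> k \<and> a < c))) \<longleftrightarrow>
     (\<forall>(j, a, b)\<in>set ps. b = a \<longrightarrow> passable k a (other w j a))"
    by (simp add: passable_def Let_def)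
  then show ?thesis unfolding rigorous_def rpath_iff[OF False] using False by blast
qed (simp add: rigorous_def)

definition pval :: "(nat \<Rightarrow> real) \<Rightarrow> (nat \<times> nat \<times> nat) list \<Rightarrow> real" where
  "pval y ps = sum_list (map (\<lambda>(j, a, b). sw_coef a b * y j) ps)"

lemma pval_simps [simp]: "pval y [] = 0" "pval y ((j, a, b) # ps) = sw_coef a b * y j + pval y ps"
  by (simp_all add: pval_def)

definition swf :: "nat list \<Rightarrow> (nat \<Rightarrow> real) \<Rightarrow> nat \<Rightarrow> nat \<Rightarrow> real" where
  "swf w y a b = sw_coef a b * y (nd w a b)"

context rword
begin

lemma on_wire_other:
  assumes "b \<in> {1..n+1}" "on_wire w i b"
  shows "other w i b \<in> {1..n+1}" "other w i b \<noteq> b" "i = nd w b (other w i b)"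
proof -
  obtain c where "c \<in> {1..n+1} - {b}" "i = nd w b c" using on_wire_iff assms by blast
  then show "other w i b \<in> {1..n+1}" "other w i b \<noteq> b" "i = nd w b (other w i b)"
    using other_nd[of b c] assms by auto
qed

lemma on_wire_nd: "b \<in> {1..n+1} \<Longrightarrow> d \<in> {1..n+1} \<Longrightarrow> d \<noteq> b \<Longrightarrow> on_wire w (nd w b d) b"
  using on_wire_iff by blast

lemma nd_eqD: "b \<in> {1..n+1} \<Longrightarrow> c \<in> {1..n+1} \<Longrightarrow> d \<in> {1..n+1} \<Longrightarrow> c \<noteq> b \<Longrightarrow> d \<noteq> b \<Longrightarrow>
    nd w b c = nd w b d \<Longrightarrow> c = d"
  using nd_inj[of b c b d] by (auto simp: doubleton_eq_iff)

text \<open>Loop invariant: wire b was entered at its crossing with x and followed straight through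
  node j without a forbidden pass. At the next switch it becomes \<open>turn\<close>, in which the
  switching node itself is exempt.\<close>

definition on_track :: "nat \<Rightarrow> nat \<Rightarrow> nat \<Rightarrow> nat \<Rightarrow> bool" where
  "on_track k x b j \<longleftrightarrow> (if k < b
     then nd w b x \<le> j \<and> (\<forall>d. k < d \<and> d < b \<longrightarrow> \<not> (nd w b x < nd w b d \<and> nd w b d \<le> j))
     else j \<le> nd w b x \<and> (\<forall>d. b < d \<and> d \<le> k \<longrightarrow> \<not> (j \<le> nd w b d \<and> nd w b d < nd w b x)))"

lemma turns_of_rpath:
  assumes "1 \<le> k" "k \<le> n"
  shows "rpath w k b j ps \<Longrightarrow> b \<in> {1..n+1} \<Longrightarrow> x \<noteq> b \<Longrightarrow> on_track k x b j \<Longrightarrow>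
    \<exists>bs. turns (nd w) k (x # b # bs) \<and> last (b # bs) = k + 1 \<and> set (b # bs) \<subseteq> {1..n+1} \<and>
         val (swf w y) (b # bs) = pval y ps"
proof (induction ps arbitrary: x b j)
  case Nil
  then show ?case by (intro exI[of _ "[]"]) auto
next
  case (Cons p ps)
  obtain i a b' where p: "p = (i, a, b')" by (cases p)
  define c where "c = other w i b"
  have nx: "next_node w k b j = Some i" and b': "b' = b \<or> b' = c"
    and pass: "b' = b \<Longrightarrow> passable k b c" and rest: "rpath w k b' i ps" and a: "a = b"
    using Cons.prems(1) by (auto simp: p c_def)
  have on: "on_wire w i b" using nx by (simp add: next_node_Some_iff)
  have c: "c \<in> {1..n+1}" "c \<noteq> b" "i = nd w b c" using on_wire_other[OF Cons.prems(2) on] by (auto simp: c_def)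
  have step: "if b \<le> k then i < j \<and> (\<forall>d\<in>{1..n+1}-{b}. nd w b d < j \<longrightarrow> nd w b d \<le> i)
      else j < i \<and> (\<forall>d\<in>{1..n+1}-{b}. j < nd w b d \<longrightarrow> i \<le> nd w b d)"
    using nx on_wire_nd[OF Cons.prems(2)] by (auto simp: next_node_Some_iff)
  have eqc: "d = c" if "d \<in> {1..n+1} - {b}" "nd w b d = i" for d
    using nd_eqD[of b d c] that c Cons.prems(2) by auto
  show ?case
  proof (cases "b' = b")
    case True
    have "on_track k x b i"
    proof (cases "k < b")
      case kb: True
      have "False" if "k < d" "d < b" "nd w b x < nd w b d" "nd w b d \<le> i" for d
      proof -
        have "j < nd w b d" using Cons.prems(4) that kb by (auto simp: on_track_def not_le[symmetric])
        then have "nd w b d = i" using step kb that Cons.prems(2) by auto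
        then show False using eqc[of d] pass[OF True] that kb Cons.prems(2) assms by (auto simp: passable_def)
      qed
      then show ?thesis using Cons.prems(4) step kb by (auto simp: on_track_def)
    next
      case kb: False
      have "False" if "b < d" "d \<le> k" "nd w b d < nd w b x" "i \<le> nd w b d" for d
      proof -
        have "nd w b d < j" using Cons.prems(4) that kb by (auto simp: on_track_def not_le[symmetric])
        then have "nd w b d = i" using step kb that Cons.prems(2) assms by auto
        then show False using eqc[of d] pass[OF True] that kb Cons.prems(2) assms by (auto simp: passable_def)
      qed
      then show ?thesis using Cons.prems(4) step kb by (auto simp: on_track_def)
    qed
    then show ?thesis using Cons.IH[of b i x] rest True Cons.prems by (simp add: p a sw_coef_def)
  next
    case False
    then have b': "b' = c" using b' by blast
    have "turn (nd w) k x b c"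
    proof (cases "k < b")
      case kb: True
      have "False" if "k < d" "d < b" "nd w b x < nd w b d" "nd w b d < i" for d
      proof -
        have "j < nd w b d" using Cons.prems(4) that kb by (auto simp: on_track_def not_le[symmetric])
        moreover have "d \<in> {1..n+1}-{b}" using that Cons.prems(2) by auto
        ultimately show False using step kb that by auto
      qed
      then show ?thesis using Cons.prems(4) step kb c by (auto simp: on_track_def turn_def)
    next
      case kb: False
      have "False" if "b < d" "d \<le> k" "nd w b d < nd w b x" "i < nd w b d" for d
      proof -
        have "nd w b d < j" using Cons.prems(4) that kb by (auto simp: on_track_def not_le[symmetric])
        moreover have "d \<in> {1..n+1}-{b}" using that Cons.prems(2) assms by auto
        ultimately show False using step kb that by auto
      qed
      then show ?thesis using Cons.prems(4) step kb c by (auto simp: on_track_def turn_def)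
    qed
    moreover have "on_track k b c i" using c nd_sym[of w b c] by (auto simp: on_track_def)
    then obtain bs where bs: "turns (nd w) k (b # c # bs)" "last (c # bs) = k + 1" "set (c # bs) \<subseteq> {1..n+1}"
        "val (swf w y) (c # bs) = pval y ps"
      using Cons.IH[of c i b] rest b' c by auto
    moreover have "swf w y b c = sw_coef b c * y i" using c by (simp add: swf_def)
    ultimately show ?thesis using Cons.prems(2,3) p a b' c(1) bs
      by (intro exI[of _ "c # bs"]) auto
  qed
qed

lemma rpath_of_turns:
  assumes k: "1 \<le> k" "k \<le> n"
  shows "turns (nd w) k (x # b # bs) \<Longrightarrow> last (b # bs) = k + 1 \<Longrightarrow> set (b # bs) \<subseteq> {1..n+1} \<Longrightarrow>
    \<exists>ps. rpath w k b (nd w b x) ps \<and> pval y ps = val (swf w y) (b # bs)"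
proof (induction bs arbitrary: x b)
  case Nil
  then have b: "b = k + 1" by simp
  \<comment> \<open>After its last switch the path follows wire k + 1 down to its end. No pass is
    forbidden there, because no wire lies strictly between k and k + 1.\<close>
  have "\<exists>ps. rpath w k b j ps \<and> pval y ps = 0" for j
  proof (induction "length w - j" arbitrary: j rule: less_induct)
    case less
    show ?case
    proof (cases "next_node w k b j")
      case None
      then show ?thesis using b by (intro exI[of _ "[]"]) auto
    next
      case (Some i)
      then have i: "on_wire w i b" "j < i" using b by (auto simp: next_node_Some_iff)
      then have "i < length w" by (auto simp: on_wire_def)
      then have "length w - i < length w - j" using i by linarith
      then obtain ps where "rpath w k b i ps \<and> pval y ps = 0" using less by blast
      then show ?thesis using Some b by (intro exI[of _ "(i, b, b) # ps"]) (auto simp: passable_def sw_coef_def)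
    qed
  qed
  then show ?case by simp
next
  case (Cons c bs)
  have b: "b \<in> {1..n+1}" and c: "c \<in> {1..n+1}" and turn: "turn (nd w) k x b c" and t: "turns (nd w) k (b # c # bs)"
    using Cons.prems by auto
  have bc: "b \<noteq> c" using t turns_hd_neq by blast
  obtain ps where ps: "rpath w k c (nd w c b) ps" "pval y ps = val (swf w y) (c # bs)"
    using Cons.IH[OF t] Cons.prems by auto
  \<comment> \<open>The straight stretch from the crossing with x to the crossing with c is filled
    in node by node; \<open>turn\<close> makes each of these passes admissible.\<close>
  have "\<exists>ps. rpath w k b j ps \<and> pval y ps = val (swf w y) (b # c # bs)"
    if "if k < b then nd w b x \<le> j \<and> j < nd w b c else nd w b c < j \<and> j \<le> nd w b x" for j
    using that
  proof (induction "if k < b then nd w b c - j else j" arbitrary: j rule: less_induct)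
    case less
    have on: "on_wire w (nd w b c) b" using on_wire_nd b c bc by auto
    have "next_node w k b j \<noteq> None" using on less.prems by (auto simp: next_node_None_iff split: if_splits)
    then obtain i where i: "next_node w k b j = Some i" by blast
    define d where "d = other w i b"
    have d: "d \<in> {1..n+1}" "d \<noteq> b" "i = nd w b d" using on_wire_other[OF b, of i] i by (auto simp: d_def next_node_Some_iff)
    have step: "if k < b then j < i \<and> i \<le> nd w b c else i < j \<and> nd w b c \<le> i"
      using i on less.prems by (auto simp: next_node_Some_iff split: if_splits)
    show ?case
    proof (cases "i = nd w b c")
      case True
      then have "d = c" using nd_eqD[of b d c] d b c bc by auto
      then have "rpath w k b j ((i, b, c) # ps)" using i ps(1) bc True nd_sym[of w b c] by (auto simp: d_def)
      moreover have "swf w y b c = sw_coef b c * y i" using True by (simp add: swf_def)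
      ultimately show ?thesis using ps(2) by (intro exI[of _ "(i, b, c) # ps"]) simp
    next
      case False
      have "passable k b d"
        using turn step less.prems False d unfolding passable_def turn_def by (auto split: if_splits)
      moreover obtain ps where "rpath w k b i ps" "pval y ps = val (swf w y) (b # c # bs)"
      proof -
        have "(if k < b then nd w b c - i else i) < (if k < b then nd w b c - j else j)"
          using step less.prems by (auto intro: diff_less_mono2)
        moreover have "if k < b then nd w b x \<le> i \<and> i < nd w b c else nd w b c < i \<and> i \<le> nd w b x"
          using step less.prems False by (auto split: if_splits)
        ultimately show ?thesis using less.hyps[of i] that by blast
      qed
      ultimately show ?thesis using i by (intro exI[of _ "(i, b, b) # ps"]) (auto simp: d_def sw_coef_def)
    qed
  qed
  then show ?case using turn unfolding turn_def by (auto split: if_splits)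
qed

text \<open>The potential, read as a function of the nodes, increases at every step, so the
  requirement to pass each node at most once is automatic.\<close>

lemma rpath_distinct:
  assumes "b \<in> {1..n+1}" "rpath w k b j ps"
  shows "distinct (map fst ps)"
proof -
  obtain \<Phi> where pot: "potential (n + 1) (nd w) k \<Phi>" using potential_exists[OF arr_nd] by blast
  define \<phi> where "\<phi> j = \<Phi> (lw w j) (rw w j)" for j
  have \<phi>: "\<phi> (nd w b c) = \<Phi> b c" if "b \<in> {1..n+1}" "c \<in> {1..n+1}" "b \<noteq> c" for b c
  proof -
    have "\<Phi> b c = \<Phi> c b" using pot that unfolding potential_def by blast
    then show ?thesis using nd_wires[OF that] by (auto simp: \<phi>_def doubleton_eq_iff)
  qed
  have incr: "\<phi> j < \<phi> i" if bji: "b \<in> {1..n+1}" "on_wire w j b" "next_node w k b j = Some i" for b j i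
  proof -
    obtain c where c: "c \<in> {1..n+1} - {b}" "j = nd w b c" using on_wire_iff bji by blast
    obtain d where d: "d \<in> {1..n+1} - {b}" "i = nd w b d"
      using on_wire_iff bji unfolding next_node_Some_iff by blast
    have "if k < b then \<Phi> b y < \<Phi> b z else \<Phi> b z < \<Phi> b y"
      if "y \<in> {1..n+1} - {b}" "z \<in> {1..n+1} - {b}" "nd w b y < nd w b z" for y z
      using pot \<open>b \<in> {1..n+1}\<close> that unfolding potential_def by blast
    then have "\<Phi> b c < \<Phi> b d" using bji(3) c d unfolding next_node_Some_iff by (metis not_le)
    then show ?thesis using \<phi>[of b c] \<phi>[of b d] c d bji by auto
  qed
  have "sorted_wrt (\<lambda>p q. \<phi> (fst p) < \<phi> (fst q)) ps \<and> (on_wire w j b \<longrightarrow> (\<forall>p\<in>set ps. \<phi> j < \<phi> (fst p)))"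
    using assms
  proof (induction ps arbitrary: b j)
    case (Cons p ps)
    obtain i a b' where p: "p = (i, a, b')" by (cases p)
    have nx: "next_node w k b j = Some i" and r: "rpath w k b' i ps" and b': "b' = b \<or> b' = other w i b"
      using Cons.prems by (auto simp: p)
    have on: "on_wire w i b" using nx by (simp add: next_node_Some_iff)
    have "b' \<in> {1..n+1}" "on_wire w i b'"
      using b' on_wire_other[OF Cons.prems(1) on] on Cons.prems(1) by (auto simp: on_wire_def other_def)
    then show ?case using Cons.IH[of b' i] r incr[OF Cons.prems(1) _ nx] by (auto simp: p intro: less_trans)
  qed simp
  then have s: "sorted_wrt (\<lambda>p q. \<phi> (fst p) < \<phi> (fst q)) ps" by blast
  have "distinct (map (\<phi> \<circ> fst) ps)"
    using s by (induction ps) auto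
  then have "distinct (map \<phi> (map fst ps))" by simp
  then show ?thesis using distinct_map[of \<phi> "map fst ps"] by blast
qed

lemma gp_of_rigorous:
  assumes "1 \<le> k" "k \<le> n" "rigorous w k ps"
  shows "\<exists>bs. gp (nd w) 1 (n + 1) k bs \<and> val (swf w y) bs = pval y ps"
proof -
  have "rpath w k k (nd w k 0) ps" using assms by (simp add: rigorous_iff)
  \<comment> \<open>The virtual wire 0 acts as predecessor of the first wire: its crossing with k is
    the lower end of k.\<close>
  moreover have "on_track k 0 k (nd w k 0)" by (simp add: on_track_def)
  ultimately obtain bs where "turns (nd w) k (0 # k # bs)" "last (k # bs) = k + 1" "set (k # bs) \<subseteq> {1..n+1}"
      "val (swf w y) (k # bs) = pval y ps"
    using turns_of_rpath[of k k "nd w k 0" ps 0 y] assms by auto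
  then show ?thesis by (intro exI[of _ "k # bs"]) (auto simp: gp_def dest: turns_ConsD)
qed

lemma rigorous_of_gp:
  assumes "gp (nd w) 1 (n + 1) k bs"
  shows "\<exists>ps. rigorous w k ps \<and> pval y ps = val (swf w y) bs"
proof -
  have k: "1 \<le> k" "k \<le> n" using gp_range[OF assms] by auto
  obtain c cs where bs: "bs = k # c # cs"
    using assms by (cases bs; cases "tl bs") (auto simp: gp_def)
  have t: "turns (nd w) k (k # c # cs)" "last bs = k + 1" "set bs \<subseteq> {1..n+1}" using assms bs by (auto simp: gp_def)
  have "nd w k c < length w" using nd_less'[of k c] t bs turns_hd_neq by auto
  then have "turns (nd w) k (0 # k # c # cs)" using t k by (auto simp: turn_def)
  then obtain ps where "rpath w k k (nd w k 0) ps \<and> pval y ps = val (swf w y) (k # c # cs)"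
    using rpath_of_turns[of k 0 k "c # cs" y] k t bs by auto
  then show ?thesis using rpath_distinct[of k k] k bs by (auto simp: rigorous_iff)
qed

end

section \<open>Facets of string polytopes and Gelfand-Cetlin polytopes\<close>

lemma num_facets_unimod_equiv:
  fixes P Q :: "(real^'m::finite) set"
  assumes "unimod_equiv P Q"
  shows "num_facets P = num_facets Q"
proof -
  obtain M M' :: "real^'m^'m" and v where M: "M ** M' = mat 1" "M' ** M = mat 1" "(\<lambda>x. M *v x + v) ` P = Q"
    using assms unfolding unimod_equiv_def by blast
  define h where "h x = M *v x + v" for x
  define g where "g x = M' *v (x - v)" for x
  have gh: "g (h x) = x" "h (g x) = x" for x
    using M by (simp_all add: g_def h_def matrix_vector_mul_assoc)
  have inj: "inj ((*v) M)" by (rule inj_on_inverseI[of _ "(*v) M'"]) (simp add: matrix_vector_mul_assoc M)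
  have lin: "linear ((*v) M)" by (rule matrix_vector_mul_linear)
  \<comment> \<open>Facets are invariant under injective linear maps and under translations;
    \<open>h\<close> is factored accordingly.\<close>
  have him: "h ` S = (+) v ` ((*v) M ` S)" for S by (auto simp: h_def image_image add.commute)
  have facet: "h ` F facet_of h ` S \<longleftrightarrow> F facet_of S" for F S
    unfolding him facet_of_def face_of_translation_eq face_of_linear_image[OF lin inj]
      aff_dim_translation_eq aff_dim_injective_linear_image[OF lin inj] by simp
  have "{F. F facet_of Q} = (`) h ` {F. F facet_of P}"
  proof (intro equalityI subsetI)
    fix F assume "F \<in> {F. F facet_of Q}"
    then have "h ` (g ` F) facet_of h ` P" using M(3) gh by (simp add: image_image h_def[symmetric])
    then have "g ` F facet_of P" using facet by blast
    then show "F \<in> (`) h ` {F. F facet_of P}"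
      using gh by (intro image_eqI[of _ _ "g ` F"]) (auto simp: image_image)
  qed (use M(3) facet h_def in auto)
  moreover have "inj ((`) h)"
    by (rule inj_on_inverseI[of _ "(`) g"]) (simp add: image_image gh)
  ultimately show ?thesis by (simp add: num_facets_def card_image inj_on_subset)
qed

text \<open>Back substitution; in the proof d counts the equations already solved, from the
  end.\<close>

lemma triangular_solution:
  fixes g :: "nat \<Rightarrow> real" and c :: "nat \<Rightarrow> nat \<Rightarrow> real"
  shows "\<exists>y. \<forall>j<N. y j = g j + (\<Sum>l\<in>{j<..<N}. c j l * y l)"
proof -
  have "\<exists>y. \<forall>j<N. N - d \<le> j \<longrightarrow> y j = g j + (\<Sum>l\<in>{j<..<N}. c j l * y l)" for d
  proof (induction d)
    case (Suc d)
    then obtain y where y: "\<And>j. j < N \<Longrightarrow> N - d \<le> j \<Longrightarrow> y j = g j + (\<Sum>l\<in>{j<..<N}. c j l * y l)" by blast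
    show ?case
    proof (cases "d < N")
      case True
      define i where "i = N - Suc d"
      define z where "z = y(i := g i + (\<Sum>l\<in>{i<..<N}. c i l * y l))"
      have "(\<Sum>l\<in>{j<..<N}. c j l * z l) = (\<Sum>l\<in>{j<..<N}. c j l * y l)" if "i \<le> j" for j
        using that by (intro sum.cong) (auto simp: z_def)
      then have "z j = g j + (\<Sum>l\<in>{j<..<N}. c j l * z l)" if "j < N" "i \<le> j" for j
        using y[of j] that True by (cases "j = i") (auto simp: z_def i_def)
      then show ?thesis unfolding i_def by blast
    next
      case False
      then show ?thesis using y by (intro exI[of _ y]) auto
    qed
  qed auto
  from this[of N] show ?thesis by simp
qed

locale coords =
  fixes n :: nat and e :: "nat \<Rightarrow> 'm::finite"
  assumes e: "bij_betw e {..<n * (n + 1) div 2} (UNIV :: 'm set)"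
begin

definition N :: nat where "N = n * (n + 1) div 2"

lemma bij_e: "bij_betw e {..<N} UNIV"
  using e by (simp add: N_def)

lemma e_eq_iff: "i < N \<Longrightarrow> j < N \<Longrightarrow> e i = e j \<longleftrightarrow> i = j"
  using bij_e by (auto simp: bij_betw_def inj_on_def)

definition vof :: "(nat \<Rightarrow> real) \<Rightarrow> real^'m" where
  "vof y = (\<chi> i. y (the_inv_into {..<N} e i))"

lemma vof_nth [simp]: "j < N \<Longrightarrow> vof y $ e j = y j"
  using bij_e the_inv_into_f_f[of e "{..<N}" j] by (simp add: vof_def bij_betw_def)

lemma vec_eq_e_iff: "x = y \<longleftrightarrow> (\<forall>j<N. x $ e j = y $ e j)" for x y :: "real^'m"
proof -
  have "(\<forall>i. P i) \<longleftrightarrow> (\<forall>j<N. P (e j))" for P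
    using bij_e unfolding bij_betw_def by (metis UNIV_I imageE lessThan_iff)
  then show ?thesis by (simp add: vec_eq_iff)
qed

lemma e_surj: "\<exists>j<N. i = e j"
  using bij_e unfolding bij_betw_def by (metis UNIV_I imageE lessThan_iff)

end

subsection \<open>The Gelfand-Cetlin polytope\<close>

lemma tri_Suc: "Suc k * (Suc k + 1) div 2 = k * (k + 1) div 2 + Suc k"
  by simp

lemma tri_mono: "k \<le> l \<Longrightarrow> k * (k + 1) div 2 \<le> l * (l + 1) div (2::nat)"
  by (intro div_le_mono mult_le_mono) auto

lemma gc_idx_Suc: "gc_idx (Suc k) (Suc j) = k * (k + 1) div 2 + j"
  by (simp add: gc_idx_def)

lemma gc_idx_bounds:
  assumes "1 \<le> j" "j \<le> k"
  shows "(k - 1) * (k - 1 + 1) div 2 \<le> gc_idx k j" "gc_idx k j < k * (k + 1) div 2"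
proof -
  obtain k' j' where [simp]: "k = Suc k'" "j = Suc j'" using assms by (metis not0_implies_Suc not_one_le_zero le_zero_eq)
  show "(k - 1) * (k - 1 + 1) div 2 \<le> gc_idx k j" "gc_idx k j < k * (k + 1) div 2"
    unfolding \<open>k = Suc k'\<close> \<open>j = Suc j'\<close> gc_idx_Suc tri_Suc using assms by auto
qed

lemma gc_idx_less: "1 \<le> j \<Longrightarrow> j \<le> k \<Longrightarrow> k \<le> n \<Longrightarrow> gc_idx k j < n * (n + 1) div 2"
  using gc_idx_bounds[of j k] tri_mono[of k n] by linarith

lemma gc_idx_eq_iff:
  assumes "1 \<le> j" "j \<le> k" "1 \<le> j'" "j' \<le> k'"
  shows "gc_idx k j = gc_idx k' j' \<longleftrightarrow> k = k' \<and> j = j'"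
proof
  have lt: "gc_idx k j < gc_idx k' j'" if "k < k'" "1 \<le> j" "j \<le> k" "1 \<le> j'" "j' \<le> k'" for k j k' j'
    using gc_idx_bounds[of j k] gc_idx_bounds[of j' k'] tri_mono[of k "k' - 1"] that by linarith
  assume eq: "gc_idx k j = gc_idx k' j'"
  then have "k = k'" using lt[of k k' j j'] lt[of k' k j' j] assms by (cases k k' rule: linorder_cases) auto
  then show "k = k' \<and> j = j'" using eq assms by (auto simp: gc_idx_def)
qed simp

context coords
begin

definition gc_ix :: "(nat \<times> nat) set" where
  "gc_ix = {(k, j). 1 \<le> j \<and> j \<le> k \<and> k \<le> n}"

text \<open>Reduces finiteness and size of the triangle of indices to the count of pairs of
  wires.\<close>

lemma gc_ix_eq: "gc_ix = (\<lambda>(a, b). (n + 1 - a, n + 2 - b)) ` pairs_upto (n + 1)"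
proof (intro equalityI subsetI)
  fix x assume "x \<in> gc_ix"
  then show "x \<in> (\<lambda>(a, b). (n + 1 - a, n + 2 - b)) ` pairs_upto (n + 1)"
    by (intro image_eqI[of _ _ "(n + 1 - fst x, n + 2 - snd x)"]) (auto simp: gc_ix_def pairs_upto_def)
qed (auto simp: gc_ix_def pairs_upto_def)

lemma finite_gc_ix: "finite gc_ix" and card_gc_ix: "card gc_ix = N"
proof -
  show "finite gc_ix" by (simp add: gc_ix_eq)
  have "inj_on (\<lambda>(a, b). (n + 1 - a, n + 2 - b)) (pairs_upto (n + 1))"
    by (rule inj_onI) (auto simp: pairs_upto_def)
  then show "card gc_ix = N" using card_pairs_upto[of n] by (simp add: gc_ix_eq card_image N_def)
qed

definition gcof :: "(nat \<Rightarrow> nat \<Rightarrow> real) \<Rightarrow> real^'m" where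
  "gcof P = vof (\<lambda>i. case the_inv_into gc_ix (\<lambda>(k, j). gc_idx k j) i of (k, j) \<Rightarrow> P k j)"

lemma gcof_nth: "1 \<le> j \<Longrightarrow> j \<le> k \<Longrightarrow> k \<le> n \<Longrightarrow> gcof P $ e (gc_idx k j) = P k j"
proof -
  assume a: "1 \<le> j" "j \<le> k" "k \<le> n"
  have "inj_on (\<lambda>(k, j). gc_idx k j) gc_ix"
    by (rule inj_onI) (auto simp: gc_ix_def gc_idx_eq_iff)
  then have "the_inv_into gc_ix (\<lambda>(k, j). gc_idx k j) (gc_idx k j) = (k, j)"
    using the_inv_into_f_f[of "\<lambda>(k, j). gc_idx k j" gc_ix "(k, j)"] a by (simp add: gc_ix_def)
  then show ?thesis using a gc_idx_less[of j k n] unfolding N_def[symmetric] by (simp add: gcof_def)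
qed

lemma num_facets_GC:
  assumes lam: "\<forall>i\<in>{1..n}. 0 < lam i"
  shows "num_facets (GC_polytope n lam e) = n * (n + 1)"
proof -
  define \<Lambda> where "\<Lambda> j = real_of_int (\<Sum>i\<in>{j..n}. lam i)" for j
  have \<Lambda>: "\<Lambda> (Suc j) < \<Lambda> j" if "1 \<le> j" "j \<le> n" for j
    using lam that by (simp add: \<Lambda>_def sum.atLeast_Suc_atMost[of j n])
  define row where "row k j = (if k \<le> n then axis (e (gc_idx k j)) (1::real) else 0)" for k j
  define up where "up = (\<lambda>(k, j). row (k + 1) j - row k j)"
  define dn where "dn = (\<lambda>(k, j). row k j - row (k + 1) (j + 1))"
  \<comment> \<open>At \<open>p\<close> all upper bounds are equalities (columns are constant), at
    \<open>q\<close> all lower bounds (diagonals are constant).\<close>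
  define p where "p = gcof (\<lambda>k j. \<Lambda> j)"
  define q where "q = gcof (\<lambda>k j. \<Lambda> (n + 1 - k + j))"
  have row: "row k j \<bullet> x = (if k \<le> n then x $ e (gc_idx k j) else 0)" for k j x
    by (simp add: row_def inner_axis')
  have gcv: "gc_val n lam e x k j = (if k = n + 1 then \<Lambda> j else x $ e (gc_idx k j))" for x k j
    by (simp add: gc_val_def \<Lambda>_def)
  have upp: "up (k, j) \<bullet> (x - p) = gc_val n lam e x (k + 1) j - gc_val n lam e x k j"
    and dnq: "dn (k, j) \<bullet> (x - q) = gc_val n lam e x k j - gc_val n lam e x (k + 1) (j + 1)"
    if "(k, j) \<in> gc_ix" for k j x
    using that by (auto simp: up_def dn_def inner_diff_left row gcv p_def q_def gcof_nth gc_ix_def)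
  have "GC_polytope n lam e = cone_at (up ` gc_ix) p \<inter> cone_at (dn ` gc_ix) q"
    unfolding GC_polytope_def cone_at_def using upp dnq by (fastforce simp: gc_ix_def)
  moreover have up_pos: "\<forall>i\<in>gc_ix. 0 < up i \<bullet> (q - p)"
  proof
    fix i assume "i \<in> gc_ix"
    then obtain k j where i: "i = (k, j)" "1 \<le> j" "j \<le> k" "k \<le> n" by (auto simp: gc_ix_def)
    then have "0 < \<Lambda> (n - k + j) - \<Lambda> (n + 1 - k + j)" using \<Lambda>[of "n - k + j"] by (simp add: Suc_diff_le)
    also have "\<dots> = up i \<bullet> (q - p)"
      using upp[of k j q] i by (auto simp: gcv gc_ix_def q_def gcof_nth Suc_diff_le)
    finally show "0 < up i \<bullet> (q - p)" .
  qed
  moreover have dn_pos: "\<forall>i\<in>gc_ix. 0 < dn i \<bullet> (p - q)"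
    using \<Lambda> dnq[of _ _ p] by (auto simp: gcv gc_ix_def p_def gcof_nth)
  moreover have "num_facets (cone_at (up ` gc_ix) p) = card gc_ix"
  proof (rule num_facets_simplicial_cone[OF finite_gc_ix _ up_pos])
    fix i l assume "i \<in> gc_ix" "l \<in> gc_ix"
    \<comment> \<open>The dual vector of the inequality at (k, j) is supported on the rows up to k
      of column j; for \<open>dn\<close> below, on the same rows of a diagonal.\<close>
    then show "up l \<bullet> (case i of (k, j) \<Rightarrow> gcof (\<lambda>k' j'. if j' = j \<and> k' \<le> k then 1 else 0)) = (if l = i then -1 else 0)"
      by (cases i; cases l) (auto simp: up_def inner_diff_left row gcof_nth gc_ix_def)
  qed
  moreover have "num_facets (cone_at (dn ` gc_ix) q) = card gc_ix"
  proof (rule num_facets_simplicial_cone[OF finite_gc_ix _ dn_pos])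
    fix i l assume "i \<in> gc_ix" "l \<in> gc_ix"
    then show "dn l \<bullet> (case i of (k, j) \<Rightarrow> gcof (\<lambda>k' j'. if j + k' = j' + k \<and> k' \<le> k then -1 else 0)) = (if l = i then -1 else 0)"
      by (cases i; cases l) (auto simp: dn_def inner_diff_left row gcof_nth gc_ix_def)
  qed
  ultimately have "num_facets (GC_polytope n lam e) = card gc_ix + card gc_ix"
    using num_facets_two_cones[of "up ` gc_ix" "dn ` gc_ix" p q] finite_gc_ix by simp
  moreover have "N + N = n * (n + 1)"
  proof -
    have "even (n * (n + 1))" by simp
    then have "2 * N = n * (n + 1)" unfolding N_def by (rule dvd_mult_div_cancel)
    then show ?thesis by linarith
  qed
  ultimately show ?thesis using card_gc_ix by simp
qed

end

subsection \<open>The string polytope\<close>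

locale scoords = rword n w + coords n e for n w and e :: "nat \<Rightarrow> 'm::finite"
begin

lemma length_w_N: "length w = N" by (simp add: length_w N_def)

definition pvec :: "nat list \<Rightarrow> real^'m" where
  "pvec bs = val (\<lambda>a b. sw_coef a b *\<^sub>R axis (e (nd w a b)) 1) bs"

lemma val_inner: "val f bs \<bullet> x = val (\<lambda>a b. f a b \<bullet> x) bs"
  by (induction f bs rule: val.induct) (auto simp: inner_add_left)

lemma pvec_inner: "pvec bs \<bullet> x = val (swf w (\<lambda>j. x $ e j)) bs"
  by (simp add: pvec_def val_inner inner_axis' swf_def[abs_def])

lemma pvec_nth: "pvec bs $ i = val (\<lambda>a b. if i = e (nd w a b) then sw_coef a b else 0) bs"
proof -
  have "val f bs $ i = val (\<lambda>a b. f a b $ i) bs" for f :: "_ \<Rightarrow> _ \<Rightarrow> real^'m" and bs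
    by (induction f bs rule: val.induct) auto
  then show ?thesis unfolding pvec_def by (simp add: axis_def if_distrib cong: if_cong)
qed

abbreviation "gpw k bs \<equiv> gp (nd w) 1 (n + 1) k bs"

definition pvecs :: "(real^'m) set" where
  "pvecs = {pvec bs | bs. \<exists>k. gpw k bs}"

lemma string_cone_eq: "string_cone n w e = cone_at pvecs 0"
proof -
  have "(\<forall>k\<in>{1..n}. \<forall>ps. rigorous w k ps \<longrightarrow> 0 \<le> pval (\<lambda>j. x $ e j) ps) \<longleftrightarrow>
      (\<forall>k bs. gpw k bs \<longrightarrow> 0 \<le> val (swf w (\<lambda>j. x $ e j)) bs)" for x :: "real^'m"
    using gp_of_rigorous[of _ _ "\<lambda>j. x $ e j"] rigorous_of_gp[of _ _ "\<lambda>j. x $ e j"] gp_range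
    by (metis Suc_eq_plus1 atLeastAtMost_iff less_Suc_eq_le)
  then have "x \<in> string_cone n w e \<longleftrightarrow> (\<forall>k bs. gpw k bs \<longrightarrow> 0 \<le> pvec bs \<bullet> x)" for x
    unfolding pvec_inner string_cone_def pval_def by simp
  then show ?thesis by (auto simp: cone_at_def pvecs_def)
qed

lemma gpw_increasing:
  assumes "gpw k bs" "potential (n + 1) (nd w) k \<Phi>"
  shows "sorted_wrt (\<lambda>(a, b) (c, d). \<Phi> a b < \<Phi> c d) (zip bs (tl bs))"
  using turns_increasing assms by (auto simp: gp_def)

text \<open>By the potential no node is used for two switches, so nothing cancels, and the vector
  determines the set of switches together with their directions.\<close>

lemma sw_coef_pvec:
  assumes bs: "gpw k bs" and ab: "a \<in> {1..n+1}" "b \<in> {1..n+1}" "a \<noteq> b"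
  shows "sw_coef a b * pvec bs $ e (nd w a b) =
    (if (a, b) \<in> set (zip bs (tl bs)) then 1 else if (b, a) \<in> set (zip bs (tl bs)) then -1 else 0)"
proof -
  obtain \<Phi> where pot: "potential (n + 1) (nd w) k \<Phi>" using potential_exists[OF arr_nd] by blast
  have sym: "\<Phi> a b = \<Phi> b a" using pot ab unfolding potential_def by blast
  have nda: "nd w a b < N" using nd_less'[OF ab] length_w_N by simp
  have "sorted_wrt (\<lambda>(a, b) (c, d). \<Phi> a b < \<Phi> c d) (zip bs (tl bs))" "turns (nd w) k bs" "set bs \<subseteq> {1..n+1}"
    using gpw_increasing[OF bs pot] bs by (auto simp: gp_def)
  then show ?thesis
    unfolding pvec_nth
  proof (induction bs rule: induct_list012)
    case (3 x y zs)
    define V where "V = val (\<lambda>a' b'. if e (nd w a b) = e (nd w a' b') then sw_coef a' b' else 0) (y # zs)"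
    have IH: "sw_coef a b * V =
      (if (a, b) \<in> set (zip (y # zs) zs) then 1 else if (b, a) \<in> set (zip (y # zs) zs) then -1 else 0)"
      unfolding V_def using 3 turns_ConsD by auto
    have xy: "x \<noteq> y" "x \<in> {1..n+1}" "y \<in> {1..n+1}" using 3 turns_hd_neq by auto
    then have "nd w x y < N" using nd_less' length_w_N by simp
    then have eq: "e (nd w a b) = e (nd w x y) \<longleftrightarrow> {a, b} = {x, y}"
      using e_eq_iff nda nd_inj[OF ab xy(2,3,1)] nd_sym[of w a b] by (auto simp: doubleton_eq_iff)
    have V: "val (\<lambda>a' b'. if e (nd w a b) = e (nd w a' b') then sw_coef a' b' else 0) (x # y # zs) =
        (if {a, b} = {x, y} then sw_coef x y else 0) + V"
      unfolding V_def eq[symmetric] by (rule val.simps)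
    have Z: "set (zip (x # y # zs) (tl (x # y # zs))) = insert (x, y) (set (zip (y # zs) zs))" by simp
    show ?case unfolding V Z
    proof (cases "{a, b} = {x, y}")
      case True
      then have "\<Phi> x y = \<Phi> a b" using sym by (auto simp: doubleton_eq_iff)
      then have "(a, b) \<notin> set (zip (y # zs) zs)" "(b, a) \<notin> set (zip (y # zs) zs)"
        using 3(3) sym by auto
      moreover have "a = x \<and> b = y \<or> a = y \<and> b = x" using True by (auto simp: doubleton_eq_iff)
      moreover have "sw_coef a b * sw_coef a b = 1" "sw_coef a b * sw_coef b a = -1"
        using ab(3) by (auto simp: sw_coef_def)
      ultimately show "sw_coef a b * ((if {a, b} = {x, y} then sw_coef x y else 0) + V) =
          (if (a, b) \<in> insert (x, y) (set (zip (y # zs) zs)) then 1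
           else if (b, a) \<in> insert (x, y) (set (zip (y # zs) zs)) then -1 else 0)"
        using IH True ab(3) by (elim disjE) (simp_all add: distrib_left)
    next
      case False
      then have ne: "(a, b) = (x, y) \<longleftrightarrow> False" "(b, a) = (x, y) \<longleftrightarrow> False" by auto
      show "sw_coef a b * ((if {a, b} = {x, y} then sw_coef x y else 0) + V) =
          (if (a, b) \<in> insert (x, y) (set (zip (y # zs) zs)) then 1
           else if (b, a) \<in> insert (x, y) (set (zip (y # zs) zs)) then -1 else 0)"
        unfolding insert_iff ne using IH by (simp only: False if_False add_0_left simp_thms)
    qed
  qed auto
qed

text \<open>Finiteness is read off the coefficients, all of them -1, 0 or 1, instead of bounding the
  lists.\<close>

lemma finite_pvecs: "finite pvecs"
proof -
  have "finite (vec_lambda ` (PiE UNIV (\<lambda>_::'m. {-1, 0, 1::real})))"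
    by (intro finite_imageI finite_PiE) auto
  moreover have "pvecs \<subseteq> vec_lambda ` (PiE UNIV (\<lambda>_::'m. {-1, 0, 1::real}))"
  proof
    fix x assume "x \<in> pvecs"
    then obtain k bs where x: "x = pvec bs" "gpw k bs" by (auto simp: pvecs_def)
    have "x $ i \<in> {-1, 0, 1}" for i
    proof -
      obtain j where j: "j < N" "i = e j" using e_surj by blast
      have l: "lw w j \<in> {1..n+1}" "rw w j \<in> {1..n+1}" "lw w j \<noteq> rw w j" "nd w (lw w j) (rw w j) = j" "lw w j < rw w j"
        using lw_rw_range lw_neq_rw nd_lw_rw lw_less_rw j length_w_N by auto
      show ?thesis using sw_coef_pvec[OF x(2) l(1-3)] l(4,5) j x by (auto simp: sw_coef_def split: if_splits)
    qed
    then show "x \<in> vec_lambda ` (PiE UNIV (\<lambda>_::'m. {-1, 0, 1::real}))"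
      by (intro image_eqI[of _ _ "vec_nth x"]) (auto simp: PiE_iff)
  qed
  ultimately show ?thesis by (rule finite_subset[rotated])
qed

text \<open>The value of every path on this point telescopes.\<close>

definition tvec :: "(nat \<Rightarrow> real) \<Rightarrow> real^'m" where
  "tvec \<mu> = vof (\<lambda>j. \<mu> (rw w j) - \<mu> (lw w j))"

lemma swf_tvec:
  assumes "a \<in> {1..n+1}" "b \<in> {1..n+1}"
  shows "swf w (\<lambda>j. tvec \<mu> $ e j) a b = \<mu> b - \<mu> a"
  using nd_less[of a b] nd_less[of b a] nd_sym[of w a b] assms length_w_N
  by (cases a b rule: linorder_cases) (auto simp: swf_def sw_coef_def tvec_def)

lemma pvec_tvec: "gpw k bs \<Longrightarrow> pvec bs \<bullet> tvec \<mu> = \<mu> (k + 1) - \<mu> k"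
proof -
  assume bs: "gpw k bs"
  then have "pvec bs \<bullet> tvec \<mu> = val (\<lambda>a b. \<mu> b - \<mu> a) bs"
    unfolding pvec_inner by (intro val_cong swf_tvec) (auto simp: gp_def)
  then show ?thesis using val_telescope[of bs \<mu>] bs by (simp add: gp_def)
qed

text \<open>The inner normal of the lambda-inequality of node j.\<close>

definition gvec :: "nat \<Rightarrow> real^'m" where
  "gvec j = (\<Sum>l\<in>{j<..<N}. lam_coef w j l *\<^sub>R axis (e l) 1) - axis (e j) 1"

lemma gvec_inner: "gvec j \<bullet> x = (\<Sum>l\<in>{j<..<N}. lam_coef w j l * x $ e l) - x $ e j"
  by (simp add: gvec_def inner_diff_left inner_sum_left inner_axis')

text \<open>Identifies \<open>tvec\<close> of a suitable \<mu> as the apex of the lambda-cone: all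
  lambda-inequalities are tight there, because their right-hand sides telescope when the diagram is
  read from the bottom.\<close>

lemma lambda_vertex:
  assumes \<mu>: "\<And>i. i \<in> {1..n} \<Longrightarrow> \<mu> (n + 2 - i) - \<mu> (n + 1 - i) = lam i" and j: "j < N"
  shows "gvec j \<bullet> tvec \<mu> = - lam (w ! j)"
proof -
  define c :: "nat \<Rightarrow> nat \<Rightarrow> real" where "c i i' = (if i' = i + 1 \<or> i = i' + 1 then 1 else if i' = i then -2 else 0)" for i i'
  \<comment> \<open>Read upward, each crossing changes the difference of \<mu> on the wires in
    positions i and i + 1 by its coefficient \<open>c\<close> times its coordinate. At the bottom,
    position i holds wire n + 2 - i.\<close>
  have X: "lam i + (\<Sum>l\<in>{t..<N}. c i (w ! l) * (\<mu> (rw w l) - \<mu> (lw w l))) = \<mu> (wpos w t i) - \<mu> (wpos w t (i + 1))"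
    if "t \<le> N" "i \<in> {1..n}" for t i
    using that
  proof (induction "N - t" arbitrary: t i)
    case 0
    then have "t = length w" using length_w_N by simp
    then show ?case using \<mu>[of i] wpos_end[of i] wpos_end[of "i + 1"] 0 length_w_N by auto
  next
    case (Suc d)
    then have t: "t < N" by simp
    define S where "S = (\<Sum>l\<in>{Suc t..<N}. c i (w ! l) * (\<mu> (rw w l) - \<mu> (lw w l)))"
    have s: "(\<Sum>l\<in>{t..<N}. c i (w ! l) * (\<mu> (rw w l) - \<mu> (lw w l))) = c i (w ! t) * (\<mu> (rw w t) - \<mu> (lw w t)) + S"
      using t by (simp add: S_def sum.atLeast_Suc_lessThan)
    have "lam i + S = \<mu> (wpos w (Suc t) i) - \<mu> (wpos w (Suc t) (i + 1))"
      using Suc.hyps(1)[of "Suc t" i] Suc.hyps(2) t Suc.prems unfolding S_def by simp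
    moreover have "w ! t + 1 = i \<or> w ! t = i \<or> w ! t = i + 1 \<or> w ! t > i + 1 \<or> w ! t + 1 < i" by linarith
    ultimately show ?case unfolding s by (auto simp: c_def lw_def rw_def sw_def algebra_simps)
  qed
  have wj: "w ! j \<in> {1..n}" using letter[of j] j length_w_N by simp
  have "(\<Sum>l\<in>{j<..<N}. lam_coef w j l * tvec \<mu> $ e l) =
        (\<Sum>l\<in>{Suc j..<N}. c (w ! j) (w ! l) * (\<mu> (rw w l) - \<mu> (lw w l)))"
    by (intro sum.cong) (auto simp: tvec_def lam_coef_def c_def)
  then show ?thesis using X[of "Suc j" "w ! j"] wj j
    by (simp add: gvec_inner tvec_def lw_def rw_def sw_def)
qed

lemma num_facets_string_polytope:
  assumes lam: "\<forall>i\<in>{1..n}. 0 < lam i"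
  shows "num_facets (string_polytope n w lam e) = num_facets (string_cone n w e) + N"
proof -
  \<comment> \<open>The increments of \<mu> are the weights in reverse order, since the wires are
    reversed at the bottom. They are positive, so every path is positive on
    \<open>t0\<close>.\<close>
  define \<mu> where "\<mu> c = real_of_int (\<Sum>i\<in>{n + 2 - c..n}. lam i)" for c
  have \<mu>: "\<mu> (n + 2 - i) - \<mu> (n + 1 - i) = real_of_int (lam i)" if "i \<in> {1..n}" for i
    using that by (simp add: \<mu>_def sum.atLeast_Suc_atMost[of i n] Suc_diff_le)
  define t0 where "t0 = tvec \<mu>"
  have g: "gvec j \<bullet> (x - t0) = real_of_int (lam (w ! j)) + (\<Sum>k\<in>{j<..<length w}. lam_coef w j k * x $ e k) - x $ e j"
    if "j < N" for j x
    using lambda_vertex[of \<mu> "\<lambda>i. real_of_int (lam i)", OF \<mu> that] length_w_N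
    by (simp add: inner_diff_right t0_def gvec_inner)
  have eq: "string_polytope n w lam e = cone_at pvecs 0 \<inter> cone_at (gvec ` {..<N}) t0"
    unfolding string_polytope_def string_cone_eq using g length_w_N by (auto simp: cone_at_def)
  have gpos: "\<forall>j\<in>{..<N}. 0 < gvec j \<bullet> (0 - t0)"
  proof
    fix j assume "j \<in> {..<N}"
    then show "0 < gvec j \<bullet> (0 - t0)" using g[of j 0] letter[of j] lam length_w_N by simp
  qed
  have ppos: "\<forall>a\<in>pvecs. 0 < a \<bullet> (t0 - 0)"
  proof
    fix a assume "a \<in> pvecs"
    then obtain k bs where k: "gpw k bs" "a = pvec bs" by (auto simp: pvecs_def)
    then have k1: "k \<in> {1..n}" using gp_range by fastforce
    then have "n + 1 - k \<in> {1..n}" "n + 2 - (n + 1 - k) = k + 1" "n + 1 - (n + 1 - k) = k" by auto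
    then have "\<mu> (k + 1) - \<mu> k > 0" using \<mu>[of "n + 1 - k"] lam by (metis of_int_0_less_iff)
    then show "0 < a \<bullet> (t0 - 0)" using k pvec_tvec[of k bs \<mu>] by (simp add: t0_def)
  qed
  \<comment> \<open>\<open>Y i\<close> solves the triangular system with the i-th unit vector on the
    right; up to sign this is a dual family of the \<open>gvec j\<close>.\<close>
  have "\<exists>y. \<forall>j<N. y j = (if j = i then 1 else 0) + (\<Sum>l\<in>{j<..<N}. lam_coef w j l * y l)" for i
    by (rule triangular_solution)
  then obtain Y where Y: "\<And>i j. j < N \<Longrightarrow> Y i j = (if j = i then 1 else 0) + (\<Sum>l\<in>{j<..<N}. lam_coef w j l * Y i l)"
    by metis
  have "num_facets (cone_at (gvec ` {..<N}) t0) = card {..<N}"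
  proof (rule num_facets_simplicial_cone[OF _ _ gpos])
    fix i j assume "i \<in> {..<N}" "j \<in> {..<N}"
    then show "gvec j \<bullet> vof (Y i) = (if j = i then -1 else 0)"
      using Y[of j i] by (simp add: gvec_inner)
  qed simp
  then show ?thesis
    using num_facets_two_cones[of pvecs "gvec ` {..<N}" 0 t0] finite_pvecs gpos ppos
    by (simp add: eq string_cone_eq)
qed

end

section \<open>Simplicial string cones\<close>

lemma val_append: "val f (xs @ y # ys) = val f (xs @ [y]) + val f (y # ys)"
  by (induction f xs rule: val.induct; cases xs) (auto simp: add.assoc)

lemma val_eq_0:
  assumes "\<And>a b. a \<in> set bs \<Longrightarrow> b \<in> set bs \<Longrightarrow> f a b = 0"
  shows "val f bs = 0"
  using assms by (induction f bs rule: val.induct) auto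

lemma turns_append: "turns h k (xs @ [c, a]) \<Longrightarrow> turns h k (c # a # ys) \<Longrightarrow> turns h k (xs @ c # a # ys)"
proof (induction xs rule: induct_list012)
  case (2 x)
  then show ?case by (cases ys) auto
next
  case (3 x y zs)
  then show ?case by (cases zs) auto
qed auto

text \<open>Greedy descent from wire b, entered at height \<open>T\<close>: switch at the first
  crossing further down with a wire from k + 1 to b - 1, so that no forbidden pass can come before
  it. By the order axiom the crossing with k + 1 stays ahead after the switch, so the descent ends
  at k + 1.\<close>

lemma left_chain:
  assumes arr: "arr m h" and k: "1 \<le> k"
  shows "k < b \<Longrightarrow> b \<le> m \<Longrightarrow> (k + 1 < b \<Longrightarrow> T < h b (k + 1)) \<Longrightarrow>
    \<exists>cs. last (b # cs) = k + 1 \<and> set (b # cs) \<subseteq> {k+1..b} \<and> (\<forall>x. x \<noteq> b \<and> h b x = T \<longrightarrow> turns h k (x # b # cs))"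
proof (induction b arbitrary: T rule: less_induct)
  case (less b)
  show ?case
  proof (cases "b = k + 1")
    case True
    then show ?thesis by (intro exI[of _ "[]"]) auto
  next
    case False
    define C where "C = {c. k < c \<and> c < b \<and> T < h b c}"
    have kC: "k + 1 \<in> C" "finite C" using less.prems False by (auto simp: C_def intro: finite_subset[of _ "{..b}"])
    then obtain c where c: "c \<in> C" "\<And>d. d \<in> C \<Longrightarrow> h b c \<le> h b d"
      by (metis (no_types, lifting) empty_iff arg_min_if_finite(1) arg_min_least)
    have "h c b < h c (k + 1)" if "k + 1 < c"
    proof -
      have "h b c \<noteq> h b (k + 1)" using arr_neq[OF arr, of b c "k + 1"] c less.prems that by (auto simp: C_def)
      then show ?thesis
        using c(2)[OF kC(1)] arr_triple[OF arr, of "k + 1" c b] c less.prems that by (auto simp: C_def)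
    qed
    then obtain cs where cs: "last (c # cs) = k + 1" "set (c # cs) \<subseteq> {k+1..c}"
        "\<forall>x. x \<noteq> c \<and> h c x = h c b \<longrightarrow> turns h k (x # c # cs)"
      using less.IH[of c "h c b"] c less.prems by (auto simp: C_def)
    have "turn h k x b c" if "h b x = T" for x
      using that c less.prems by (auto simp: turn_def C_def not_less[symmetric])
    moreover have "turns h k (b # c # cs)" using cs c by (auto simp: C_def)
    ultimately show ?thesis using cs c less.prems
      by (intro exI[of _ "c # cs"]) (auto simp: C_def)
  qed
qed

text \<open>The mirror image on upward wires, built backwards: it finds the wires through which a
  path from k reaches wire a, to leave it at height \<open>T\<close>.\<close>

lemma right_chain:
  assumes arr: "arr m h" and k: "k \<le> m"
  shows "1 \<le> a \<Longrightarrow> a \<le> k \<Longrightarrow> (a < k \<Longrightarrow> T < h a k) \<Longrightarrow>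
    \<exists>cs. hd (cs @ [a]) = k \<and> set (cs @ [a]) \<subseteq> {a..k} \<and> (\<forall>x. x \<noteq> a \<and> h a x = T \<longrightarrow> turns h k (cs @ [a, x]))"
proof (induction "k - a" arbitrary: a T rule: less_induct)
  case less
  show ?case
  proof (cases "a = k")
    case True
    then show ?thesis by (intro exI[of _ "[]"]) auto
  next
    case False
    define C where "C = {c. a < c \<and> c \<le> k \<and> T < h a c}"
    have kC: "k \<in> C" "finite C" using less.prems False by (auto simp: C_def intro: finite_subset[of _ "{..k}"])
    then obtain c where c: "c \<in> C" "\<And>d. d \<in> C \<Longrightarrow> h a c \<le> h a d"
      by (metis (no_types, lifting) empty_iff arg_min_if_finite(1) arg_min_least)
    have "h c a < h c k" if "c < k"
    proof -
      have "h a c \<noteq> h a k" using arr_neq[OF arr, of a c k] c less.prems that k by (auto simp: C_def)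
      then show ?thesis
        using c(2)[OF kC(1)] arr_triple[OF arr, of a c k] c less.prems that k by (auto simp: C_def)
    qed
    moreover have "k - c < k - a" using c less.prems unfolding C_def mem_Collect_eq by arith
    ultimately obtain cs where cs: "hd (cs @ [c]) = k" "set (cs @ [c]) \<subseteq> {c..k}"
        "\<forall>x. x \<noteq> c \<and> h c x = h c a \<longrightarrow> turns h k (cs @ [c, x])"
      using less.hyps[of c "h c a"] c less.prems by (auto simp: C_def)
    have t: "turn h k c a x" if "h a x = T" for x
      using that c less.prems by (auto simp: turn_def C_def not_less[symmetric])
    have "turns h k (cs @ [c, a])" using cs c by (auto simp: C_def)
    then have "turns h k (cs @ [c, a, x])" if "h a x = T" "x \<noteq> a" for x
      using turns_append[of h k cs c a "[x]"] t[of x] that c by (auto simp: C_def)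
    then show ?thesis using cs c less.prems
      by (intro exI[of _ "cs @ [c]"]) (auto simp: C_def hd_append)
  qed
qed

text \<open>
  The two descending chains start at the crossing of \<open>p\<close> and \<open>q\<close>; choosing \<open>k\<close> so that at this
  crossing \<open>k\<close> is to the right and \<open>k + 1\<close> to the left makes them end at \<open>k\<close> and \<open>k + 1\<close>.
\<close>

lemma apex_path:
  assumes arr: "arr m h" and pq: "1 \<le> p" "p < q" "q \<le> m"
  shows "\<exists>k xs ys. gp h p q k (xs @ p # q # ys) \<and> set (xs @ [p]) \<subseteq> {p..k} \<and> set (q # ys) \<subseteq> {k+1..q}"
proof -
  \<comment> \<open>The disjunct \<open>i = p\<close> makes sure that some index qualifies; for k =
    p the chain of upward wires is the single wire p.\<close>
  define P where "P i \<longleftrightarrow> p \<le> i \<and> i < q \<and> (i = p \<or> h p q < h p i)" for i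
  have "P p" using pq by (simp add: P_def)
  moreover have "\<forall>i. P i \<longrightarrow> i \<le> q" by (simp add: P_def)
  ultimately obtain k where k: "P k" "\<And>i. P i \<Longrightarrow> i \<le> k"
    by (metis Nat.ex_has_greatest_nat)
  have k1: "h p (k + 1) < h p q" if "k + 1 < q"
    using k(2)[of "k + 1"] arr_neq[OF arr, of p "k + 1" q] k(1) that pq by (force simp: P_def)
  have "h q p < h q (k + 1)" if "k + 1 < q"
    using arr_triple[OF arr, of p "k + 1" q] k1 that pq k(1) by (auto simp: P_def)
  then obtain ys where ys: "last (q # ys) = k + 1" "set (q # ys) \<subseteq> {k+1..q}"
      "\<forall>x. x \<noteq> q \<and> h q x = h q p \<longrightarrow> turns h k (x # q # ys)"
    using left_chain[OF arr, of k q "h q p"] k(1) pq by (auto simp: P_def)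
  obtain xs where xs: "hd (xs @ [p]) = k" "set (xs @ [p]) \<subseteq> {p..k}"
      "\<forall>x. x \<noteq> p \<and> h p x = h p q \<longrightarrow> turns h k (xs @ [p, x])"
    using right_chain[OF arr, of k p "h p q"] k(1) pq by (auto simp: P_def)
  have "turns h k (xs @ p # q # ys)"
    using turns_append[of h k xs p q ys] xs ys pq by auto
  then have "gp h p q k (xs @ p # q # ys)"
    using xs ys k(1) pq by (cases xs) (auto simp: gp_def P_def)
  then show ?thesis using xs ys by blast
qed

lemma gp_mono: "gp h p' q' k bs \<Longrightarrow> p \<le> p' \<Longrightarrow> q' \<le> q \<Longrightarrow> gp h p q k bs"
  by (auto simp: gp_def)

section \<open>Generators of the dual cone and their restriction to intervals of wires\<close>

context scoords
begin

text \<open>The apex path of p and q switches once between them and otherwise only between wires of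
  p..k or of k+1..q. Induction on q - p therefore recovers every coordinate from the values on
  paths.\<close>

lemma pvecs_span:
  assumes x: "\<And>a. a \<in> pvecs \<Longrightarrow> a \<bullet> x = 0"
  shows "x = 0"
proof -
  have main: "1 \<le> p \<Longrightarrow> p < q \<Longrightarrow> q \<le> n + 1 \<Longrightarrow> x $ e (nd w p q) = 0" for p q
  proof (induction "q - p" arbitrary: p q rule: less_induct)
    case less
    define f where "f = swf w (\<lambda>j. x $ e j)"
    obtain k xs ys where b: "gp (nd w) p q k (xs @ p # q # ys)" "set (xs @ [p]) \<subseteq> {p..k}" "set (q # ys) \<subseteq> {k+1..q}"
      using apex_path[OF arr_nd] less.prems by blast
    have f0: "f a b = 0" if "a \<in> {p..q}" "b \<in> {p..q}" "\<not> (a = p \<and> b = q)" "\<not> (a = q \<and> b = p)" for a b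
    proof -
      have z: "x $ e (nd w a b) = 0" if "a < b" "a \<in> {p..q}" "b \<in> {p..q}" "\<not> (a = p \<and> b = q)" for a b
        using less.hyps[of b a] that less.prems by auto
      show ?thesis using z[of a b] z[of b a] that nd_sym[of w a b]
        by (cases a b rule: linorder_cases) (auto simp: f_def swf_def sw_coef_def)
    qed
    have "xs @ p # q # ys = (xs @ [p]) @ q # ys" by simp
    have "val f (xs @ [p]) = 0" "val f (q # ys) = 0"
      by (rule val_eq_0; rule f0; use b gp_range[OF b(1)] less.prems in force)+
    then have "val f (xs @ p # q # ys) = f p q"
      by (simp add: val_append[of f xs p "q # ys"])
    moreover have "val f (xs @ p # q # ys) = 0"
      using x[of "pvec (xs @ p # q # ys)"] b(1) gp_mono[OF b(1)] less.prems
      unfolding pvec_inner f_def[symmetric] pvecs_def by auto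
    ultimately show ?case using less.prems by (simp add: f_def swf_def sw_coef_def)
  qed
  show ?thesis
    unfolding vec_eq_e_iff
  proof (intro allI impI)
    fix j assume "j < N"
    then show "x $ e j = 0 $ e j"
      using main[of "lw w j" "rw w j"] lw_rw_range[of j] lw_less_rw[of j] nd_lw_rw[of j] length_w_N by auto
  qed
qed

definition pv :: "nat \<Rightarrow> nat \<Rightarrow> (real^'m) set" where
  "pv p q = {pvec bs | k bs. gp (nd w) p q k bs}"

lemma pv_subset: "1 \<le> p \<Longrightarrow> q \<le> n + 1 \<Longrightarrow> pv p q \<subseteq> pvecs"
  unfolding pv_def pvecs_def using gp_mono by blast

text \<open>Simpliciality expressed by independent generators and not by a number of facets: in this
  form it passes to the paths on a smaller interval, where the ambient dimension stays the
  same.\<close>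

definition cone_basis :: "(real^'m) set \<Rightarrow> nat \<Rightarrow> nat \<Rightarrow> bool" where
  "cone_basis M p q \<longleftrightarrow> M \<subseteq> pv p q \<and> independent M \<and>
     (\<forall>x\<in>pv p q. \<exists>c. (\<forall>m\<in>M. 0 \<le> c m) \<and> x = (\<Sum>m\<in>M. c m *\<^sub>R m))"

lemma cone_basis_of_simplicial:
  assumes "num_facets (string_cone n w e) = N"
  shows "\<exists>M. cone_basis M 1 (n + 1)"
proof -
  obtain M where M: "M \<subseteq> pvecs" "irredundant M" "\<And>p. cone_at M p = cone_at pvecs p"
    using irredundant_subset_exists[OF finite_pvecs] by metis
  have fin: "finite M" using M(1) finite_pvecs finite_subset by blast
  have "\<forall>a\<in>M. 0 < a \<bullet> (tvec real - 0)"
    using M(1) pvec_tvec[of _ _ real] by (fastforce simp: pvecs_def)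
  then have "card M = N" using num_facets_cone_at[OF fin M(2)] assms M(3) string_cone_eq by metis
  moreover have "N = DIM(real^'m)"
    using bij_betw_same_card[OF bij_e] by simp
  ultimately have card: "card M = DIM(real^'m)" by simp
  \<comment> \<open>A vector orthogonal to all facet normals lies in the cone together with its
    negative; so all paths vanish on it, and it is 0.\<close>
  have spanM: "span M = UNIV"
  proof (rule ccontr)
    assume "span M \<noteq> UNIV"
    then have "dim M < DIM(real^'m)" using dim_eq_full[of M] dim_subset_UNIV[of M] by linarith
    then obtain x where x: "x \<noteq> 0" "\<And>y. y \<in> span M \<Longrightarrow> orthogonal x y"
      using orthogonal_to_subspace_exists by blast
    have "a \<bullet> x = 0" if "a \<in> M" for a
      using x(2)[OF span_base[OF that]] by (simp add: orthogonal_def inner_commute)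
    then have "x \<in> cone_at M 0" "- x \<in> cone_at M 0" by (auto simp: cone_at_def)
    then have x': "x \<in> cone_at pvecs 0" "- x \<in> cone_at pvecs 0" using M(3) by auto
    have "a \<bullet> x = 0" if "a \<in> pvecs" for a
    proof -
      have "0 \<le> a \<bullet> x" "0 \<le> a \<bullet> (- x)" using x' that by (auto simp: cone_at_def)
      then show ?thesis by simp
    qed
    then show False using pvecs_span x(1) by blast
  qed
  have ind: "independent M"
    using card_le_dim_spanning[of M UNIV] spanM fin card by (simp add: dim_UNIV)
  have "\<exists>c. (\<forall>m\<in>M. 0 \<le> c m) \<and> x = (\<Sum>m\<in>M. c m *\<^sub>R m)" if x: "x \<in> pvecs" for x
  proof -
    have "x \<in> span M" using spanM by simp
    then obtain c where c: "x = (\<Sum>m\<in>M. c m *\<^sub>R m)" using span_finite[OF fin] by auto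
    \<comment> \<open>The component \<open>z\<close> of m orthogonal to the other generators lies in
      the string cone; pairing with it isolates the coefficient of m and shows its sign.\<close>
    have "0 \<le> c m" if m: "m \<in> M" for m
    proof -
      obtain y z where yz: "y \<in> span (M - {m})" "\<And>v. v \<in> span (M - {m}) \<Longrightarrow> orthogonal z v" "m = y + z"
        using orthogonal_subspace_decomp_exists by metis
      have "z \<noteq> 0" using yz ind m by (auto simp: dependent_def)
      have zo: "b \<bullet> z = 0" if "b \<in> M - {m}" for b
        using yz(2)[OF span_base[OF that]] by (simp add: orthogonal_def inner_commute)
      have "y \<bullet> z = 0" using yz(2)[OF yz(1)] by (simp add: orthogonal_def inner_commute)
      then have mz: "m \<bullet> z = z \<bullet> z" using yz(3) by (simp add: inner_add_left)
      have "0 \<le> b \<bullet> z" if "b \<in> M" for b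
        using zo[of b] mz that by (cases "b = m") auto
      then have "z \<in> cone_at M 0" by (simp add: cone_at_def)
      then have "z \<in> cone_at pvecs 0" using M(3) by simp
      then have "0 \<le> x \<bullet> z" using x by (simp add: cone_at_def)
      also have "x \<bullet> z = (\<Sum>b\<in>M. c b * (b \<bullet> z))" by (simp add: c inner_sum_left)
      also have "\<dots> = c m * (z \<bullet> z)"
      proof -
        have "(\<Sum>b\<in>M. c b * (b \<bullet> z)) = c m * (m \<bullet> z) + (\<Sum>b\<in>M-{m}. c b * (b \<bullet> z))"
          using fin m by (rule sum.remove)
        moreover have "(\<Sum>b\<in>M-{m}. c b * (b \<bullet> z)) = 0" by (rule sum.neutral) (simp add: zo)
        ultimately show ?thesis by (simp add: mz)
      qed
      finally have "0 \<le> c m * (z \<bullet> z)" .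
      moreover have "0 < z \<bullet> z" using \<open>z \<noteq> 0\<close> by simp
      ultimately show ?thesis by (simp add: zero_le_mult_iff)
    qed
    then show ?thesis using c by blast
  qed
  moreover have "pv 1 (n + 1) = pvecs" by (auto simp: pv_def pvecs_def)
  ultimately show ?thesis using M(1) ind unfolding cone_basis_def by metis
qed

lemma cone_basis_finite: "cone_basis M p q \<Longrightarrow> finite M"
  using independent_imp_finite by (auto simp: cone_basis_def)

text \<open>\<open>X\<close> is nonnegative on the dual cone, and its zero set cuts out the face of
  the smaller interval: the expansion of a path with value 0 can only use generators with value
  0.\<close>

lemma cone_basis_face:
  assumes M: "cone_basis M p q"
    and X: "\<And>k bs. gp (nd w) p q k bs \<Longrightarrow> 0 \<le> pvec bs \<bullet> X \<and> (pvec bs \<bullet> X = 0 \<longleftrightarrow> gp (nd w) p' q' k bs)"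
    and sub: "p \<le> p'" "q' \<le> q"
  shows "cone_basis {m \<in> M. m \<bullet> X = 0} p' q'"
proof -
  note fin = cone_basis_finite[OF M]
  let ?M' = "{m \<in> M. m \<bullet> X = 0}"
  have mpv: "\<exists>k bs. m = pvec bs \<and> gp (nd w) p q k bs" if "m \<in> M" for m
    using M that unfolding cone_basis_def pv_def by blast
  have "?M' \<subseteq> pv p' q'"
  proof
    fix m assume "m \<in> ?M'"
    then show "m \<in> pv p' q'" using mpv[of m] X unfolding pv_def by blast
  qed
  moreover have "independent ?M'" using M independent_mono[of M ?M'] by (auto simp: cone_basis_def)
  moreover have "\<exists>c. (\<forall>m\<in>?M'. 0 \<le> c m) \<and> x = (\<Sum>m\<in>?M'. c m *\<^sub>R m)" if x: "x \<in> pv p' q'" for x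
  proof -
    obtain k bs where bs: "x = pvec bs" "gp (nd w) p' q' k bs" using x unfolding pv_def by blast
    then have bs': "gp (nd w) p q k bs" using gp_mono sub by blast
    then obtain c where c: "\<forall>m\<in>M. 0 \<le> c m" "x = (\<Sum>m\<in>M. c m *\<^sub>R m)"
      using M bs unfolding cone_basis_def pv_def by blast
    have nn: "0 \<le> m \<bullet> X" if "m \<in> M" for m using mpv[OF that] X by blast
    have "0 = x \<bullet> X" using X[OF bs'] bs by simp
    also have "\<dots> = (\<Sum>m\<in>M. c m * (m \<bullet> X))" by (simp add: c inner_sum_left)
    finally have "\<forall>m\<in>M. c m * (m \<bullet> X) = 0"
      using sum_nonneg_eq_0_iff[OF fin, of "\<lambda>m. c m * (m \<bullet> X)"] c(1) nn by simp
    then have "x = (\<Sum>m\<in>?M'. c m *\<^sub>R m)"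
      unfolding c(2) by (intro sum.mono_neutral_right) (use fin in auto)
    then show ?thesis using c(1) by blast
  qed
  ultimately show ?thesis by (auto simp: cone_basis_def)
qed

text \<open>The functional has weight \<open>N - j\<close> on the nodes of wire q and 0 elsewhere. A
  visit enters q above the node where it leaves and gains the difference of the two weights; a path
  that ends on q keeps the whole weight of its last switch. So the value is 0 exactly if q is
  avoided.\<close>

lemma cone_basis_drop_last:
  assumes M: "cone_basis M p q" and pq: "1 \<le> p" "q \<le> n + 1"
  shows "\<exists>M'. cone_basis M' p (q - 1)"
proof -
  define y where "y j = (if q \<in> {lw w j, rw w j} then real (N - j) else 0)" for j
  define f where "f = swf w (\<lambda>j. vof y $ e j)"
  have f: "f a b = (if a = q then - real (N - nd w a b) else if b = q then real (N - nd w a b) else 0)"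
    "nd w a b < N" if ab: "a \<in> {p..q}" "b \<in> {p..q}" "a \<noteq> b" for a b
  proof -
    have r: "a \<in> {1..n+1}" "b \<in> {1..n+1}" using ab pq by auto
    show l: "nd w a b < N" using nd_less'[OF r ab(3)] length_w_N by simp
    have "y (nd w a b) = (if q \<in> {a, b} then real (N - nd w a b) else 0)"
      unfolding y_def nd_wires[OF r ab(3)] by (rule refl)
    moreover have "f a b = sw_coef a b * y (nd w a b)" unfolding f_def swf_def using l by simp
    moreover have "p \<le> a" "a \<le> q" "p \<le> b" "b \<le> q" using ab by auto
    ultimately show "f a b = (if a = q then - real (N - nd w a b) else if b = q then real (N - nd w a b) else 0)"
      using ab(3) by (simp add: sw_coef_def)
  qed
  have main: "turns (nd w) k (x # bs) \<Longrightarrow> set (x # bs) \<subseteq> {p..q} \<Longrightarrow> k < q \<Longrightarrow> x \<noteq> q \<Longrightarrow>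
      0 \<le> val f (x # bs) \<and> (val f (x # bs) = 0 \<longleftrightarrow> q \<notin> set (x # bs))" for k x bs
  proof (induction bs arbitrary: x rule: length_induct)
    case (1 bs)
    show ?case
    proof (cases bs)
      case (Cons c cs)
      have xc: "x \<noteq> c" using 1 Cons turns_hd_neq by auto
      show ?thesis
      proof (cases "c = q")
        case False
        then have "f x c = 0" using f[of x c] 1 Cons xc by auto
        then show ?thesis using 1(1)[rule_format, of cs c] 1(2-) turns_ConsD[of _ k x "c # cs"] Cons False by auto
      next
        case c: True
        show ?thesis
        proof (cases cs)
          case Nil
          then show ?thesis using c Cons f[of x c] 1 by auto
        next
          case cs: (Cons d ds)
          have "turn (nd w) k x q d" and td: "turns (nd w) k (q # d # ds)" using 1(2) Cons c cs by auto
          then have t: "turn (nd w) k x q d" "turns (nd w) k (d # ds)" "q \<noteq> d"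
            using turns_ConsD[OF td] turns_hd_neq[OF td] by auto
          then have "nd w q x < nd w q d" using 1 by (auto simp: turn_def)
          then have "0 < f x q + f q d"
            using f[of x q] f[of q d] 1(3,5) t Cons c cs nd_sym[of w x q] by auto
          moreover have "0 \<le> val f (d # ds)"
            using 1(1)[rule_format, of ds d] 1(2-) Cons cs t by auto
          ultimately show ?thesis using Cons c cs by auto
        qed
      qed
    qed (use 1 in auto)
  qed
  have X: "0 \<le> pvec bs \<bullet> vof y \<and> (pvec bs \<bullet> vof y = 0 \<longleftrightarrow> gp (nd w) p (q - 1) k bs)"
    if bs: "gp (nd w) p q k bs" for k bs
  proof -
    have kq: "k < q" using gp_range[OF bs] by simp
    obtain cs where cs: "bs = k # cs" using bs by (cases bs) (auto simp: gp_def)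
    have "gp (nd w) p (q - 1) k bs \<longleftrightarrow> q \<notin> set bs"
    proof -
      have "{p..q-1} = {p..q} - {q}" using kq by auto
      then show ?thesis using bs by (auto simp: gp_def)
    qed
    then show ?thesis using main[of k k cs] bs kq unfolding pvec_inner f_def[symmetric] cs
      by (simp add: gp_def)
  qed
  have "cone_basis {m \<in> M. m \<bullet> vof y = 0} p (q - 1)"
    by (rule cone_basis_face[OF M]) (use X in simp_all)
  then show ?thesis by blast
qed

text \<open>The same weights on wire p, which is travelled upward. Here a path may start on p but
  never ends there, so the first segment needs its own case.\<close>

lemma cone_basis_drop_first:
  assumes M: "cone_basis M p q" and pq: "1 \<le> p" "q \<le> n + 1"
  shows "\<exists>M'. cone_basis M' (p + 1) q"
proof -
  define y where "y j = (if p \<in> {lw w j, rw w j} then real (N - j) else 0)" for j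
  define f where "f = swf w (\<lambda>j. vof y $ e j)"
  have f: "f a b = (if a = p then real (N - nd w a b) else if b = p then - real (N - nd w a b) else 0)"
    "nd w a b < N" if ab: "a \<in> {p..q}" "b \<in> {p..q}" "a \<noteq> b" for a b
  proof -
    have r: "a \<in> {1..n+1}" "b \<in> {1..n+1}" using ab pq by auto
    show l: "nd w a b < N" using nd_less'[OF r ab(3)] length_w_N by simp
    have "y (nd w a b) = (if p \<in> {a, b} then real (N - nd w a b) else 0)"
      unfolding y_def nd_wires[OF r ab(3)] by (rule refl)
    moreover have "f a b = sw_coef a b * y (nd w a b)" unfolding f_def swf_def using l by simp
    moreover have "p \<le> a" "a \<le> q" "p \<le> b" "b \<le> q" using ab by auto
    ultimately show "f a b = (if a = p then real (N - nd w a b) else if b = p then - real (N - nd w a b) else 0)"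
      using ab(3) by (simp add: sw_coef_def)
  qed
  have main: "turns (nd w) k (x # bs) \<Longrightarrow> set (x # bs) \<subseteq> {p..q} \<Longrightarrow> p \<le> k \<Longrightarrow> last (x # bs) \<noteq> p \<Longrightarrow> x \<noteq> p \<Longrightarrow>
      0 \<le> val f (x # bs) \<and> (val f (x # bs) = 0 \<longleftrightarrow> p \<notin> set (x # bs))" for k x bs
  proof (induction bs arbitrary: x rule: length_induct)
    case (1 bs)
    show ?case
    proof (cases bs)
      case (Cons c cs)
      have xc: "x \<noteq> c" using 1 Cons turns_hd_neq by auto
      show ?thesis
      proof (cases "c = p")
        case False
        then have "f x c = 0" using f[of x c] 1 Cons xc by auto
        then show ?thesis using 1(1)[rule_format, of cs c] 1(2-) turns_ConsD[of _ k x "c # cs"] Cons False by auto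
      next
        case c: True
        show ?thesis
        proof (cases cs)
          case Nil
          then show ?thesis using c Cons 1 by auto
        next
          case cs: (Cons d ds)
          have "turn (nd w) k x p d" and td: "turns (nd w) k (p # d # ds)" using 1(2) Cons c cs by auto
          then have t: "turn (nd w) k x p d" "turns (nd w) k (d # ds)" "p \<noteq> d"
            using turns_ConsD[OF td] turns_hd_neq[OF td] by auto
          then have "nd w p d < nd w p x" using 1 by (auto simp: turn_def)
          then have "0 < f x p + f p d"
            using f[of x p] f[of p d] 1(3,6) t Cons c cs nd_sym[of w x p] by auto
          moreover have "0 \<le> val f (d # ds)"
            using 1(1)[rule_format, of ds d] 1(2-) Cons cs t by auto
          ultimately show ?thesis using Cons c cs by auto
        qed
      qed
    qed (use 1 in auto)
  qed
  have X: "0 \<le> pvec bs \<bullet> vof y \<and> (pvec bs \<bullet> vof y = 0 \<longleftrightarrow> gp (nd w) (p + 1) q k bs)"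
    if bs: "gp (nd w) p q k bs" for k bs
  proof -
    have kp: "p \<le> k" using gp_range[OF bs] by simp
    obtain c cs where cs: "bs = k # c # cs" using bs by (cases bs; cases "tl bs") (auto simp: gp_def)
    have g: "gp (nd w) (p + 1) q k bs \<longleftrightarrow> p \<notin> set bs"
    proof -
      have "{p+1..q} = {p..q} - {p}" by auto
      then show ?thesis using bs by (auto simp: gp_def)
    qed
    have b: "turns (nd w) k (k # c # cs)" "set bs \<subseteq> {p..q}" "last bs = Suc k" using bs cs by (auto simp: gp_def)
    have kc: "k \<noteq> c" using b turns_hd_neq by blast
    show ?thesis
    proof (cases "k = p")
      case True
      have "0 < f k c" using f[of k c] b cs kc True by auto
      moreover have "0 \<le> val f (c # cs)"
        using main[of k c cs] b cs kc kp True turns_ConsD[of _ _ k "c # cs"] by auto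
      ultimately show ?thesis unfolding pvec_inner f_def[symmetric] g using cs True by auto
    next
      case False
      then show ?thesis using main[of k k "c # cs"] b kp cs unfolding pvec_inner f_def[symmetric] g by auto
    qed
  qed
  have "cone_basis {m \<in> M. m \<bullet> vof y = 0} (p + 1) q"
    by (rule cone_basis_face[OF M]) (use X in simp_all)
  then show ?thesis by blast
qed

end

text \<open>Wire q comes last among p..q. Comparing on the smaller wire a is enough: the order axiom
  then puts the crossing of b and q below that of a and b as well. Every comparison is along one
  wire, hence invariant under 2-moves.\<close>

definition ZD :: "(nat \<Rightarrow> nat \<Rightarrow> nat) \<Rightarrow> nat \<Rightarrow> nat \<Rightarrow> bool" where
  "ZD h p q \<longleftrightarrow> (\<forall>a b. p \<le> a \<and> a < b \<and> b < q \<longrightarrow> h a b < h a q)"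

definition ZA :: "(nat \<Rightarrow> nat \<Rightarrow> nat) \<Rightarrow> nat \<Rightarrow> nat \<Rightarrow> bool" where
  "ZA h p q \<longleftrightarrow> (\<forall>b c. p < b \<and> b < c \<and> c \<le> q \<longrightarrow> h b c < h b p)"

lemma turns_nth:
  "turns h k Q \<Longrightarrow> Suc i < length Q \<Longrightarrow> Q ! i \<noteq> Q ! Suc i \<and>
     (Suc (Suc i) < length Q \<longrightarrow> turn h k (Q ! i) (Q ! Suc i) (Q ! Suc (Suc i)))"
proof (induction Q arbitrary: i)
  case (Cons x Q)
  show ?case
  proof (cases i)
    case 0
    then show ?thesis using Cons.prems turns_hd_neq[of h k x "hd Q" "tl Q"]
      by (cases Q; cases "tl Q") auto
  next
    case (Suc j)
    then show ?thesis using Cons.IH[of j] Cons.prems turns_ConsD by auto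
  qed
qed simp

lemma pairs_nth: "(a, b) \<in> set (zip Q (tl Q)) \<longleftrightarrow> (\<exists>i. Suc i < length Q \<and> Q ! i = a \<and> Q ! Suc i = b)"
proof -
  have "i < length Q \<and> i < length (tl Q) \<longleftrightarrow> Suc i < length Q" for i by auto
  then have "(a, b) \<in> set (zip Q (tl Q)) \<longleftrightarrow> (\<exists>i. Q ! i = a \<and> tl Q ! i = b \<and> Suc i < length Q)"
    by (simp add: in_set_zip)
  also have "\<dots> \<longleftrightarrow> (\<exists>i. Suc i < length Q \<and> Q ! i = a \<and> Q ! Suc i = b)"
    by (rule arg_cong[of _ _ Ex], rule ext) (auto simp: nth_tl)
  finally show ?thesis .
qed

section \<open>Extreme paths and relations between them\<close>

context scoords
begin

lemma gpw_of_gp: "gp (nd w) p q k bs \<Longrightarrow> 1 \<le> p \<Longrightarrow> q \<le> n + 1 \<Longrightarrow> gpw k bs"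
  by (rule gp_mono)

text \<open>Pairing with \<open>tvec\<close> of a step function reads off the type of a path.\<close>

lemma coeff_other_type:
  assumes "finite M" "M \<subseteq> pvecs" "\<forall>m\<in>M. 0 \<le> c m" "gpw k P" "pvec P = (\<Sum>m\<in>M. c m *\<^sub>R m)"
    and "pvec Q \<in> M" "gpw l Q" "l \<noteq> k"
  shows "c (pvec Q) = 0"
proof -
  define \<tau> where "\<tau> = tvec (\<lambda>c. if l < c then 1 else 0)"
  have \<tau>: "pvec R \<bullet> \<tau> = (if i = l then 1 else 0)" if "gpw i R" for i R
    using pvec_tvec[OF that] by (auto simp: \<tau>_def)
  have nn: "0 \<le> m \<bullet> \<tau>" if "m \<in> M" for m using \<tau> that assms(2) by (force simp: pvecs_def)
  have "0 = pvec P \<bullet> \<tau>" using \<tau>[OF assms(4)] assms(8) by simp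
  also have "\<dots> = (\<Sum>m\<in>M. c m * (m \<bullet> \<tau>))" by (simp add: assms(5) inner_sum_left)
  finally have "\<forall>m\<in>M. c m * (m \<bullet> \<tau>) = 0"
    using sum_nonneg_eq_0_iff[OF assms(1), of "\<lambda>m. c m * (m \<bullet> \<tau>)"] assms(3) nn by simp
  then show ?thesis using assms(6) \<tau>[OF assms(7)] by auto
qed

text \<open>The expansions of paths of different types use disjoint sets of generators; by
  independence the relation splits into one relation for each type.\<close>

lemma cone_basis_type_independent:
  assumes M: "cone_basis M p q" and pq: "1 \<le> p" "q \<le> n + 1" and kl: "k \<noteq> l"
    and gp: "gp (nd w) p q k P" "gp (nd w) p q k P'" "gp (nd w) p q l R" "gp (nd w) p q l R'"
    and eq: "pvec P + pvec R = pvec P' + pvec R'"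
  shows "pvec P = pvec P'"
proof -
  note fin = cone_basis_finite[OF M]
  have sub: "M \<subseteq> pvecs" using M pv_subset pq by (auto simp: cone_basis_def)
  have ex: "\<exists>c. (\<forall>m\<in>M. 0 \<le> c m) \<and> pvec X = (\<Sum>m\<in>M. c m *\<^sub>R m)" if "gp (nd w) p q i X" for i X
    using M that unfolding cone_basis_def pv_def by blast
  obtain a where a: "\<forall>m\<in>M. 0 \<le> a m" "pvec P = (\<Sum>m\<in>M. a m *\<^sub>R m)" using ex gp by blast
  obtain a' where a': "\<forall>m\<in>M. 0 \<le> a' m" "pvec P' = (\<Sum>m\<in>M. a' m *\<^sub>R m)" using ex gp by blast
  obtain b where b: "\<forall>m\<in>M. 0 \<le> b m" "pvec R = (\<Sum>m\<in>M. b m *\<^sub>R m)" using ex gp by blast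
  obtain b' where b': "\<forall>m\<in>M. 0 \<le> b' m" "pvec R' = (\<Sum>m\<in>M. b' m *\<^sub>R m)" using ex gp by blast
  have "(\<Sum>m\<in>M. (a m + b m - a' m - b' m) *\<^sub>R m) = pvec P + pvec R - pvec P' - pvec R'"
    by (simp add: a b a' b' scaleR_left_distrib scaleR_left_diff_distrib sum.distrib sum_subtractf)
  also have "\<dots> = 0" using eq by simp
  finally have "\<forall>m\<in>M. a m + b m - a' m - b' m = 0"
    using M fin independentD[of M M "\<lambda>m. a m + b m - a' m - b' m"] by (auto simp: cone_basis_def)
  then have ab: "a m + b m = a' m + b' m" if "m \<in> M" for m using that by force
  note g = gp[THEN gpw_of_gp, OF pq]
  have "a m = a' m" if "m \<in> M" for m
  proof -
    obtain i Q where Q: "m = pvec Q" "gpw i Q" using \<open>m \<in> M\<close> sub unfolding pvecs_def by blast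
    note z = coeff_other_type[OF fin sub]
    show ?thesis
    proof (cases "i = k")
      case True
      then have "b m = 0" "b' m = 0"
        using z[OF b(1) g(3) b(2), of Q i] z[OF b'(1) g(4) b'(2), of Q i] Q kl that by auto
      then show ?thesis using ab[OF that] by simp
    next
      case False
      then have "a m = 0" "a' m = 0"
        using z[OF a(1) g(1) a(2), of Q i] z[OF a'(1) g(2) a'(2), of Q i] Q that by auto
      then show ?thesis by simp
    qed
  qed
  then show ?thesis by (simp add: a a')
qed

text \<open>The pairing is the number of switches of P that Q makes in the same direction, minus
  those that it makes in the opposite direction.\<close>

lemma inner_pvec_le:
  assumes P: "gpw k P" and Q: "gpw l Q"
  shows "pvec P \<bullet> pvec Q \<le> real (length P - 1)"
    and "pvec P \<bullet> pvec Q = real (length P - 1) \<longleftrightarrow> set (zip P (tl P)) \<subseteq> set (zip Q (tl Q))"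
proof -
  have g: "swf w (\<lambda>j. pvec Q $ e j) a b = (if (a, b) \<in> set (zip Q (tl Q)) then 1 else if (b, a) \<in> set (zip Q (tl Q)) then -1 else 0)"
    if "a \<in> {1..n+1}" "b \<in> {1..n+1}" "a \<noteq> b" for a b
    unfolding swf_def by (rule sw_coef_pvec[OF Q that])
  have "set P \<subseteq> {1..n+1}" "turns (nd w) k P" using P by (auto simp: gp_def)
  then have "val (swf w (\<lambda>j. pvec Q $ e j)) P \<le> real (length P - 1) \<and>
      (val (swf w (\<lambda>j. pvec Q $ e j)) P = real (length P - 1) \<longleftrightarrow> set (zip P (tl P)) \<subseteq> set (zip Q (tl Q)))"
  proof (induction P rule: induct_list012)
    case (3 x y zs)
    have IH: "val (swf w (\<lambda>j. pvec Q $ e j)) (y # zs) \<le> real (length zs) \<and>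
      (val (swf w (\<lambda>j. pvec Q $ e j)) (y # zs) = real (length zs) \<longleftrightarrow> set (zip (y # zs) zs) \<subseteq> set (zip Q (tl Q)))"
      using 3 turns_ConsD by auto
    have "x \<noteq> y" using 3 turns_hd_neq by blast
    then show ?case using IH g[of x y] 3(3) by auto
  qed auto
  then show "pvec P \<bullet> pvec Q \<le> real (length P - 1)"
    and "pvec P \<bullet> pvec Q = real (length P - 1) \<longleftrightarrow> set (zip P (tl P)) \<subseteq> set (zip Q (tl Q))"
    by (auto simp: pvec_inner)
qed

text \<open>\<open>tvec real\<close> has value 1 on every path, so P is a convex combination of
  generators. The pairing with P attains its maximum at P, hence at each generator that occurs; such
  a generator contains all switches of P, has the same type, and so is P.\<close>

lemma cone_basis_extreme:
  assumes M: "cone_basis M p q" and pq: "1 \<le> p" "q \<le> n + 1" and P: "gp (nd w) p q k P"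
    and ext: "\<And>Q. gp (nd w) p q k Q \<Longrightarrow> set (zip P (tl P)) \<subseteq> set (zip Q (tl Q)) \<Longrightarrow> Q = P"
  shows "pvec P \<in> M"
proof -
  note fin = cone_basis_finite[OF M]
  have sub: "M \<subseteq> pvecs" using M pv_subset pq by (auto simp: cone_basis_def)
  obtain c where c: "\<forall>m\<in>M. 0 \<le> c m" "pvec P = (\<Sum>m\<in>M. c m *\<^sub>R m)"
    using M P unfolding cone_basis_def pv_def by blast
  have Pw: "gpw k P" using gpw_of_gp[OF P pq] .
  define L where "L = real (length P - 1)"
  define \<tau> where "\<tau> = tvec real"
  have \<tau>: "m \<bullet> \<tau> = 1" if "m \<in> M" for m using that sub pvec_tvec[of _ _ real] by (force simp: pvecs_def \<tau>_def)
  have "1 = pvec P \<bullet> \<tau>" using pvec_tvec[OF Pw, of real] by (simp add: \<tau>_def)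
  also have "\<dots> = (\<Sum>m\<in>M. c m * (m \<bullet> \<tau>))" by (simp add: c inner_sum_left)
  also have "\<dots> = (\<Sum>m\<in>M. c m)" by (intro sum.cong) (auto simp: \<tau>)
  finally have s1: "(\<Sum>m\<in>M. c m) = 1" by simp
  have le: "m \<bullet> pvec P \<le> L" if m: "m \<in> M" for m
  proof -
    obtain l Q where "m = pvec Q" "gpw l Q" using m sub by (auto simp: pvecs_def)
    then show ?thesis using inner_pvec_le(1)[OF Pw, of l Q] by (simp add: inner_commute[of "pvec Q"] L_def)
  qed
  have "L = pvec P \<bullet> pvec P" using inner_pvec_le(2)[OF Pw Pw] by (simp add: L_def)
  also have "\<dots> = (\<Sum>m\<in>M. c m * (m \<bullet> pvec P))"
    by (subst c(2)) (simp add: inner_sum_left)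
  finally have "(\<Sum>m\<in>M. c m * (L - m \<bullet> pvec P)) = 0"
    using s1 by (simp add: right_diff_distrib sum_subtractf flip: sum_distrib_right)
  moreover have "0 \<le> c m * (L - m \<bullet> pvec P)" if "m \<in> M" for m using c(1) le that by simp
  ultimately have z: "\<forall>m\<in>M. c m * (L - m \<bullet> pvec P) = 0"
    using sum_nonneg_eq_0_iff[OF fin, of "\<lambda>m. c m * (L - m \<bullet> pvec P)"] by simp
  obtain m where m: "m \<in> M" "c m \<noteq> 0" using s1 by (metis sum.neutral zero_neq_one)
  obtain l Q where Q: "m = pvec Q" "gp (nd w) p q l Q" using m(1) M unfolding cone_basis_def pv_def by blast
  have Qw: "gpw l Q" using gpw_of_gp[OF Q(2) pq] .
  have "l = k" using coeff_other_type[OF fin sub c(1) Pw c(2) _ Qw] m Q by auto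
  have "pvec P \<bullet> pvec Q = L" using z m Q by (auto simp: inner_commute)
  then have "Q = P" using inner_pvec_le(2)[OF Pw Qw] ext[of Q] Q \<open>l = k\<close> by (simp add: L_def)
  then show ?thesis using m Q by simp
qed

text \<open>
  Two wires \<open>p\<close>, \<open>q\<close> below everything else that cross between their crossings with \<open>k\<close> and \<open>k + 1\<close>:
  exchanging at the crossing of \<open>p\<close> and \<open>q\<close> the two paths through it gives an affine relation
  between four extreme paths.
\<close>

lemma crossing_exchange:
  assumes M: "cone_basis M p q" and pq: "1 \<le> p" "q \<le> n + 1" and k: "p < k" "k + 1 < q"
    and ZA: "ZA (nd w) p (q - 1)" and ZD: "ZD (nd w) (p + 1) q"
    and kr: "nd w p q < nd w p k" and kl: "nd w p (k + 1) < nd w p q"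
  shows False
proof -
  define h where "h = nd w"
  have arr: "arr (n + 1) h" using arr_nd by (simp add: h_def)
  note tri = arr_triple[OF arr]
  have sym: "h a b = h b a" for a b by (simp add: h_def nd_sym)
  have ZA': "h b c < h b p" if "p < b" "b < c" "c < q" for b c
    using ZA that unfolding ZA_def h_def by auto
  have ZD': "h a b < h a q" if "p < a" "a < b" "b < q" for a b
    using ZD that unfolding ZD_def h_def by auto
  have kr': "h p q < h p k" "h q k < h q p" "h k q < h k p"
    and kl': "h p (k + 1) < h p q" "h q p < h q (k + 1)" "h (k + 1) p < h (k + 1) q"
    using kr kl tri[of p k q] tri[of p "k + 1" q] k pq by (auto simp: h_def)
  \<comment> \<open>Among the wires p..q, wire k read downward ends with its crossings with q and
    then p, wire k + 1 with p and then q; on p and on q only their common crossing lies between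
    those with k and k + 1. This leaves a path no room for detours.\<close>
  have wk: "h k d < h k q" if "p < d" "d < q" "d \<noteq> k" for d
    using ZD'[of k d] ZD'[of d k] tri[of d k q] that k pq sym[of d k] by (cases "d < k") auto
  have wk1: "h (k + 1) d < h (k + 1) p" if "p < d" "d < q" "d \<noteq> k + 1" for d
    using ZA'[of "k + 1" d] ZA'[of d "k + 1"] tri[of p d "k + 1"] that k pq sym[of d "k + 1"] by (cases "d < k + 1") auto
  have wp1: "h p k < h p d" if "p < d" "d < k" for d
    using ZA'[of d k] tri[of p d k] that k pq by auto
  have wp2: "h p d < h p (k + 1)" if "k + 1 < d" "d < q" for d
    using ZA'[of "k + 1" d] tri[of p "k + 1" d] that k pq by auto
  have wq1: "h q d < h q k" if "p < d" "d < k" for d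
    using ZD'[of d k] tri[of d k q] that k pq by auto
  have wq2: "h q (k + 1) < h q d" if "k + 1 < d" "d < q" for d
    using ZD'[of "k + 1" d] tri[of "k + 1" d q] that k pq by auto
  let ?P1 = "[k, q, k + 1]" and ?P2 = "[k, p, k + 1]" and ?P3 = "[k, q, p, k + 1]" and ?P4 = "[k, p, q, k + 1]"
  have tq: "turn h k x q c" if "h q x < h q c" "c \<in> {p, k + 1}" for x c
  proof -
    have "h q c \<le> h q d" if "k < d" "d < q" for d
      using wq2[of d] kl' that \<open>c \<in> {p, k + 1}\<close> by (cases "d = k + 1") (auto intro: less_imp_le less_trans)
    then have "\<not> h q d < h q c" if "k < d \<and> d < q" for d using that leD by blast
    then show ?thesis using that k by (simp add: turn_def)
  qed
  have tp: "turn h k x p c" if "h p c < h p x" "x \<in> {k, q}" for x c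
  proof -
    have "h p x \<le> h p d" if "p < d" "d \<le> k" for d
      using wp1[of d] kr' that \<open>x \<in> {k, q}\<close> by (cases "d = k") (auto intro: less_imp_le less_trans)
    then have "\<not> h p d < h p x" if "p < d \<and> d \<le> k" for d using that leD by blast
    then show ?thesis using that k by (simp add: turn_def)
  qed
  have gps: "gp h p q k ?P1" "gp h p q k ?P2" "gp h p q k ?P3" "gp h p q k ?P4"
  proof -
    have "turn h k k q (k + 1)" "turn h k k q p" "turn h k p q (k + 1)"
      using tq[of k "k + 1"] tq[of k p] tq[of p "k + 1"] kr' kl' by auto
    moreover have "turn h k k p (k + 1)" "turn h k k p q" "turn h k q p (k + 1)"
      using tp[of "k + 1" k] tp[of q k] tp[of "k + 1" q] kr' kl' by auto
    ultimately show "gp h p q k ?P1" "gp h p q k ?P2" "gp h p q k ?P3" "gp h p q k ?P4"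
      using k by (simp_all add: gp_def)
  qed
  have fst_last: "Q ! 0 = k \<and> Q ! (length Q - 1) = k + 1 \<and> 1 < length Q" if Q: "gp h p q k Q" for Q
  proof -
    have "Q \<noteq> []" "hd Q = k" "last Q = k + 1" using Q by (auto simp: gp_def)
    moreover from this have "1 < length Q" by (cases Q; cases "tl Q") auto
    ultimately show ?thesis by (simp add: hd_conv_nth last_conv_nth)
  qed
  obtain \<Phi> where pot: "potential (n + 1) h k \<Phi>" using potential_exists[OF arr] by blast
  have mono: "if k < b then \<Phi> b c < \<Phi> b d \<longleftrightarrow> h b c < h b d else \<Phi> b c < \<Phi> b d \<longleftrightarrow> h b d < h b c"
    if "b \<in> {p..q}" "c \<in> {p..q}" "d \<in> {p..q}" "b \<noteq> c" "b \<noteq> d" for b c d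
  proof -
    have r: "b \<in> {1..n+1}" "c \<in> {1..n+1} - {b}" "d \<in> {1..n+1} - {b}" using that pq by auto
    have "h b c < h b d \<Longrightarrow> (if k < b then \<Phi> b c < \<Phi> b d else \<Phi> b d < \<Phi> b c)"
         "h b d < h b c \<Longrightarrow> (if k < b then \<Phi> b d < \<Phi> b c else \<Phi> b c < \<Phi> b d)"
      using pot r unfolding potential_def by blast+
    moreover have "h b c = h b d \<Longrightarrow> c = d" using arr_neq[OF arr, of b c d] r by auto
    ultimately show ?thesis by (cases "h b c" "h b d" rule: linorder_cases) (auto split: if_splits)
  qed
  have psym: "\<Phi> b c = \<Phi> c b" if "b \<in> {p..q}" "c \<in> {p..q}" "b \<noteq> c" for b c
  proof -
    have "b \<in> {1..n+1}" "c \<in> {1..n+1} - {b}" using that pq by auto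
    then show ?thesis using pot unfolding potential_def by blast
  qed
  have nth: "Q ! i \<in> {p..q}" if "gp h p q k Q" "i < length Q" for Q i
    using that nth_mem[of i Q] unfolding gp_def by blast
  have tnth: "Q ! i \<noteq> Q ! Suc i" "Suc (Suc i) < length Q \<Longrightarrow> turn h k (Q ! i) (Q ! Suc i) (Q ! Suc (Suc i))"
    if "gp h p q k Q" "Suc i < length Q" for Q i
    using that turns_nth[of h k Q i] by (auto simp: gp_def)
  have incr: "\<Phi> (Q ! i) (Q ! Suc i) < \<Phi> (Q ! j) (Q ! Suc j)" if "gp h p q k Q" "i < j" "Suc j < length Q" for Q i j
  proof -
    have "set Q \<subseteq> {1..n+1}" "turns h k Q" using that(1) pq by (auto simp: gp_def)
    then have "sorted_wrt (\<lambda>(a, b) (c, d). \<Phi> a b < \<Phi> c d) (zip Q (tl Q))" using turns_increasing[OF pot] by blast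
    from sorted_wrt_nth_less[OF this, of i j] show ?thesis using that by (simp add: nth_tl)
  qed
  have incr_le: "\<Phi> (Q ! i) (Q ! Suc i) \<le> \<Phi> (Q ! j) (Q ! Suc j)" if "gp h p q k Q" "i \<le> j" "Suc j < length Q" for Q i j
    using incr[of Q i j] that by (cases "i = j") auto
  have pqk: "p \<in> {p..q}" "q \<in> {p..q}" "k \<in> {p..q}" "k + 1 \<in> {p..q}" using k by auto
  have maxk: "\<not> h k p < h k x" if "x \<in> {p..q}" "x \<noteq> k" for x
    using wk[of x] kr' that by (cases "x = p \<or> x = q") auto
  have maxk': "x = p" if "x \<in> {p..q}" "x \<noteq> k" "h k q < h k x" for x
    using wk[of x] that by (cases "x = p \<or> x = q") auto
  have maxk1: "\<not> h (k + 1) q < h (k + 1) x" if "x \<in> {p..q}" "x \<noteq> k + 1" for x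
    using wk1[of x] kl' that by (cases "x = p \<or> x = q") auto
  have maxk1': "x = q" if "x \<in> {p..q}" "x \<noteq> k + 1" "h (k + 1) p < h (k + 1) x" for x
    using wk1[of x] that by (cases "x = p \<or> x = q") auto
  have bq: "x = p" if "x \<in> {p..q}" "x \<noteq> q" "h q k < h q x" "h q x < h q (k + 1)" for x
    using wq1[of x] wq2[of x] that by (cases "x < k"; cases "x = k"; cases "x = k + 1"; cases "x = p") auto
  have bp: "x = q" if "x \<in> {p..q}" "x \<noteq> p" "h p (k + 1) < h p x" "h p x < h p k" for x
    using wp1[of x] wp2[of x] that by (cases "x < k"; cases "x = k"; cases "x = k + 1"; cases "x = q") auto
  have mk: "\<Phi> k c < \<Phi> k d \<longleftrightarrow> h k d < h k c" if "c \<in> {p..q}" "d \<in> {p..q}" "k \<noteq> c" "k \<noteq> d" for c d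
    using mono[of k c d] that pqk by simp
  have mk1: "\<Phi> (k + 1) c < \<Phi> (k + 1) d \<longleftrightarrow> h (k + 1) c < h (k + 1) d"
    if "c \<in> {p..q}" "d \<in> {p..q}" "k + 1 \<noteq> c" "k + 1 \<noteq> d" for c d
    using mono[of "k + 1" c d] that pqk by simp
  have mp: "\<Phi> p c < \<Phi> p d \<longleftrightarrow> h p d < h p c" if "c \<in> {p..q}" "d \<in> {p..q}" "p \<noteq> c" "p \<noteq> d" for c d
    using mono[of p c d] that pqk k by simp
  have mq: "\<Phi> q c < \<Phi> q d \<longleftrightarrow> h q c < h q d" if "c \<in> {p..q}" "d \<in> {p..q}" "q \<noteq> c" "q \<noteq> d" for c d
    using mono[of q c d] that pqk k by simp
  \<comment> \<open>A switch from k to p or q in the middle of a path would have entered k at its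
    lowest crossing, that with p. Among the crossings on k this has the smallest potential, but the
    first switch of the path, also on k, would precede it.\<close>
  have first: "i = 0" if Q: "gp h p q k Q" "Suc i < length Q" "Q ! i = k" "Q ! Suc i \<in> {p, q}" for Q i
  proof (rule ccontr)
    assume "i \<noteq> 0"
    then obtain l where l: "i = Suc l" by (cases i) auto
    define x where "x = Q ! l"
    have x: "x \<in> {p..q}" "x \<noteq> k" using nth[of Q l] tnth(1)[of Q l] Q l by (auto simp: x_def)
    have "turn h k x k (Q ! Suc i)" using tnth(2)[of Q l] Q l by (simp add: x_def)
    then have "h k (Q ! Suc i) < h k x" by (simp add: turn_def)
    then have xp: "x = p" using Q(4) maxk[OF x] maxk'[OF x] by auto
    have "l \<noteq> 0" using fst_last[OF Q(1)] xp k by (auto simp: x_def intro: Nat.gr0I)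
    then have "\<Phi> (Q ! 0) (Q ! 1) < \<Phi> p k" using incr[of Q 0 l] Q l xp by (simp add: x_def)
    moreover have "Q ! 0 = k" "Q ! 1 \<in> {p..q}" "Q ! 1 \<noteq> k"
      using fst_last[OF Q(1)] nth[of Q 1] tnth(1)[of Q 0] Q by auto
    ultimately show False using mk[of "Q ! 1" p] maxk[of "Q ! 1"] psym[of p k] pqk k by auto
  qed
  have last: "Suc (Suc i) = length Q" if Q: "gp h p q k Q" "Suc i < length Q" "Q ! i \<in> {p, q}" "Q ! Suc i = k + 1" for Q i
  proof (rule ccontr)
    assume "Suc (Suc i) \<noteq> length Q"
    then have l: "Suc (Suc i) < length Q" using Q by simp
    define c where "c = Q ! Suc (Suc i)"
    have c: "c \<in> {p..q}" "c \<noteq> k + 1" using nth[of Q "Suc (Suc i)"] tnth(1)[of Q "Suc i"] Q l by (auto simp: c_def)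
    have "turn h k (Q ! i) (k + 1) c" using tnth(2)[of Q i] Q l by (simp add: c_def)
    then have "h (k + 1) (Q ! i) < h (k + 1) c" by (simp add: turn_def)
    then have cq: "c = q" using Q(3) maxk1[OF c] maxk1'[OF c] by auto
    define j where "j = length Q - 2"
    have j: "Suc j < length Q" "Suc j = length Q - 1" "Suc i \<le> j" using l by (auto simp: j_def)
    have end_: "Q ! Suc j = k + 1" using fst_last[OF Q(1)] j by simp
    have "Suc i \<noteq> j" using end_ cq k by (auto simp: c_def)
    then have "\<Phi> (k + 1) q < \<Phi> (Q ! j) (k + 1)" using incr[of Q "Suc i" j] Q j end_ cq by (simp add: c_def)
    moreover have "Q ! j \<in> {p..q}" "Q ! j \<noteq> k + 1" using nth[of Q j] tnth(1)[of Q j] Q j end_ by auto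
    ultimately show False using mk1[of q "Q ! j"] maxk1[of "Q ! j"] psym[of "Q ! j" "k + 1"] pqk k by auto
  qed
  have len: "Q = [Q ! 0, Q ! 1, Q ! 2]" if "length Q = 3" for Q :: "nat list"
    using that by (auto simp: numeral_3_eq_3 length_Suc_conv)
  have len4: "Q = [Q ! 0, Q ! 1, Q ! 2, Q ! 3]" if "length Q = 4" for Q :: "nat list"
    using that by (auto simp: numeral_eq_Suc length_Suc_conv)
  \<comment> \<open>Each of the four paths is determined by its switches: by \<open>first\<close>
    and \<open>last\<close> they fix both ends, and nothing can be inserted on p or q between k and
    k + 1.\<close>
  have P1: "Q = ?P1" if Q: "gp h p q k Q" "(k, q) \<in> set (zip Q (tl Q))" "(q, k + 1) \<in> set (zip Q (tl Q))" for Q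
  proof -
    have Q01: "Q ! 0 = k" "Q ! 1 = q" using Q(2) first[OF Q(1)] fst_last[OF Q(1)] unfolding pairs_nth by auto
    obtain j where j: "Suc j < length Q" "Q ! j = q" "Q ! Suc j = k + 1" using Q(3) unfolding pairs_nth by blast
    have L: "length Q = Suc (Suc j)" using last[OF Q(1) j(1)] j by simp
    have j1: "1 \<le> j" using Q01 j k by (cases j) auto
    show ?thesis
    proof (cases "j = 1")
      case True
      then show ?thesis using len[of Q] L Q01 j by (simp add: numeral_2_eq_2)
    next
      case False
      then obtain l where l: "j = Suc l" "1 \<le> l" using j1 by (cases j) auto
      define c o' where "c = Q ! 2" and "o' = Q ! l"
      have "2 < length Q" using L l by simp
      have c: "c \<in> {p..q}" "q \<noteq> c" "h q k < h q c"
        using nth[of Q 2] tnth(1)[of Q 1] tnth(2)[of Q 0] Q01 Q \<open>2 < length Q\<close> k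
        by (auto simp: c_def numeral_2_eq_2 turn_def)
      have o': "o' \<in> {p..q}" "q \<noteq> o'" using nth[of Q l] tnth(1)[of Q l] Q j l by (auto simp: o'_def)
      have 1: "\<Phi> q c \<le> \<Phi> o' q" using incr_le[of Q 1 l] Q Q01 j l by (simp add: c_def o'_def numeral_2_eq_2)
      have 2: "\<Phi> o' q < \<Phi> q (k + 1)" using incr[of Q l j] Q j l by (simp add: o'_def)
      have s: "\<Phi> o' q = \<Phi> q o'" using psym[of o' q] o' pqk by auto
      have "h q c < h q (k + 1)" using 1 2 mq[of c "k + 1"] c pqk k by auto
      then have cp: "c = p" using bq[of c] c by auto
      have "\<not> h q o' < h q p" "h q o' < h q (k + 1)" using 1 2 s cp mq[of o' p] mq[of o' "k + 1"] o' pqk k by auto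
      then have "o' = p" using bq[of o'] o' kr' by auto
      moreover have "l \<noteq> 1" using calculation Q01 k by (auto simp: o'_def)
      ultimately show ?thesis using incr[of Q 1 l] Q Q01 j l cp s by (simp add: c_def o'_def numeral_2_eq_2)
    qed
  qed
  have P2: "Q = ?P2" if Q: "gp h p q k Q" "(k, p) \<in> set (zip Q (tl Q))" "(p, k + 1) \<in> set (zip Q (tl Q))" for Q
  proof -
    have Q01: "Q ! 0 = k" "Q ! 1 = p" using Q(2) first[OF Q(1)] fst_last[OF Q(1)] unfolding pairs_nth by auto
    obtain j where j: "Suc j < length Q" "Q ! j = p" "Q ! Suc j = k + 1" using Q(3) unfolding pairs_nth by blast
    have L: "length Q = Suc (Suc j)" using last[OF Q(1) j(1)] j by simp
    have j1: "1 \<le> j" using Q01 j k by (cases j) auto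
    show ?thesis
    proof (cases "j = 1")
      case True
      then show ?thesis using len[of Q] L Q01 j by (simp add: numeral_2_eq_2)
    next
      case False
      then obtain l where l: "j = Suc l" "1 \<le> l" using j1 by (cases j) auto
      define c o' where "c = Q ! 2" and "o' = Q ! l"
      have "2 < length Q" using L l by simp
      have c: "c \<in> {p..q}" "p \<noteq> c" "h p c < h p k"
        using nth[of Q 2] tnth(1)[of Q 1] tnth(2)[of Q 0] Q01 Q \<open>2 < length Q\<close> k
        by (auto simp: c_def numeral_2_eq_2 turn_def)
      have o': "o' \<in> {p..q}" "p \<noteq> o'" using nth[of Q l] tnth(1)[of Q l] Q j l by (auto simp: o'_def)
      have 1: "\<Phi> p c \<le> \<Phi> o' p" using incr_le[of Q 1 l] Q Q01 j l by (simp add: c_def o'_def numeral_2_eq_2)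
      have 2: "\<Phi> o' p < \<Phi> p (k + 1)" using incr[of Q l j] Q j l by (simp add: o'_def)
      have s: "\<Phi> o' p = \<Phi> p o'" using psym[of o' p] o' pqk by auto
      have "h p (k + 1) < h p c" using 1 2 mp[of c "k + 1"] c pqk k by auto
      then have cp: "c = q" using bp[of c] c by auto
      have "\<not> h p q < h p o'" "h p (k + 1) < h p o'" using 1 2 s cp mp[of o' q] mp[of o' "k + 1"] o' pqk k by auto
      then have "o' = q" using bp[of o'] o' kr' by auto
      moreover have "l \<noteq> 1" using calculation Q01 k by (auto simp: o'_def)
      ultimately show ?thesis using incr[of Q 1 l] Q Q01 j l cp s by (simp add: c_def o'_def numeral_2_eq_2)
    qed
  qed
  have P3: "Q = ?P3" if Q: "gp h p q k Q" "(k, q) \<in> set (zip Q (tl Q))" "(q, p) \<in> set (zip Q (tl Q))" "(p, k + 1) \<in> set (zip Q (tl Q))" for Q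
  proof -
    have Q01: "Q ! 0 = k" "Q ! 1 = q" using Q(2) first[OF Q(1)] fst_last[OF Q(1)] unfolding pairs_nth by auto
    obtain i where i: "Suc i < length Q" "Q ! i = q" "Q ! Suc i = p" using Q(3) unfolding pairs_nth by blast
    obtain j where j: "Suc j < length Q" "Q ! j = p" "Q ! Suc j = k + 1" using Q(4) unfolding pairs_nth by blast
    have L: "length Q = Suc (Suc j)" using last[OF Q(1) j(1)] j by simp
    have i1: "1 \<le> i" using Q01 i k by (cases i) auto
    define c where "c = Q ! 2"
    have "2 < length Q" using i i1 by simp
    have c: "c \<in> {p..q}" "q \<noteq> c" "h q k < h q c"
      using nth[of Q 2] tnth(1)[of Q 1] tnth(2)[of Q 0] Q01 Q \<open>2 < length Q\<close> k
      by (auto simp: c_def numeral_2_eq_2 turn_def)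
    have "\<Phi> q c \<le> \<Phi> q p" using incr_le[of Q 1 i] Q Q01 i i1 by (simp add: c_def numeral_2_eq_2)
    then have "\<not> h q p < h q c" using mq[of p c] c pqk k by auto
    then have cp: "c = p" using bq[of c] c kl' by auto
    have "j \<noteq> 0" "j \<noteq> 1" using Q01 j k by (auto intro: Nat.gr0I)
    show ?thesis
    proof (cases "j = 2")
      case True
      then show ?thesis using len4[of Q] L Q01 j cp by (simp add: c_def numeral_2_eq_2 numeral_3_eq_3)
    next
      case False
      then obtain l where l: "j = Suc l" "2 \<le> l" using \<open>j \<noteq> 0\<close> \<open>j \<noteq> 1\<close> by (cases j) auto
      define o' where "o' = Q ! l"
      have o': "o' \<in> {p..q}" "p \<noteq> o'" using nth[of Q l] tnth(1)[of Q l] Q j l by (auto simp: o'_def)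
      have 1: "\<Phi> q p < \<Phi> o' p" using incr[of Q 1 l] Q Q01 j l cp by (simp add: c_def o'_def numeral_2_eq_2)
      have 2: "\<Phi> o' p < \<Phi> p (k + 1)" using incr[of Q l j] Q j l by (simp add: o'_def)
      have s: "\<Phi> o' p = \<Phi> p o'" "\<Phi> q p = \<Phi> p q" using psym[of o' p] psym[of p q] o' pqk k by auto
      have "h p o' < h p q" "h p (k + 1) < h p o'" using 1 2 s mp[of q o'] mp[of o' "k + 1"] o' pqk k by auto
      then show ?thesis using bp[of o'] o' kr' by auto
    qed
  qed
  have P4: "Q = ?P4" if Q: "gp h p q k Q" "(k, p) \<in> set (zip Q (tl Q))" "(p, q) \<in> set (zip Q (tl Q))" "(q, k + 1) \<in> set (zip Q (tl Q))" for Q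
  proof -
    have Q01: "Q ! 0 = k" "Q ! 1 = p" using Q(2) first[OF Q(1)] fst_last[OF Q(1)] unfolding pairs_nth by auto
    obtain i where i: "Suc i < length Q" "Q ! i = p" "Q ! Suc i = q" using Q(3) unfolding pairs_nth by blast
    obtain j where j: "Suc j < length Q" "Q ! j = q" "Q ! Suc j = k + 1" using Q(4) unfolding pairs_nth by blast
    have L: "length Q = Suc (Suc j)" using last[OF Q(1) j(1)] j by simp
    have i1: "1 \<le> i" using Q01 i k by (cases i) auto
    define c where "c = Q ! 2"
    have "2 < length Q" using i i1 by simp
    have c: "c \<in> {p..q}" "p \<noteq> c" "h p c < h p k"
      using nth[of Q 2] tnth(1)[of Q 1] tnth(2)[of Q 0] Q01 Q \<open>2 < length Q\<close> k
      by (auto simp: c_def numeral_2_eq_2 turn_def)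
    have "\<Phi> p c \<le> \<Phi> p q" using incr_le[of Q 1 i] Q Q01 i i1 by (simp add: c_def numeral_2_eq_2)
    then have "\<not> h p c < h p q" using mp[of q c] c pqk k by auto
    then have cp: "c = q" using bp[of c] c kl' by auto
    have "j \<noteq> 0" "j \<noteq> 1" using Q01 j k by (auto intro: Nat.gr0I)
    show ?thesis
    proof (cases "j = 2")
      case True
      then show ?thesis using len4[of Q] L Q01 j cp by (simp add: c_def numeral_2_eq_2 numeral_3_eq_3)
    next
      case False
      then obtain l where l: "j = Suc l" "2 \<le> l" using \<open>j \<noteq> 0\<close> \<open>j \<noteq> 1\<close> by (cases j) auto
      define o' where "o' = Q ! l"
      have o': "o' \<in> {p..q}" "q \<noteq> o'" using nth[of Q l] tnth(1)[of Q l] Q j l by (auto simp: o'_def)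
      have 1: "\<Phi> p q < \<Phi> o' q" using incr[of Q 1 l] Q Q01 j l cp by (simp add: c_def o'_def numeral_2_eq_2)
      have 2: "\<Phi> o' q < \<Phi> q (k + 1)" using incr[of Q l j] Q j l by (simp add: o'_def)
      have s: "\<Phi> o' q = \<Phi> q o'" "\<Phi> p q = \<Phi> q p" using psym[of o' q] psym[of p q] o' pqk k by auto
      have "h q p < h q o'" "h q o' < h q (k + 1)" using 1 2 s mq[of p o'] mq[of o' "k + 1"] o' pqk k by auto
      then show ?thesis using bq[of o'] o' kr' by auto
    qed
  qed
  note ext = cone_basis_extreme[OF M pq, folded h_def]
  have "pvec ?P1 \<in> M" by (rule ext[OF gps(1)], rule P1) auto
  moreover have "pvec ?P2 \<in> M" by (rule ext[OF gps(2)], rule P2) auto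
  moreover have "pvec ?P3 \<in> M" by (rule ext[OF gps(3)], rule P3) auto
  moreover have "pvec ?P4 \<in> M" by (rule ext[OF gps(4)], rule P4) auto
  ultimately have inM: "pvec ?P1 \<in> M" "pvec ?P2 \<in> M" "pvec ?P3 \<in> M" "pvec ?P4 \<in> M" by auto
  have eqD: "set (zip P (tl P)) \<subseteq> set (zip Q (tl Q))" if "gp h p q k P" "gp h p q k Q" "pvec P = pvec Q" for P Q
    using inner_pvec_le(2)[of k P k P] inner_pvec_le(2)[of k P k Q] that gpw_of_gp[OF _ pq] unfolding h_def by auto
  have ne: "pvec ?P1 \<noteq> pvec ?P2" "pvec ?P1 \<noteq> pvec ?P3" "pvec ?P1 \<noteq> pvec ?P4"
    using eqD[OF gps(1) gps(2)] eqD[OF gps(1) gps(3)] eqD[OF gps(1) gps(4)] k by auto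
  \<comment> \<open>The switches from p to q and from q to p have opposite coefficients and cancel
    in the sum.\<close>
  have "pvec ?P1 = pvec ?P3 + pvec ?P4 - pvec ?P2"
    using k nd_sym[of w q p] by (simp add: pvec_def sw_coef_def)
  moreover have "pvec ?P3 + pvec ?P4 - pvec ?P2 \<in> span (M - {pvec ?P1})"
    using inM ne by (intro span_add span_diff span_base) auto
  moreover have "independent M" using M by (simp add: cone_basis_def)
  ultimately show False using inM(1) by (auto simp: dependent_def)
qed

text \<open>
  The three chamber types of four wires whose outer triples turn outwards. In each of them a
  difference of two paths of type \<open>p\<close> is a difference of two paths of type \<open>p + 2\<close>.
\<close>

lemma four_wires:
  assumes M: "cone_basis M p (p + 3)" and p: "1 \<le> p" "p + 3 \<le> n + 1"
    and 123: "nd w p (p + 1) < nd w p (p + 2)"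
    and 234: "nd w (p + 2) (p + 3) < nd w (p + 2) (p + 1)"
  shows False
proof -
  define p1 p2 p3 where "p1 = p + 1" and "p2 = p + 2" and "p3 = p + 3"
  note pd = p1_def p2_def p3_def
  have lt: "p < p1" "p < p2" "p < p3" "p1 < p2" "p1 < p3" "p2 < p3" "Suc p = p1" "Suc p2 = p3" by (simp_all add: pd)
  note lt' = lt lt(1-6)[THEN less_imp_le] lt(1-6)[THEN less_not_sym]  lt(1-6)[THEN less_imp_neq]  lt(1-6)[THEN less_imp_neq, symmetric]
  define h where "h = nd w"
  have arr: "arr (n + 1) h" using arr_nd by (simp add: h_def)
  have sym: "h a b = h b a" for a b by (simp add: h_def nd_sym)
  note syms = sym[of "p1" p] sym[of "p2" p] sym[of "p3" p] sym[of "p2" "p1"]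
    sym[of "p3" "p1"] sym[of "p3" "p2"]
  have o123: "h p p1 < h p p2" "h p p2 < h p1 p2"
    using arr_triple[OF arr, of p p1 p2] 123[folded pd] p(1) p(2)[folded pd] syms lt by (auto simp: h_def)
  have o234: "h p2 p3 < h p1 p3" "h p1 p3 < h p1 p2"
    using arr_triple[OF arr, of p1 p2 p3] 234[folded pd] p(1) p(2)[folded pd] syms lt by (auto simp: h_def)
  have d: "p < d \<and> d < p2 \<longleftrightarrow> d = p1" "p < d \<and> d < p3 \<longleftrightarrow> d = p1 \<or> d = p2"
    "p < d \<and> d \<le> p2 \<longleftrightarrow> d = p1 \<or> d = p2" "p1 < d \<and> d \<le> p2 \<longleftrightarrow> d = p2" for d
    unfolding pd by arith+
  have t1: "turn h p x p2 c \<longleftrightarrow> h p2 x < h p2 c \<and>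
        \<not> (h p2 x < h p2 p1 \<and> h p2 p1 < h p2 c)"
    and t2: "turn h p x p3 c \<longleftrightarrow> h p3 x < h p3 c \<and>
        (\<forall>d\<in>{p1, p2}. \<not> (h p3 x < h p3 d \<and> h p3 d < h p3 c))"
    and t3: "turn h p2 x p c \<longleftrightarrow> h p c < h p x \<and>
        (\<forall>d\<in>{p1, p2}. \<not> (h p c < h p d \<and> h p d < h p x))"
    and t4: "turn h p2 x p1 c \<longleftrightarrow> h p1 c < h p1 x \<and>
        \<not> (h p1 c < h p1 p2 \<and> h p1 p2 < h p1 x)" for x c
    unfolding turn_def d using lt' by auto
  note indep = cone_basis_type_independent[OF M p(1) p(2), of p p2, folded h_def p3_def]
  have eqD: "set (zip P (tl P)) \<subseteq> set (zip Q (tl Q))"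
    if "gp h p p3 p P" "gp h p p3 p Q" "pvec P = pvec Q" for P Q
    using inner_pvec_le(2)[of p P p P] inner_pvec_le(2)[of p P p Q] that gpw_of_gp[OF _ p[folded p3_def]] unfolding h_def by auto
  have pe: "pvec bs = val (\<lambda>a b. sw_coef a b *\<^sub>R axis (e (h a b)) 1) bs" for bs
    by (simp add: pvec_def h_def)
  have A: "gp h p p3 p [p, p2, p1]"
    using o123 syms lt' by (simp add: gp_def t1)
  have R: "gp h p p3 p2 [p2, p1, p3]"
    using o234 syms lt' by (simp add: gp_def t4)
  \<comment> \<open>The cases are the place of wire p + 3 on wire p, read downward: after, between
    or before the crossings with p + 1 and p + 2.\<close>
  consider "h p p1 < h p p3" "h p p3 < h p1 p3" "h p p2 < h p p3" "h p p3 < h p2 p3"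
    | "h p p1 < h p p3" "h p p3 < h p1 p3" "h p2 p3 < h p p3" "h p p3 < h p p2"
    | "h p1 p3 < h p p3" "h p p3 < h p p1" "h p2 p3 < h p p3" "h p p3 < h p p2"
    using arr_triple[OF arr, of p p1 p3] arr_triple[OF arr, of p p2 p3] p(1) p(2)[folded pd] syms o123 lt by linarith
  then show False
  proof cases
    case 1
    have B: "gp h p p3 p [p, p2, p3, p1]"
      using o123 o234 1 syms lt' by (simp add: gp_def t1 t2)
    have S: "gp h p p3 p2 [p2, p3]" using lt' by (simp add: gp_def)
    have "pvec [p, p2, p1] + pvec [p2, p3] = pvec [p, p2, p3, p1] + pvec [p2, p1, p3]"
      using syms lt' by (simp add: pe sw_coef_def)
    from indep[OF _ A B S R this] eqD[OF A B] lt' show False by simp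
  next
    case 2
    have B: "gp h p p3 p [p, p3, p1]"
      using o123 o234 2 syms lt' by (simp add: gp_def t2)
    have S: "gp h p p3 p2 [p2, p, p3]"
      using o123 o234 2 syms lt' by (simp add: gp_def t3)
    have "pvec [p, p2, p1] + pvec [p2, p, p3] = pvec [p, p3, p1] + pvec [p2, p1, p3]"
      using syms lt' by (simp add: pe sw_coef_def)
    from indep[OF _ A B S R this] eqD[OF A B] lt' show False by simp
  next
    case 3
    have B: "gp h p p3 p [p, p1]" using lt' by (simp add: gp_def)
    have S: "gp h p p3 p2 [p2, p, p1, p3]"
      using o123 o234 3 syms lt' by (simp add: gp_def t3 t4)
    have "pvec [p, p2, p1] + pvec [p2, p, p1, p3] = pvec [p, p1] + pvec [p2, p1, p3]"
      using syms lt' by (simp add: pe sw_coef_def)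
    from indep[OF _ A B S R this] eqD[OF A B] lt' show False by simp
  qed
qed

text \<open>There are four combinations on the two subintervals. Equal kinds contradict the order
  axiom; \<open>ZA\<close> on the left with \<open>ZD\<close> on the right is settled by
  \<open>crossing_exchange\<close>; for \<open>ZD\<close> on the left with \<open>ZA\<close> on the
  right, the two conditions collide on a common triple once q > p + 3, and \<open>four_wires\<close>
  covers q = p + 3.\<close>

lemma ZD_or_ZA:
  "cone_basis M p q \<Longrightarrow> 1 \<le> p \<Longrightarrow> q \<le> n + 1 \<Longrightarrow> ZD (nd w) p q \<or> ZA (nd w) p q"
proof (induction "q - p" arbitrary: M p q rule: less_induct)
  case less
  define h where "h = nd w"
  have arr: "arr (n + 1) h" using arr_nd by (simp add: h_def)
  note tri = arr_triple[OF arr]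
  have "h a b = h b a" for a b by (simp add: h_def nd_sym)
  have ZDD: "h a b < h a r" if "ZD h s r" "s \<le> a" "a < b" "b < r" for s r a b
    using that unfolding ZD_def by blast
  have ZAD: "h b c < h b s" if "ZA h s r" "s < b" "b < c" "c \<le> r" for s r b c
    using that unfolding ZA_def by blast
  consider "q \<le> p + 1" | "q = p + 2" | "p + 3 \<le> q" by linarith
  then have "ZD h p q \<or> ZA h p q"
  proof cases
    case 1
    then have "ZD h p q" by (auto simp: ZD_def)
    then show ?thesis by blast
  next
    case 2
    have D: "a = p \<and> b = p + 1" if "p \<le> a" "a < b" "b < q" for a b using that 2 by linarith
    have A: "b = p + 1 \<and> c = q" if "p < b" "b < c" "c \<le> q" for b c using that 2 by linarith
    consider "h p (p + 1) < h p q" | "h (p + 1) q < h (p + 1) p"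
      using tri[of p "p + 1" q] less.prems 2 by auto
    then show ?thesis
    proof cases
      case 1
      then have "ZD h p q" unfolding ZD_def using D by blast
      then show ?thesis by blast
    next
      case 2
      then have "ZA h p q" unfolding ZA_def using A by blast
      then show ?thesis by blast
    qed
  next
    case 3
    obtain M1 where M1: "cone_basis M1 p (q - 1)" using cone_basis_drop_last less.prems by blast
    obtain M2 where M2: "cone_basis M2 (p + 1) q" using cone_basis_drop_first less.prems by blast
    have Z1: "ZD h p (q - 1) \<or> ZA h p (q - 1)"
      unfolding h_def by (rule less.hyps[OF _ M1]) (use less.prems 3 in auto)
    have Z2: "ZD h (p + 1) q \<or> ZA h (p + 1) q"
      unfolding h_def by (rule less.hyps[OF _ M2]) (use less.prems 3 in auto)
    show ?thesis
    proof (rule ccontr)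
      assume "\<not> (ZD h p q \<or> ZA h p q)"
      then have nD: "\<not> ZD h p q" and nA: "\<not> ZA h p q" by auto
      \<comment> \<open>As \<open>ZA\<close> holds on p..q-1, a failure on p..q must involve the
        wire q.\<close>
      have bA: "\<exists>b. p < b \<and> b < q \<and> h p b < h p q \<and> h p q < h b q" if Z: "ZA h p (q - 1)"
      proof -
        obtain b c where bc: "p < b" "b < c" "c \<le> q" "\<not> h b c < h b p" using nA unfolding ZA_def by blast
        have "\<not> c \<le> q - 1" using ZAD[OF Z, of b c] bc by blast
        then have "c = q" using bc(3) by linarith
        then show ?thesis using bc tri[of p b q] less.prems \<open>\<And>a b. h a b = h b a\<close> by (intro exI[of _ b]) fastforce
      qed
      have bD: "\<exists>b. p < b \<and> b < q \<and> h p q < h p b \<and> h b q < h p q" if Z: "ZD h (p + 1) q"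
      proof -
        obtain a b where ab: "p \<le> a" "a < b" "b < q" "\<not> h a b < h a q" using nD unfolding ZD_def by blast
        have "a = p" using ZDD[OF Z, of a b] ab by (cases "a = p") auto
        then show ?thesis using ab tri[of p b q] less.prems \<open>\<And>a b. h a b = h b a\<close> by (intro exI[of _ b]) fastforce
      qed
      note sy = \<open>\<And>a b. h a b = h b a\<close>
      show False
      proof (cases "ZA h p (q - 1)")
        case A1: True
        obtain b where b: "p < b" "b < q" "h p b < h p q" "h p q < h b q" using bA[OF A1] by blast
        show False
        proof (cases "ZD h (p + 1) q")
          case D2: True
          obtain b' where b': "p < b'" "b' < q" "h p q < h p b'" using bD[OF D2] by blast
          have "\<not> b < b'"
          proof
            assume bb: "b < b'"
            have "h b b' < h b p" using ZAD[OF A1, of b b'] b b' bb by auto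
            then have "h p b' < h p b" using tri[of p b b'] b b' bb less.prems by auto
            then show False using b b' by auto
          qed
          moreover have "b \<noteq> b'" using b b' by auto
          ultimately have "b' < b" by simp
          \<comment> \<open>The crossing of p with \<open>b'\<close> lies below that with q, the
            crossing with b above it. So from \<open>b'\<close> to b there are consecutive wires k
            and k + 1 at which the side changes, as \<open>crossing_exchange\<close>
            requires.\<close>
          define P where "P i \<longleftrightarrow> b' \<le> i \<and> i < b \<and> h p q < h p i" for i
          have "P b'" using b' \<open>b' < b\<close> by (simp add: P_def)
          moreover have "\<forall>i. P i \<longrightarrow> i \<le> b" by (simp add: P_def)
          ultimately obtain k where k: "P k" "\<And>i. P i \<Longrightarrow> i \<le> k"
            by (metis Nat.ex_has_greatest_nat)
          have "\<not> h p q < h p (k + 1)" using k(1) k(2)[of "k + 1"] b by (cases "k + 1 = b") (auto simp: P_def)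
          moreover have "h p q \<noteq> h p (k + 1)"
            by (rule arr_neq[OF arr]) (use k(1) b b' less.prems in \<open>auto simp: P_def\<close>)
          ultimately have "h p (k + 1) < h p q" by simp
          then show False
            using crossing_exchange[OF less.prems, of k] A1 D2 k(1) b b' unfolding h_def P_def by auto
        next
          case False
          then have A2: "ZA h (p + 1) q" using Z2 by blast
          show False
          proof (cases "b = p + 1")
            case False
            \<comment> \<open>The heights along wire b would form a cycle: the crossing with q above
              that with p + 1, this above the one with p, and this above the one with q.\<close>
            have "h b q < h b (p + 1)" using ZAD[OF A2, of b q] b False by auto
            moreover have "h (p + 1) b < h (p + 1) p" using ZAD[OF A1, of "p + 1" b] b False by auto
            ultimately show False
              using tri[of p "p + 1" b] tri[of "p + 1" b q] b False less.prems sy[of b q] sy[of b p] sy[of b "p + 1"] sy[of "p + 1" p] by auto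
          next
            case True
            have "h (p + 1) (p + 2) < h (p + 1) p" using ZAD[OF A1, of "p + 1" "p + 2"] 3 by auto
            moreover have "h (p + 2) q < h (p + 2) (p + 1)" using ZAD[OF A2, of "p + 2" q] 3 by auto
            ultimately show False
              using tri[of p "p + 1" "p + 2"] tri[of "p + 1" "p + 2" q] b True 3 less.prems
                sy[of "p + 1" q] sy[of "p + 1" p] sy[of "p + 2" "p + 1"] by auto
          qed
        qed
      next
        case False
        then have D1: "ZD h p (q - 1)" using Z1 by blast
        show False
        proof (cases "ZD h (p + 1) q")
          case D2: True
          obtain b where b: "p < b" "b < q" "h p q < h p b" "h b q < h p q" using bD[OF D2] by blast
          show False
          proof (cases "b = q - 1")
            case False
            have "b < q - 1" "q - 1 \<le> n + 1" using b False less.prems by linarith+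
            moreover have "h b (q - 1) < h b q" using ZDD[OF D2, of b "q - 1"] b False by auto
            moreover have "h p b < h p (q - 1)" using ZDD[OF D1, of p b] b False by auto
            ultimately show False
              using tri[of b "q - 1" q] tri[of p b "q - 1"] b False less.prems sy[of b "q - 1"] sy[of "q - 1" p] by auto
          next
            case True
            have "p + 1 < q - 1" "q - 1 \<le> n + 1" using 3 less.prems by linarith+
            moreover have "h p (p + 1) < h p (q - 1)" using ZDD[OF D1, of p "p + 1"] 3 by auto
            moreover have "h (p + 1) (q - 1) < h (p + 1) q" using ZDD[OF D2, of "p + 1" "q - 1"] 3 by auto
            ultimately show False
              using tri[of p "p + 1" "q - 1"] tri[of "p + 1" "q - 1" q] b True 3 less.prems
                sy[of "q - 1" p] sy[of "q - 1" "p + 1"] by auto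
          qed
        next
          case False
          then have A2: "ZA h (p + 1) q" using Z2 by blast
          show False
          proof (cases "q = p + 3")
            case True
            have "h p (p + 1) < h p (p + 2)" using ZDD[OF D1, of p "p + 1"] True by auto
            moreover have "h (p + 2) (p + 3) < h (p + 2) (p + 1)" using ZAD[OF A2, of "p + 2" "p + 3"] True by auto
            ultimately show False using four_wires[of M p] less.prems True unfolding h_def by auto
          next
            case False
            \<comment> \<open>The triple p + 1, p + 2, q - 1 lies in both subintervals;
              \<open>ZD\<close> orders it lexicographically, \<open>ZA\<close> in reverse.\<close>
            have "p + 2 < q - 1" "q - 1 \<le> n + 1" using 3 False less.prems by linarith+
            moreover have "h (p + 1) (p + 2) < h (p + 1) (q - 1)" using ZDD[OF D1, of "p + 1" "p + 2"] 3 False by auto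
            moreover have "h (p + 2) (q - 1) < h (p + 2) (p + 1)" using ZAD[OF A2, of "p + 2" "q - 1"] 3 False by auto
            ultimately show False using tri[of "p + 1" "p + 2" "q - 1"] 3 False less.prems by auto
          qed
        qed
      qed
    qed
  qed
  then show ?case by (simp add: h_def)
qed

theorem simplicial_imp_ZD_or_ZA:
  assumes "num_facets (string_cone n w e) = N" "1 \<le> p" "p \<le> q" "q \<le> n + 1"
  shows "ZD (nd w) p q \<or> ZA (nd w) p q"
proof -
  obtain M where "cone_basis M 1 (n + 1)" using cone_basis_of_simplicial assms by blast
  moreover have "d \<le> n + 1 - 1 \<Longrightarrow> cone_basis M 1 (n + 1) \<Longrightarrow> \<exists>M'. cone_basis M' 1 (n + 1 - d)" for d M
  proof (induction d)
    case (Suc d)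
    then obtain M' where "cone_basis M' 1 (n + 1 - d)" by auto
    from cone_basis_drop_last[OF this] show ?case by auto
  qed auto
  from this[of "n + 1 - q"] calculation have "\<exists>M'. cone_basis M' 1 (n + 1 - (n + 1 - q))" using assms by auto
  moreover have "n + 1 - (n + 1 - q) = q" using assms by simp
  ultimately obtain M1 where M1: "cone_basis M1 1 q" by auto
  have "d + 1 \<le> q \<Longrightarrow> \<exists>M'. cone_basis M' (d + 1) q" for d
  proof (induction d)
    case 0
    then show ?case using M1 by auto
  next
    case (Suc d)
    then obtain M' where "cone_basis M' (d + 1) q" by auto
    from cone_basis_drop_first[OF this] show ?case using assms by auto
  qed
  from this[of "p - 1"] assms obtain M2 where "cone_basis M2 p q" by auto
  then show ?thesis using ZD_or_ZA assms by blast
qed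

end

section \<open>Commutation classes, indices and contractions\<close>

lemma comm_eq_append: "comm_eq u v \<Longrightarrow> comm_eq (xs @ u @ ys) (xs @ v @ ys)"
  unfolding comm_eq_def
proof (induction rule: rtranclp_induct)
  case (step v v')
  obtain zs us a b where "v = zs @ [a, b] @ us" "v' = zs @ [b, a] @ us" "b + 1 < a \<or> a + 1 < b"
    using step(2) unfolding two_move_def by blast
  then have "two_move (xs @ v @ ys) (xs @ v' @ ys)"
    unfolding two_move_def by (intro exI[of _ "xs @ zs"] exI[of _ "us @ ys"] exI[of _ a] exI[of _ b]) simp
  then show ?case using step by (meson rtranclp.rtrancl_into_rtrancl)
qed simp

lemma comm_eq_Cons: "comm_eq u v \<Longrightarrow> comm_eq (a # u) (a # v)"
  using comm_eq_append[of u v "[a]" "[]"] by simp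

lemma comm_eq_trans: "comm_eq u v \<Longrightarrow> comm_eq v x \<Longrightarrow> comm_eq u x"
  unfolding comm_eq_def by (rule rtranclp_trans)

lemma comm_eq_refl [simp]: "comm_eq u u"
  by (simp add: comm_eq_def)

lemma comm_eq_swap: "a + 1 < b \<or> b + 1 < a \<Longrightarrow> comm_eq (a # b # v) (b # a # v)"
  unfolding comm_eq_def two_move_def
  by (rule r_into_rtranclp) (metis append_Cons append_Nil)

lemma comm_eq_move: "\<forall>i\<in>set u. a + 1 < i \<or> i + 1 < a \<Longrightarrow> comm_eq (a # u @ v) (u @ a # v)"
proof (induction u)
  case (Cons i u)
  have "comm_eq (a # i # u @ v) (i # a # u @ v)" by (rule comm_eq_swap) (use Cons in auto)
  moreover have "comm_eq (i # a # u @ v) (i # u @ a # v)" by (rule comm_eq_Cons) (use Cons in auto)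
  ultimately show ?case using comm_eq_trans by auto
qed simp

section \<open>Collecting the letters that move one wire\<close>

fun moves_left :: "nat \<Rightarrow> nat list \<Rightarrow> bool" where
  "moves_left p [] \<longleftrightarrow> True"
| "moves_left p (a # w) \<longleftrightarrow> a \<noteq> p \<and> moves_left (sw a p) w"

fun moves_right :: "nat \<Rightarrow> nat list \<Rightarrow> bool" where
  "moves_right p [] \<longleftrightarrow> True"
| "moves_right p (a # w) \<longleftrightarrow> a + 1 \<noteq> p \<and> moves_right (sw a p) w"

text \<open>A letter left of the wire goes in front of the block, a letter right of it goes behind,
  and a letter that moves the wire joins the block. The bound on \<open>u\<close> is what lets the
  latter two commute past the letters already in front.\<close>

lemma collect_left:
  "moves_left p w \<Longrightarrow> fold sw w p \<le> p \<and>
     (\<exists>u v. comm_eq w (u @ rev [fold sw w p..<p] @ v) \<and> (\<forall>i\<in>set u. i + 1 < p))"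
proof (induction w arbitrary: p)
  case Nil
  then show ?case by (intro conjI exI[of _ "[]"]) auto
next
  case (Cons a w)
  define q where "q = fold sw w (sw a p)"
  obtain u v where uv: "q \<le> sw a p" "comm_eq w (u @ rev [q..<sw a p] @ v)" "\<forall>i\<in>set u. i + 1 < sw a p"
    using Cons unfolding q_def by fastforce
  have c: "comm_eq (a # w) (a # u @ rev [q..<sw a p] @ v)" using uv by (intro comm_eq_Cons)
  consider "a + 1 = p" | "a + 1 < p" | "p < a" using Cons.prems by fastforce
  then have "q \<le> p \<and> (\<exists>u v. comm_eq (a # w) (u @ rev [q..<p] @ v) \<and> (\<forall>i\<in>set u. i + 1 < p))"
  proof cases
    case 1
    then have s: "sw a p = a" by (auto simp: sw_def)
    then have "rev [q..<p] = a # rev [q..<a]" using uv 1 by auto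
    moreover have "comm_eq (a # u @ rev [q..<a] @ v) (u @ a # rev [q..<a] @ v)"
      by (rule comm_eq_move) (use uv s in auto)
    ultimately show ?thesis using c uv s 1
      by (intro conjI exI[of _ u] exI[of _ v]) (auto intro: comm_eq_trans)
  next
    case 2
    then have s: "sw a p = p" by (auto simp: sw_def)
    then show ?thesis using c uv 2 by (intro conjI exI[of _ "a # u"] exI[of _ v]) auto
  next
    case 3
    then have s: "sw a p = p" by (auto simp: sw_def)
    have "comm_eq (a # (u @ rev [q..<p]) @ v) ((u @ rev [q..<p]) @ a # v)"
      by (rule comm_eq_move) (use uv s 3 in auto)
    then show ?thesis using c uv s by (intro conjI exI[of _ u] exI[of _ "a # v"]) (auto intro: comm_eq_trans)
  qed
  then show ?case by (simp add: q_def)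
qed

lemma collect_right:
  "moves_right p w \<Longrightarrow> p \<le> fold sw w p \<and>
     (\<exists>u v. comm_eq w (u @ [p..<fold sw w p] @ v) \<and> (\<forall>i\<in>set u. p < i))"
proof (induction w arbitrary: p)
  case Nil
  then show ?case by (intro conjI exI[of _ "[]"]) auto
next
  case (Cons a w)
  define q where "q = fold sw w (sw a p)"
  obtain u v where uv: "sw a p \<le> q" "comm_eq w (u @ [sw a p..<q] @ v)" "\<forall>i\<in>set u. sw a p < i"
    using Cons unfolding q_def by fastforce
  have c: "comm_eq (a # w) (a # u @ [sw a p..<q] @ v)" using uv by (intro comm_eq_Cons)
  consider "a = p" | "p < a" | "a + 1 < p" using Cons.prems by fastforce
  then have "p \<le> q \<and> (\<exists>u v. comm_eq (a # w) (u @ [p..<q] @ v) \<and> (\<forall>i\<in>set u. p < i))"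
  proof cases
    case 1
    then have s: "sw a p = p + 1" by (auto simp: sw_def)
    then have "[p..<q] = a # [p+1..<q]" using uv 1 by (simp add: upt_conv_Cons)
    moreover have "comm_eq (a # u @ [p+1..<q] @ v) (u @ a # [p+1..<q] @ v)"
      by (rule comm_eq_move) (use uv s 1 in auto)
    ultimately show ?thesis using c uv s 1
      by (intro conjI exI[of _ u] exI[of _ v]) (auto intro: comm_eq_trans)
  next
    case 2
    then have s: "sw a p = p" by (auto simp: sw_def)
    then show ?thesis using c uv 2 by (intro conjI exI[of _ "a # u"] exI[of _ v]) auto
  next
    case 3
    then have s: "sw a p = p" by (auto simp: sw_def)
    have "comm_eq (a # (u @ [p..<q]) @ v) ((u @ [p..<q]) @ a # v)"
      by (rule comm_eq_move) (use uv s 3 in auto)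
    then show ?thesis using c uv s by (intro conjI exI[of _ u] exI[of _ "a # v"]) (auto intro: comm_eq_trans)
  qed
  then show ?case by (simp add: q_def)
qed

lemma wp_fold: "j \<le> length w \<Longrightarrow> wp w j c = fold sw (take j w) c"
  by (induction j) (auto simp: take_Suc_conv_app_nth)

context rword
begin

text \<open>Wire n + 1 is the larger and hence the right one at each of its crossings; so it only
  moves left, from position n + 1 to position 1, and its letters are n, ..., 1 in this
  order.\<close>

lemma Dword_decomposition: "1 \<le> n \<Longrightarrow> \<exists>u v. comm_eq w (u @ Dword n @ v)"
proof -
  assume n: "1 \<le> n"
  have "d \<le> length w \<Longrightarrow> moves_left (wp w (length w - d) (n + 1)) (drop (length w - d) w)" for d
  proof (induction d)
    case (Suc d)
    define j where "j = length w - Suc d"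
    have j: "j < length w" "length w - d = Suc j" using Suc.prems by (auto simp: j_def)
    have "lw w j \<noteq> n + 1" using lw_less_rw[OF j(1)] lw_rw_range(2)[OF j(1)] by auto
    then have "w ! j \<noteq> wp w j (n + 1)" by (metis lw_def wpos_wp)
    then show ?case using Suc j by (auto simp: j_def[symmetric] Cons_nth_drop_Suc[symmetric])
  qed simp
  from this[of "length w"] have "moves_left (n + 1) w" by simp
  then have "\<exists>u v. comm_eq w (u @ rev [fold sw w (n + 1)..<n + 1] @ v)" using collect_left by blast
  moreover have "fold sw w (n + 1) = wp w (length w) (n + 1)" using wp_fold[of "length w" w "n + 1"] by simp
  moreover have "wp w (length w) (n + 1) = 1" using wp_end[of "n + 1"] by simp
  ultimately show ?thesis unfolding Dword_def by metis
qed

lemma Aword_decomposition: "1 \<le> n \<Longrightarrow> \<exists>u v. comm_eq w (u @ Aword n @ v)"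
proof -
  assume n: "1 \<le> n"
  have "d \<le> length w \<Longrightarrow> moves_right (wp w (length w - d) 1) (drop (length w - d) w)" for d
  proof (induction d)
    case (Suc d)
    define j where "j = length w - Suc d"
    have j: "j < length w" "length w - d = Suc j" using Suc.prems by (auto simp: j_def)
    have "rw w j \<noteq> 1" using lw_less_rw[OF j(1)] lw_rw_range(1)[OF j(1)] by auto
    then have "w ! j + 1 \<noteq> wp w j 1" by (metis rw_def wpos_wp)
    then show ?case using Suc j by (auto simp: j_def[symmetric] Cons_nth_drop_Suc[symmetric])
  qed simp
  from this[of "length w"] have "moves_right 1 w" by simp
  then have "\<exists>u v. comm_eq w (u @ [1..<fold sw w 1] @ v)" using collect_right by blast
  moreover have "fold sw w 1 = wp w (length w) 1" using wp_fold[of "length w" w 1] by simp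
  moreover have "wp w (length w) 1 = n + 1" using wp_end[of 1] by simp
  ultimately show ?thesis unfolding Aword_def by metis
qed

end

subsection \<open>Invariance under 2-moves\<close>

definition lam_cone :: "nat list \<Rightarrow> (nat \<Rightarrow> real) \<Rightarrow> (nat \<Rightarrow> real) \<Rightarrow> bool" where
  "lam_cone w lam y \<longleftrightarrow>
     (\<forall>j<length w. y j \<le> lam (w ! j) + (\<Sum>k\<in>{j<..<length w}. lam_coef w j k * y k))"

text \<open>What a 2-move keeps, up to the renumbering \<pi> of the nodes: which wires cross at a
  node, the order along each wire, and the lambda-inequalities. The order of nodes without a common
  wire may change.\<close>

definition same_diagram :: "nat \<Rightarrow> (nat \<Rightarrow> nat) \<Rightarrow> nat list \<Rightarrow> nat list \<Rightarrow> bool" where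
  "same_diagram n \<pi> u v \<longleftrightarrow> u \<in> red_w0 n \<and> v \<in> red_w0 n \<and>
     bij_betw \<pi> {..<length u} {..<length u} \<and>
     (\<forall>b\<in>{1..n+1}. \<forall>c\<in>{1..n+1}-{b}. nd v b c = \<pi> (nd u b c)) \<and>
     (\<forall>b\<in>{1..n+1}. \<forall>c\<in>{1..n+1}-{b}. \<forall>d\<in>{1..n+1}-{b}. nd u b c < nd u b d \<longleftrightarrow> nd v b c < nd v b d) \<and>
     (\<forall>lam y. lam_cone v lam y \<longleftrightarrow> lam_cone u lam (y \<circ> \<pi>))"

lemma same_diagram_refl: "u \<in> red_w0 n \<Longrightarrow> same_diagram n id u u"
  by (auto simp: same_diagram_def)

lemma same_diagram_trans:
  assumes "same_diagram n \<pi> u v" "same_diagram n \<rho> v x"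
  shows "same_diagram n (\<rho> \<circ> \<pi>) u x"
proof -
  have "length v = length u" using assms by (auto simp: same_diagram_def red_w0_def)
  then have "bij_betw (\<rho> \<circ> \<pi>) {..<length u} {..<length u}"
    using assms unfolding same_diagram_def by (metis bij_betw_trans)
  moreover have "lam_cone x lam y \<longleftrightarrow> lam_cone u lam (y \<circ> (\<rho> \<circ> \<pi>))" for lam y
    using assms unfolding same_diagram_def by (simp add: comp_assoc)
  ultimately show ?thesis using assms unfolding same_diagram_def by auto
qed

lemma sw_commute: "a + 1 < b \<or> b + 1 < a \<Longrightarrow> sw a \<circ> sw b = sw b \<circ> sw a"
  by (rule ext) (auto simp: sw_def)

lemma two_move_red:
  assumes "two_move u v" "u \<in> red_w0 n"
  shows "v \<in> red_w0 n"
proof -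
  obtain xs ys a b where uv: "u = xs @ [a, b] @ ys" "v = xs @ [b, a] @ ys" "b + 1 < a \<or> a + 1 < b"
    using assms(1) unfolding two_move_def by blast
  have "word_perm [a, b] = word_perm [b, a]"
    using sw_commute[of a b] uv(3) by (auto simp: word_perm_def)
  then have "word_perm u = word_perm v" unfolding uv word_perm_append by simp
  then show ?thesis using assms(2) uv by (auto simp: red_w0_def)
qed

text \<open>The two nodes that change places have no common wire, and their letters are not
  neighbours, so neither coordinate enters the lambda-inequality of the other.\<close>

lemma two_move_same_diagram:
  assumes "two_move u v" "u \<in> red_w0 n"
  shows "\<exists>\<pi>. same_diagram n \<pi> u v"
proof -
  obtain xs ys a b where uv: "u = xs @ [a, b] @ ys" "v = xs @ [b, a] @ ys" "b + 1 < a \<or> a + 1 < b"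
    using assms(1) unfolding two_move_def by blast
  have v: "v \<in> red_w0 n" using two_move_red[OF assms] .
  interpret u: rword n u by unfold_locales (rule assms(2))
  interpret v: rword n v by unfold_locales (rule v)
  define i where "i = length xs"
  define \<tau> where "\<tau> j = (if j = i then i + 1 else if j = i + 1 then i else j)" for j
  have len: "length v = length u" "i + 1 < length u" by (simp_all add: uv i_def)
  have \<tau>\<tau>: "\<tau> (\<tau> j) = j" for j by (auto simp: \<tau>_def)
  have \<tau>l: "\<tau> j < length u" if "j < length u" for j using that len by (auto simp: \<tau>_def)
  have bij: "bij_betw \<tau> {..<length u} {..<length u}"
    by (rule bij_betw_byWitness[of _ \<tau>]) (use \<tau>\<tau> \<tau>l in auto)
  have nthu: "u ! i = a" "u ! (i + 1) = b" and nthv: "v ! i = b" "v ! (i + 1) = a"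
    by (simp_all add: uv i_def nth_append)
  have nth: "v ! j = u ! j" if "j \<noteq> i" "j \<noteq> i + 1" for j
    using that by (auto simp: uv i_def nth_append nth_Cons split: nat.split)
  have vnth: "v ! j = u ! \<tau> j" for j using nth nthu nthv by (auto simp: \<tau>_def)
  have w1: "wpos v j = wpos u j" if "j \<le> i" for j
    using that by (simp add: uv wpos_append i_def)
  have w2: "wpos v (i + 2 + d) = wpos u (i + 2 + d)" for d
  proof (induction d)
    case 0
    have 1: "wpos v (i + 2) = wpos u i \<circ> (sw b \<circ> sw a)" "wpos u (i + 2) = wpos u i \<circ> (sw a \<circ> sw b)"
      using nthu nthv w1[of i] by (simp_all add: comp_assoc)
    have "sw b \<circ> sw a = sw a \<circ> sw b" using sw_commute[of a b] uv(3) by metis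
    then show ?case by (simp only: 1 Nat.add_0_right)
  next
    case (Suc d)
    have "v ! (i + 2 + d) = u ! (i + 2 + d)" by (rule nth) auto
    then show ?case by (simp only: add_Suc_right wpos.simps Suc)
  qed
  have w2': "wpos v j = wpos u j" if "i + 2 \<le> j" for j
  proof -
    obtain d where "j = i + 2 + d" using le_Suc_ex[OF \<open>i + 2 \<le> j\<close>] by blast
    then show ?thesis using w2[of d] by (simp only:)
  qed
  have lr: "lw v (\<tau> j) = lw u j \<and> rw v (\<tau> j) = rw u j" for j
  proof -
    consider "j < i" | "j = i" | "j = i + 1" | "i + 2 \<le> j" by linarith
    then show ?thesis
    proof cases
      case 1
      then show ?thesis using w1[of j] nth[of j] by (simp add: lw_def rw_def \<tau>_def)
    next
      case 2
      then show ?thesis using w1[of i] nthu nthv uv(3) by (auto simp: lw_def rw_def \<tau>_def sw_def)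
    next
      case 3
      then show ?thesis using w1[of i] nthu nthv uv(3) by (auto simp: lw_def rw_def \<tau>_def sw_def)
    next
      case 4
      then show ?thesis using w2'[of j] nth[of j] by (simp add: lw_def rw_def \<tau>_def)
    qed
  qed
  have nd: "nd v b c = \<tau> (nd u b c)" if "b \<in> {1..n+1}" "c \<in> {1..n+1}" "b \<noteq> c" for b c
  proof -
    have "nd v (lw u j) (rw u j) = \<tau> j" if "j < length u" for j
      using v.nd_lw_rw[of "\<tau> j"] lr[of j] \<tau>l[OF that] len by simp
    then show ?thesis
      using u.nd_less'[OF that] u.nd_wires[OF that] nd_sym[of v b c] by (metis doubleton_eq_iff)
  qed
  have disj: "{lw u i, rw u i} \<inter> {lw u (i + 1), rw u (i + 1)} = {}"
  proof -
    have "inj (wpos u i)" by (metis injI wp_wpos)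
    then show ?thesis using nthu uv(3) by (auto simp: lw_def rw_def sw_def inj_eq)
  qed
  have ord: "nd u b c < nd u b d \<longleftrightarrow> nd v b c < nd v b d"
    if "b \<in> {1..n+1}" "c \<in> {1..n+1}-{b}" "d \<in> {1..n+1}-{b}" for b c d
  proof -
    have "b \<in> {lw u (nd u b c), rw u (nd u b c)}" "b \<in> {lw u (nd u b d), rw u (nd u b d)}"
      using u.nd_wires[of b c] u.nd_wires[of b d] that by auto
    then have "\<not> (nd u b c = i \<and> nd u b d = i + 1)" "\<not> (nd u b c = i + 1 \<and> nd u b d = i)"
      using disj by auto
    then show ?thesis using nd[of b c] nd[of b d] that by (auto simp: \<tau>_def)
  qed
  have lc: "lam_coef v (\<tau> j) (\<tau> k) = lam_coef u j k" for j k
    by (simp add: lam_coef_def vnth \<tau>\<tau>)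
  have lc0: "lam_coef u i (i + 1) = 0" "lam_coef u (i + 1) i = 0"
    using nthu uv(3) by (auto simp: lam_coef_def)
  have sum: "(\<Sum>k\<in>{\<tau> j<..<length u}. lam_coef v (\<tau> j) k * y k) =
      (\<Sum>k\<in>{j<..<length u}. lam_coef u j k * y (\<tau> k))" for j and y :: "nat \<Rightarrow> real"
  proof -
    have s: "(\<Sum>k\<in>{j<..<length u}. f k) = (\<Sum>k<length u. if j < k then f k else 0)" for j and f :: "nat \<Rightarrow> real"
      by (rule sum.mono_neutral_cong_left) auto
    have "(\<Sum>k<length u. if \<tau> j < k then lam_coef v (\<tau> j) k * y k else 0) =
        (\<Sum>k<length u. if \<tau> j < \<tau> k then lam_coef v (\<tau> j) (\<tau> k) * y (\<tau> k) else 0)"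
      by (rule sum.reindex_bij_betw[OF bij, symmetric])
    also have "\<dots> = (\<Sum>k<length u. if j < k then lam_coef u j k * y (\<tau> k) else 0)"
    proof (rule sum.cong)
      fix k
      have "\<tau> j < \<tau> k \<longleftrightarrow> j < k" if "\<not> (j = i \<and> k = i + 1)" "\<not> (j = i + 1 \<and> k = i)"
        using that by (auto simp: \<tau>_def)
      then show "(if \<tau> j < \<tau> k then lam_coef v (\<tau> j) (\<tau> k) * y (\<tau> k) else 0) =
          (if j < k then lam_coef u j k * y (\<tau> k) else 0)"
        using lc lc0 by (cases "j = i \<and> k = i + 1"; cases "j = i + 1 \<and> k = i") auto
    qed simp
    finally show ?thesis unfolding s .
  qed
  have "lam_cone v lam y \<longleftrightarrow> lam_cone u lam (y \<circ> \<tau>)" for lam y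
  proof -
    have "lam_cone v lam y \<longleftrightarrow> (\<forall>j<length u. y (\<tau> j) \<le> lam (v ! \<tau> j) + (\<Sum>k\<in>{\<tau> j<..<length u}. lam_coef v (\<tau> j) k * y k))"
      unfolding lam_cone_def len using \<tau>\<tau> \<tau>l by metis
    then show ?thesis by (simp add: lam_cone_def sum vnth \<tau>\<tau>)
  qed
  then have "same_diagram n \<tau> u v"
    unfolding same_diagram_def using assms(2) v bij nd ord by (intro conjI ballI allI) (blast | simp)+
  then show ?thesis by blast
qed

lemma comm_eq_same_diagram:
  assumes "comm_eq u v" "u \<in> red_w0 n"
  shows "\<exists>\<pi>. same_diagram n \<pi> u v"
  using assms unfolding comm_eq_def
proof (induction rule: rtranclp_induct)
  case base
  then show ?case using same_diagram_refl by blast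
next
  case (step v x)
  then obtain \<pi> where "same_diagram n \<pi> u v" by blast
  moreover from this have "v \<in> red_w0 n" by (simp add: same_diagram_def)
  then obtain \<rho> where "same_diagram n \<rho> v x" using two_move_same_diagram[OF step(2)] by blast
  ultimately show ?case using same_diagram_trans by blast
qed

lemma same_diagram_ZD: "same_diagram n \<pi> u v \<Longrightarrow> 1 \<le> p \<Longrightarrow> q \<le> n + 1 \<Longrightarrow> ZD (nd v) p q \<longleftrightarrow> ZD (nd u) p q"
  and same_diagram_ZA: "same_diagram n \<pi> u v \<Longrightarrow> 1 \<le> p \<Longrightarrow> q \<le> n + 1 \<Longrightarrow> ZA (nd v) p q \<longleftrightarrow> ZA (nd u) p q"
proof -
  assume s: "same_diagram n \<pi> u v" and pq: "1 \<le> p" "q \<le> n + 1"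
  have o: "nd u b c < nd u b d \<longleftrightarrow> nd v b c < nd v b d"
    if "b \<in> {1..n+1}" "c \<in> {1..n+1}-{b}" "d \<in> {1..n+1}-{b}" for b c d
    using s that unfolding same_diagram_def by blast
  have "nd u a b < nd u a q \<longleftrightarrow> nd v a b < nd v a q" if "p \<le> a \<and> a < b \<and> b < q" for a b
    using o[of a b q] that pq by auto
  then show "ZD (nd v) p q \<longleftrightarrow> ZD (nd u) p q" unfolding ZD_def by blast
  have "nd u b c < nd u b p \<longleftrightarrow> nd v b c < nd v b p" if "p < b \<and> b < c \<and> c \<le> q" for b c
    using o[of b c p] that pq by auto
  then show "ZA (nd v) p q \<longleftrightarrow> ZA (nd u) p q" unfolding ZA_def by blast
qed

section \<open>Words that contain a full wire as a block\<close>

lemma word_perm_Dword: "word_perm (Dword m) x = (if x = 1 then m + 1 else if 1 < x \<and> x \<le> m + 1 then x - 1 else x)"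
proof (induction m)
  case 0
  then show ?case by (auto simp: Dword_def word_perm_def)
next
  case (Suc m)
  have "Dword (Suc m) = Suc m # Dword m" by (simp add: Dword_def)
  then have "word_perm (Dword (Suc m)) x = sw (Suc m) (word_perm (Dword m) x)" by (simp add: word_perm_def)
  then show ?case unfolding Suc by (auto simp: sw_def)
qed

lemma word_perm_Aword: "word_perm (Aword m) x = (if x = m + 1 then 1 else if 1 \<le> x \<and> x \<le> m then x + 1 else x)"
proof (induction m arbitrary: x)
  case 0
  then show ?case by (auto simp: Aword_def word_perm_def)
next
  case (Suc m)
  have "Aword (Suc m) = Aword m @ [Suc m]" by (simp add: Aword_def)
  then have "word_perm (Aword (Suc m)) x = word_perm (Aword m) (sw (Suc m) x)"
    by (simp add: word_perm_append) (simp add: word_perm_def)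
  then show ?case unfolding Suc by (auto simp: sw_def)
qed

lemma length_Dword [simp]: "length (Dword n) = n" and length_Aword [simp]: "length (Aword n) = n"
  by (simp_all add: Dword_def Aword_def)

lemma Dword_nth: "t < n \<Longrightarrow> Dword n ! t = n - t" and Aword_nth: "t < n \<Longrightarrow> Aword n ! t = t + 1"
  by (simp_all add: Dword_def Aword_def rev_nth del: upt_Suc)

lemma injective_below_bound:
  fixes f :: "nat \<Rightarrow> nat"
  assumes "inj_on f {..<n}" "\<And>t. t < n \<Longrightarrow> f t \<in> S" "finite S" "card S \<le> n"
  shows "f ` {..<n} = S"
proof (rule card_subset_eq[OF assms(3)])
  show sub: "f ` {..<n} \<subseteq> S" using assms(2) by auto
  have "card (f ` {..<n}) = n" using assms(1) by (simp add: card_image)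
  then show "card (f ` {..<n}) = card S" using card_mono[OF assms(3) sub] assms(4) by simp
qed

text \<open>The block carries a single wire g from position n + 1 to position 1, across n different
  wires smaller than g. There are only g - 1 of these, so g = n + 1.\<close>

lemma D_block:
  assumes red: "u @ Dword n @ v \<in> red_w0 n" and a: "a \<in> {1..n}"
  shows "length u \<le> nd (u @ Dword n @ v) a (n + 1)" "nd (u @ Dword n @ v) a (n + 1) < length u + n"
proof -
  let ?w = "u @ Dword n @ v"
  interpret w: rword n ?w by unfold_locales (rule red)
  define L where "L = length u"
  define g where "g = wpos ?w L (n + 1)"
  have l: "L + t < length ?w" if "t < n" for t using that by (simp add: L_def)
  have nth: "?w ! (L + t) = n - t" if "t < n" for t
    using that by (simp add: L_def nth_append Dword_nth)
  have g: "wp ?w (L + t) g = n + 1 - t" if "t \<le> n" for t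
    using that
  proof (induction t)
    case 0
    then show ?case by (simp add: g_def)
  next
    case (Suc t)
    then show ?case using nth[of t] by (auto simp: sw_def)
  qed
  have rw: "rw ?w (L + t) = g" if "t < n" for t
    using g[of t] nth[OF that] that wpos_wp[of ?w "L + t" g] by (simp add: rw_def Suc_diff_le)
  have gr: "g \<in> {1..n+1}" using w.lw_rw_range(2)[OF l[of 0]] rw[of 0] a by auto
  define f where "f t = lw ?w (L + t)" for t
  have fg: "f t \<in> {1..<g}" if "t < n" for t
    using w.lw_less_rw[OF l[OF that]] w.lw_rw_range(1)[OF l[OF that]] rw[OF that] by (simp add: f_def)
  have ndf: "nd ?w (f t) g = L + t" if "t < n" for t
    using w.nd_lw_rw[OF l[OF that]] rw[OF that] by (simp add: f_def)
  have "inj_on f {..<n}" by (rule inj_onI) (metis ndf add_left_cancel lessThan_iff)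
  moreover have "g \<le> n + 1" using gr by simp
  then have "card {1..<g} \<le> n" by simp
  ultimately have im: "f ` {..<n} = {1..<g}" using fg by (intro injective_below_bound) auto
  then have "card {1..<g} = n" using \<open>inj_on f {..<n}\<close> card_image by fastforce
  then have "g = n + 1" using gr unfolding card_atLeastLessThan atLeastAtMost_iff by arith
  then have "a \<in> f ` {..<n}" using im a by simp
  then obtain t where t: "t < n" "f t = a" by blast
  then have "nd ?w a (n + 1) = L + t" using ndf[OF t(1)] \<open>g = n + 1\<close> by simp
  then show "length u \<le> nd ?w a (n + 1)" "nd ?w a (n + 1) < length u + n" using t by (simp_all add: L_def)
qed

text \<open>Here g goes from position 1 to position n + 1 across n larger wires, which forces g =
  1.\<close>

lemma A_block:
  assumes red: "u @ Aword n @ v \<in> red_w0 n" and a: "a \<in> {2..n+1}"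
  shows "length u \<le> nd (u @ Aword n @ v) 1 a" "nd (u @ Aword n @ v) 1 a < length u + n"
proof -
  let ?w = "u @ Aword n @ v"
  interpret w: rword n ?w by unfold_locales (rule red)
  define L where "L = length u"
  define g where "g = wpos ?w L 1"
  have l: "L + t < length ?w" if "t < n" for t using that by (simp add: L_def)
  have nth: "?w ! (L + t) = t + 1" if "t < n" for t
    using that by (simp add: L_def nth_append Aword_nth)
  have g: "wp ?w (L + t) g = t + 1" if "t \<le> n" for t
    using that
  proof (induction t)
    case 0
    then show ?case by (simp add: g_def)
  next
    case (Suc t)
    then show ?case using nth[of t] by (auto simp: sw_def)
  qed
  have lw: "lw ?w (L + t) = g" if "t < n" for t
    using g[of t] nth[OF that] that wpos_wp[of ?w "L + t" g] by (simp add: lw_def)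
  have gr: "g \<in> {1..n+1}" using w.lw_rw_range(1)[OF l[of 0]] lw[of 0] a by auto
  define f where "f t = rw ?w (L + t)" for t
  have fg: "f t \<in> {g<..n+1}" if "t < n" for t
    using w.lw_less_rw[OF l[OF that]] w.lw_rw_range(2)[OF l[OF that]] lw[OF that] by (simp add: f_def)
  have ndf: "nd ?w g (f t) = L + t" if "t < n" for t
    using w.nd_lw_rw[OF l[OF that]] lw[OF that] by (simp add: f_def)
  have "inj_on f {..<n}" by (rule inj_onI) (metis ndf add_left_cancel lessThan_iff)
  moreover have "card {g<..n+1} \<le> n" using gr by auto
  ultimately have im: "f ` {..<n} = {g<..n+1}" using fg by (intro injective_below_bound) auto
  then have "card {g<..n+1} = n" using \<open>inj_on f {..<n}\<close> card_image by fastforce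
  then have "g = 1" using gr unfolding card_greaterThanAtMost atLeastAtMost_iff by arith
  then have "a \<in> f ` {..<n}" using im a by auto
  then obtain t where t: "t < n" "f t = a" by blast
  then have "nd ?w 1 a = L + t" using ndf[OF t(1)] \<open>g = 1\<close> by simp
  then show "length u \<le> nd ?w 1 a" "nd ?w 1 a < length u + n" using t by (simp_all add: L_def)
qed

text \<open>The n heights of the block are exactly those of the crossings of wire n + 1. Every other
  crossing lies before or after the block, and a crossing after it, namely the last letter of
  \<open>v\<close>, violates \<open>ZD\<close>.\<close>

lemma ZD_Dword_iff:
  assumes red: "u @ Dword n @ v \<in> red_w0 n" and n: "1 \<le> n"
  shows "ZD (nd (u @ Dword n @ v)) 1 (n + 1) \<longleftrightarrow> v = []"
proof -
  let ?w = "u @ Dword n @ v"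
  interpret w: rword n ?w by unfold_locales (rule red)
  note B = D_block[OF red]
  show ?thesis
  proof
    assume Z: "ZD (nd ?w) 1 (n + 1)"
    show "v = []"
    proof (rule ccontr)
      assume "v \<noteq> []"
      define j where "j = length ?w - 1"
      have "0 < length v" using \<open>v \<noteq> []\<close> by simp
      moreover have "length ?w = length u + n + length v" by simp
      ultimately have j: "j < length ?w" "length u + n \<le> j" unfolding j_def by linarith+
      have r: "lw ?w j \<in> {1..n+1}" "rw ?w j \<in> {1..n+1}" "lw ?w j < rw ?w j" "nd ?w (lw ?w j) (rw ?w j) = j"
        using w.lw_rw_range[OF j(1)] w.lw_less_rw[OF j(1)] w.nd_lw_rw[OF j(1)] by auto
      then have la: "lw ?w j \<in> {1..n}" by auto
      have "rw ?w j \<noteq> n + 1" using B(2)[OF la] r j by auto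
      then have "nd ?w (lw ?w j) (rw ?w j) < nd ?w (lw ?w j) (n + 1)" 
        using Z[unfolded ZD_def, rule_format, of "lw ?w j" "rw ?w j"] r by simp
      then show False using B(2)[OF la] r j by auto
    qed
  next
    assume v: "v = []"
    show "ZD (nd ?w) 1 (n + 1)" unfolding ZD_def
    proof (intro allI impI)
      fix a b assume ab: "1 \<le> a \<and> a < b \<and> b < n + 1"
      define j where "j = nd ?w a b"
      have j: "j < length u + n" using w.nd_less(1)[of a b] ab v by (simp add: j_def)
      show "nd ?w a b < nd ?w a (n + 1)"
      proof (rule ccontr)
        assume "\<not> nd ?w a b < nd ?w a (n + 1)"
        then have ju: "length u \<le> j" using B(1)[of a] ab by (simp add: j_def)
        have "(\<lambda>c. nd ?w c (n + 1)) ` {1..n} = {length u..<length u + n}"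
        proof (rule card_subset_eq)
          show "(\<lambda>c. nd ?w c (n + 1)) ` {1..n} \<subseteq> {length u..<length u + n}" using B by auto
          have "inj_on (\<lambda>c. nd ?w c (n + 1)) {1..n}"
          proof (rule inj_onI)
            fix c d assume cd: "c \<in> {1..n}" "d \<in> {1..n}" "nd ?w c (n + 1) = nd ?w d (n + 1)"
            then show "c = d" using w.nd_inj[of c "n + 1" d "n + 1"] by (auto simp: doubleton_eq_iff)
          qed
          then show "card ((\<lambda>c. nd ?w c (n + 1)) ` {1..n}) = card {length u..<length u + n}"
            by (simp add: card_image)
        qed simp
        moreover have "j \<in> {length u..<length u + n}" using ju j by simp
        ultimately obtain c where c: "c \<in> {1..n}" "j = nd ?w c (n + 1)" by blast
        then have "{a, b} = {c, n + 1}" using ab by (intro w.nd_inj) (auto simp: j_def)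
        then show False using ab by (auto simp: doubleton_eq_iff)
      qed
    qed
  qed
qed

lemma ZA_Aword_iff:
  assumes red: "u @ Aword n @ v \<in> red_w0 n" and n: "1 \<le> n"
  shows "ZA (nd (u @ Aword n @ v)) 1 (n + 1) \<longleftrightarrow> v = []"
proof -
  let ?w = "u @ Aword n @ v"
  interpret w: rword n ?w by unfold_locales (rule red)
  note B = A_block[OF red]
  show ?thesis
  proof
    assume Z: "ZA (nd ?w) 1 (n + 1)"
    show "v = []"
    proof (rule ccontr)
      assume "v \<noteq> []"
      define j where "j = length ?w - 1"
      have "0 < length v" using \<open>v \<noteq> []\<close> by simp
      moreover have "length ?w = length u + n + length v" by simp
      ultimately have j: "j < length ?w" "length u + n \<le> j" unfolding j_def by linarith+
      have r: "lw ?w j \<in> {1..n+1}" "rw ?w j \<in> {1..n+1}" "lw ?w j < rw ?w j" "nd ?w (lw ?w j) (rw ?w j) = j"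
        using w.lw_rw_range[OF j(1)] w.lw_less_rw[OF j(1)] w.nd_lw_rw[OF j(1)] by auto
      then have ra: "rw ?w j \<in> {2..n+1}" by auto
      have "lw ?w j \<noteq> 1" using B(2)[OF ra] r j by auto
      then have l2: "lw ?w j \<in> {2..n+1}" using r by auto
      then have "nd ?w (lw ?w j) (rw ?w j) < nd ?w (lw ?w j) 1" 
        using Z[unfolded ZA_def, rule_format, of "lw ?w j" "rw ?w j"] r l2 by simp
      then show False using B(2)[OF l2] r j nd_sym[of ?w 1] by auto
    qed
  next
    assume v: "v = []"
    show "ZA (nd ?w) 1 (n + 1)" unfolding ZA_def
    proof (intro allI impI)
      fix a b assume ab: "1 < a \<and> a < b \<and> b \<le> n + 1"
      define j where "j = nd ?w a b"
      have j: "j < length u + n" using w.nd_less(1)[of a b] ab v by (simp add: j_def)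
      show "nd ?w a b < nd ?w a 1"
      proof (rule ccontr)
        assume "\<not> nd ?w a b < nd ?w a 1"
        then have ju: "length u \<le> j" using B(1)[of a] ab nd_sym[of ?w 1 a] by (simp add: j_def)
        have "(\<lambda>c. nd ?w 1 c) ` {2..n+1} = {length u..<length u + n}"
        proof (rule card_subset_eq)
          show "(\<lambda>c. nd ?w 1 c) ` {2..n+1} \<subseteq> {length u..<length u + n}" using B by auto
          have "inj_on (\<lambda>c. nd ?w 1 c) {2..n+1}"
          proof (rule inj_onI)
            fix c d assume cd: "c \<in> {2..n+1}" "d \<in> {2..n+1}" "nd ?w 1 c = nd ?w 1 d"
            then show "c = d" using w.nd_inj[of 1 c 1 d] by (auto simp: doubleton_eq_iff)
          qed
          then show "card ((\<lambda>c. nd ?w 1 c) ` {2..n+1}) = card {length u..<length u + n}"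
            by (simp add: card_image)
        qed simp
        moreover have "j \<in> {length u..<length u + n}" using ju j by simp
        ultimately obtain c where c: "c \<in> {2..n+1}" "j = nd ?w 1 c" by blast
        then have "{a, b} = {1, c}" using ab by (intro w.nd_inj) (auto simp: j_def)
        then show False using ab by (auto simp: doubleton_eq_iff)
      qed
    qed
  qed
qed

lemma tri_diff: "1 \<le> n \<Longrightarrow> n * (n + 1) div 2 = (n - 1) * (n - 1 + 1) div 2 + (n::nat)"
  by (cases n) auto

text \<open>All crossings of wire n + 1 are in the final block, so it stays in position n + 1
  throughout \<open>u\<close>, and the letter n does not occur there.\<close>

lemma red_w0_drop_Dword:
  assumes red: "u @ Dword n \<in> red_w0 n" and n: "1 \<le> n"
  shows "u \<in> red_w0 (n - 1)"
    and "1 \<le> a \<Longrightarrow> a < b \<Longrightarrow> b \<le> n \<Longrightarrow> nd u a b = nd (u @ Dword n) a b"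
proof -
  let ?w = "u @ Dword n"
  interpret w: rword n ?w by unfold_locales (rule red)
  have B: "length u \<le> nd ?w a (n + 1)" if "a \<in> {1..n}" for a using D_block(1)[of u n "[]"] red that by simp
  have nr: "rw ?w j \<noteq> n + 1" if "j < length u" for j
  proof
    assume r: "rw ?w j = n + 1"
    have j: "j < length ?w" using that by simp
    have "lw ?w j \<in> {1..n}" using w.lw_rw_range(1)[OF j] w.lw_less_rw[OF j] r by auto
    then show False using B[of "lw ?w j"] w.nd_lw_rw[OF j] r that by auto
  qed
  have pos: "wp ?w j (n + 1) = n + 1" if "j \<le> length u" for j
    using that
  proof (induction j)
    case (Suc j)
    have j: "j < length ?w" using Suc.prems by simp
    have "lw ?w j \<noteq> n + 1" using w.lw_less_rw[OF j] w.lw_rw_range(2)[OF j] by auto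
    then show ?case using Suc nr[of j] w.wp_Suc[of j "n + 1"] by (simp del: wp.simps)
  qed simp
  have "u ! j \<noteq> n" if "j < length u" for j
  proof
    assume "u ! j = n"
    then have "rw ?w j = wpos ?w j (n + 1)" using that by (simp add: rw_def nth_append)
    also have "\<dots> = n + 1" using pos[of j] that by (metis wpos_wp less_imp_le)
    finally show False using nr that by simp
  qed
  moreover have "u ! j \<in> {1..n}" if "j < length u" for j
    using w.letter[of j] that by (simp add: nth_append)
  ultimately have "set u \<subseteq> {1..n-1}"
    by (force simp: set_conv_nth)
  moreover have "length u = (n - 1) * (n - 1 + 1) div 2" using w.length_w tri_diff[OF n] by simp
  moreover have "word_perm u x = n - 1 + 2 - x" if "x \<in> {1..n - 1 + 1}" for x
  proof -
    have "word_perm ?w (x + 1) = n + 2 - (x + 1)" using red that n unfolding red_w0_def by auto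
    then show ?thesis using that n unfolding word_perm_append comp_apply word_perm_Dword by auto
  qed
  ultimately show u: "u \<in> red_w0 (n - 1)" by (auto simp: red_w0_def)
  interpret u: rword "n - 1" u by unfold_locales (rule u)
  show "nd u a b = nd ?w a b" if "1 \<le> a" "a < b" "b \<le> n"
  proof -
    define j where "j = nd u a b"
    have j: "j < length u" "lw u j = a" "rw u j = b" using u.nd_less[of a b] that by (auto simp: j_def)
    then have "nd ?w (lw ?w j) (rw ?w j) = j" using w.nd_lw_rw[of j] by simp
    then show ?thesis using j by (simp add: lw_append rw_append j_def)
  qed
qed

text \<open>Wire 1 stays in position 1 throughout \<open>u\<close>, so the letter 1 does not occur
  there and all letters can be lowered; wires and positions shift along.\<close>

lemma red_w0_drop_Aword:
  assumes red: "u @ Aword n \<in> red_w0 n" and n: "1 \<le> n"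
  shows "map (\<lambda>a. a - 1) u \<in> red_w0 (n - 1)"
    and "1 \<le> a \<Longrightarrow> a < b \<Longrightarrow> b \<le> n \<Longrightarrow> nd (map (\<lambda>a. a - 1) u) a b = nd (u @ Aword n) (a + 1) (b + 1)"
    and "set u \<subseteq> {2..n}"
proof -
  let ?w = "u @ Aword n" and ?x = "map (\<lambda>a. a - 1) u"
  interpret w: rword n ?w by unfold_locales (rule red)
  have B: "length u \<le> nd ?w 1 a" if "a \<in> {2..n+1}" for a using A_block(1)[of u n "[]"] red that by simp
  have nl: "lw ?w j \<noteq> 1" if "j < length u" for j
  proof
    assume r: "lw ?w j = 1"
    have j: "j < length ?w" using that by simp
    have "rw ?w j \<in> {2..n+1}" using w.lw_rw_range(2)[OF j] w.lw_less_rw[OF j] r by auto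
    then show False using B[of "rw ?w j"] w.nd_lw_rw[OF j] r that by auto
  qed
  have pos: "wp ?w j 1 = 1" if "j \<le> length u" for j
    using that
  proof (induction j)
    case (Suc j)
    have j: "j < length ?w" using Suc.prems by simp
    have "rw ?w j \<noteq> 1" using w.lw_less_rw[OF j] w.lw_rw_range(1)[OF j] by auto
    then show ?case using Suc nl[of j] w.wp_Suc[of j 1] by (simp del: wp.simps)
  qed simp
  have "u ! j \<noteq> 1" if "j < length u" for j
  proof
    assume "u ! j = 1"
    then have "lw ?w j = wpos ?w j 1" using that by (simp add: lw_def nth_append)
    also have "\<dots> = 1" using pos[of j] that by (metis wpos_wp less_imp_le)
    finally show False using nl that by simp
  qed
  moreover have "u ! j \<in> {1..n}" if "j < length u" for j
    using w.letter[of j] that by (simp add: nth_append)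
  ultimately have u2: "2 \<le> u ! j \<and> u ! j \<le> n" if "j < length u" for j using that by force
  then show su: "set u \<subseteq> {2..n}" by (auto simp: set_conv_nth)
  have shift: "Suc (wpos ?x j p) = wpos ?w j (Suc p)" if "j \<le> length u" for j p
    using that
  proof (induction j arbitrary: p)
    case (Suc j)
    have "Suc (sw (u ! j - 1) p) = sw (u ! j) (Suc p)" using u2[of j] Suc.prems by (auto simp: sw_def)
    then show ?case using Suc by (simp add: nth_append)
  qed simp
  have "set ?x \<subseteq> {1..n-1}"
  proof
    fix b assume "b \<in> set ?x"
    then obtain a where "a \<in> set u" "b = a - 1" by auto
    moreover from this have "2 \<le> a" "a \<le> n" using su by auto
    ultimately show "b \<in> {1..n-1}" by auto
  qed
  moreover have "length ?x = (n - 1) * (n - 1 + 1) div 2" using w.length_w tri_diff[OF n] by simp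
  moreover have "word_perm ?x p = n - 1 + 2 - p" if p: "p \<in> {1..n - 1 + 1}" for p
  proof -
    have "Suc (word_perm ?x p) = word_perm u (Suc p)"
      using shift[of "length u" p] wpos_append[of "length u" u "Aword n"] by (simp add: wpos_eq_word_perm)
    also have "\<dots> = word_perm ?w p"
      unfolding word_perm_append comp_apply word_perm_Aword using p n by auto
    also have "\<dots> = n + 2 - p" using red p n unfolding red_w0_def by auto
    finally show ?thesis using p n by auto
  qed
  ultimately show x: "?x \<in> red_w0 (n - 1)" unfolding red_w0_def by blast
  interpret x: rword "n - 1" ?x by unfold_locales (rule x)
  show "nd ?x a b = nd ?w (a + 1) (b + 1)" if "1 \<le> a" "a < b" "b \<le> n"
  proof -
    define j where "j = nd ?x a b"
    have j: "j < length u" "lw ?x j = a" "rw ?x j = b" using x.nd_less[of a b] that by (auto simp: j_def)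
    have "lw ?w j = a + 1" "rw ?w j = b + 1"
      using j shift[of j "?x ! j"] shift[of j "?x ! j + 1"] u2[of j] by (auto simp: lw_def rw_def nth_append)
    then show ?thesis using w.nd_lw_rw[of j] j by (simp add: j_def)
  qed
qed

section \<open>Index zero and the contraction\<close>

context rword
begin

text \<open>\<open>ZD\<close> is invariant under 2-moves and tests \<open>v = []\<close> in every
  decomposition; so either all decompositions have an empty tail or none has.\<close>

lemma ind_D_iff: "1 \<le> n \<Longrightarrow> ind D n w = 0 \<longleftrightarrow> ZD (nd w) 1 (n + 1)"
proof -
  assume n: "1 \<le> n"
  obtain u v where uv: "comm_eq w (u @ Dword n @ v)" using Dword_decomposition[OF n] by blast
  have Z: "ZD (nd w) 1 (n + 1) \<longleftrightarrow> v = []" if c: "comm_eq w (u @ Dword n @ v)" for u v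
  proof -
    obtain \<pi> where s: "same_diagram n \<pi> w (u @ Dword n @ v)" using comm_eq_same_diagram[OF c red] by blast
    then have r: "u @ Dword n @ v \<in> red_w0 n" by (simp add: same_diagram_def)
    show ?thesis using ZD_Dword_iff[OF r n] same_diagram_ZD[OF s, of 1 "n + 1"] by simp
  qed
  have "ind D n w = (LEAST l. \<exists>u v. comm_eq w (u @ Dword n @ v) \<and> length v = l)" by (simp add: ind_def)
  also have "\<dots> = 0 \<longleftrightarrow> (\<exists>u. comm_eq w (u @ Dword n @ []))"
  proof
    assume "(LEAST l. \<exists>u v. comm_eq w (u @ Dword n @ v) \<and> length v = l) = 0"
    then show "\<exists>u. comm_eq w (u @ Dword n @ [])"
      using LeastI_ex[of "\<lambda>l. \<exists>u v. comm_eq w (u @ Dword n @ v) \<and> length v = l"] uv by auto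
  next
    assume "\<exists>u. comm_eq w (u @ Dword n @ [])"
    then have "(LEAST l. \<exists>u v. comm_eq w (u @ Dword n @ v) \<and> length v = l) \<le> 0"
      by (intro Least_le) auto
    then show "(LEAST l. \<exists>u v. comm_eq w (u @ Dword n @ v) \<and> length v = l) = 0" by simp
  qed
  also have "\<dots> \<longleftrightarrow> ZD (nd w) 1 (n + 1)" using Z uv by metis
  finally show ?thesis .
qed

lemma ind_A_iff: "1 \<le> n \<Longrightarrow> ind A n w = 0 \<longleftrightarrow> ZA (nd w) 1 (n + 1)"
proof -
  assume n: "1 \<le> n"
  obtain u v where uv: "comm_eq w (u @ Aword n @ v)" using Aword_decomposition[OF n] by blast
  have Z: "ZA (nd w) 1 (n + 1) \<longleftrightarrow> v = []" if c: "comm_eq w (u @ Aword n @ v)" for u v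
  proof -
    obtain \<pi> where s: "same_diagram n \<pi> w (u @ Aword n @ v)" using comm_eq_same_diagram[OF c red] by blast
    then have r: "u @ Aword n @ v \<in> red_w0 n" by (simp add: same_diagram_def)
    show ?thesis using ZA_Aword_iff[OF r n] same_diagram_ZA[OF s, of 1 "n + 1"] by simp
  qed
  have "ind A n w = (LEAST l. \<exists>u v. comm_eq w (u @ Aword n @ v) \<and> length v = l)" by (simp add: ind_def)
  also have "\<dots> = 0 \<longleftrightarrow> (\<exists>u. comm_eq w (u @ Aword n @ []))"
  proof
    assume "(LEAST l. \<exists>u v. comm_eq w (u @ Aword n @ v) \<and> length v = l) = 0"
    then show "\<exists>u. comm_eq w (u @ Aword n @ [])"
      using LeastI_ex[of "\<lambda>l. \<exists>u v. comm_eq w (u @ Aword n @ v) \<and> length v = l"] uv by auto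
  next
    assume "\<exists>u. comm_eq w (u @ Aword n @ [])"
    then have "(LEAST l. \<exists>u v. comm_eq w (u @ Aword n @ v) \<and> length v = l) \<le> 0"
      by (intro Least_le) auto
    then show "(LEAST l. \<exists>u v. comm_eq w (u @ Aword n @ v) \<and> length v = l) = 0" by simp
  qed
  also have "\<dots> \<longleftrightarrow> ZA (nd w) 1 (n + 1)" using Z uv by metis
  finally show ?thesis .
qed

text \<open>The choice operator may pick any decomposition, but by \<open>ZD\<close> each of them
  has an empty tail, so no letter is lowered.\<close>

lemma contr_D:
  assumes n: "1 \<le> n" and Z: "ZD (nd w) 1 (n + 1)"
  shows "comm_eq w (contr D n w @ Dword n)"
proof -
  have "\<exists>x u v. comm_eq w (u @ Dword n @ v) \<and> x = u @ map (\<lambda>a. a - 1) v"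
    using Dword_decomposition[OF n] by blast
  then have "\<exists>u v. comm_eq w (u @ Dword n @ v) \<and> contr D n w = u @ map (\<lambda>a. a - 1) v"
    unfolding contr_def by simp (rule someI_ex, blast)
  then obtain u v where uv: "comm_eq w (u @ Dword n @ v)" "contr D n w = u @ map (\<lambda>a. a - 1) v" by blast
  obtain \<pi> where s: "same_diagram n \<pi> w (u @ Dword n @ v)" using comm_eq_same_diagram[OF uv(1) red] by blast
  then have r: "u @ Dword n @ v \<in> red_w0 n" by (simp add: same_diagram_def)
  have "v = []" using ZD_Dword_iff[OF r n] same_diagram_ZD[OF s, of 1 "n + 1"] Z by simp
  then show ?thesis using uv by simp
qed

lemma contr_A:
  assumes n: "1 \<le> n" and Z: "ZA (nd w) 1 (n + 1)"
  shows "\<exists>u. comm_eq w (u @ Aword n) \<and> contr A n w = map (\<lambda>a. a - 1) u"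
proof -
  have "\<exists>x u v. comm_eq w (u @ Aword n @ v) \<and> x = map (\<lambda>a. a - 1) u @ v"
    using Aword_decomposition[OF n] by blast
  then have "\<exists>u v. comm_eq w (u @ Aword n @ v) \<and> contr A n w = map (\<lambda>a. a - 1) u @ v"
    unfolding contr_def by simp (rule someI_ex, blast)
  then obtain u v where uv: "comm_eq w (u @ Aword n @ v)" "contr A n w = map (\<lambda>a. a - 1) u @ v" by blast
  obtain \<pi> where s: "same_diagram n \<pi> w (u @ Aword n @ v)" using comm_eq_same_diagram[OF uv(1) red] by blast
  then have r: "u @ Aword n @ v \<in> red_w0 n" by (simp add: same_diagram_def)
  have "v = []" using ZA_Aword_iff[OF r n] same_diagram_ZA[OF s, of 1 "n + 1"] Z by simp
  then show ?thesis using uv by auto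
qed

end

section \<open>String polytopes of words ending in a full wire\<close>

text \<open>The string cone with coordinates indexed by natural numbers. Induction over contractions
  changes the dimension, which vectors over a fixed index type do not permit.\<close>

definition path_cone :: "nat \<Rightarrow> nat list \<Rightarrow> (nat \<Rightarrow> real) \<Rightarrow> bool" where
  "path_cone n w y \<longleftrightarrow> (\<forall>k bs. gp (nd w) 1 (n + 1) k bs \<longrightarrow> 0 \<le> val (swf w y) bs)"

lemma gp_nthD:
  assumes "gp h p q k bs"
  shows "bs ! 0 = k" "bs ! (length bs - 1) = k + 1" "1 < length bs"
    and "i < length bs \<Longrightarrow> bs ! i \<in> {p..q}"
    and "Suc i < length bs \<Longrightarrow> bs ! i \<noteq> bs ! Suc i"
    and "Suc (Suc i) < length bs \<Longrightarrow> turn h k (bs ! i) (bs ! Suc i) (bs ! Suc (Suc i))"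
proof -
  have b: "bs \<noteq> []" "hd bs = k" "last bs = k + 1" "turns h k bs" "set bs \<subseteq> {p..q}" using assms by (auto simp: gp_def)
  show "1 < length bs" using b by (cases bs; cases "tl bs") auto
  show "bs ! 0 = k" "bs ! (length bs - 1) = k + 1" using b by (simp_all add: hd_conv_nth last_conv_nth)
  show "i < length bs \<Longrightarrow> bs ! i \<in> {p..q}" using b(5) nth_mem[of i bs] by blast
  show "Suc i < length bs \<Longrightarrow> bs ! i \<noteq> bs ! Suc i" using turns_nth[OF b(4)] by blast
  show "Suc (Suc i) < length bs \<Longrightarrow> turn h k (bs ! i) (bs ! Suc i) (bs ! Suc (Suc i))"
    using turns_nth[OF b(4), of i] by simp
qed

lemma ZD_orders:
  assumes arr: "arr (n + 1) h" and Z: "ZD h 1 (n + 1)"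
  shows "a \<in> {1..n} \<Longrightarrow> b \<in> {1..n} \<Longrightarrow> a \<noteq> b \<Longrightarrow> h a b < h a (n + 1)"
    and "1 \<le> a \<Longrightarrow> a < b \<Longrightarrow> b \<le> n \<Longrightarrow> h (n + 1) a < h (n + 1) b"
proof -
  have t: "h a b < h a (n + 1) \<and> h b a < h b (n + 1) \<and> h (n + 1) a < h (n + 1) b"
    if "1 \<le> a" "a < b" "b \<le> n" for a b
    using arr_triple[OF arr, of a b "n + 1"] Z[unfolded ZD_def, rule_format, of a b] that by auto
  show "1 \<le> a \<Longrightarrow> a < b \<Longrightarrow> b \<le> n \<Longrightarrow> h (n + 1) a < h (n + 1) b" using t by blast
  show "a \<in> {1..n} \<Longrightarrow> b \<in> {1..n} \<Longrightarrow> a \<noteq> b \<Longrightarrow> h a b < h a (n + 1)"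
    using t[of a b] t[of b a] by (cases "a < b") auto
qed

lemma ZA_orders:
  assumes arr: "arr (n + 1) h" and Z: "ZA h 1 (n + 1)"
  shows "a \<in> {2..n+1} \<Longrightarrow> b \<in> {2..n+1} \<Longrightarrow> a \<noteq> b \<Longrightarrow> h a b < h a 1"
    and "2 \<le> a \<Longrightarrow> a < b \<Longrightarrow> b \<le> n + 1 \<Longrightarrow> h 1 b < h 1 a"
proof -
  have t: "h a b < h a 1 \<and> h b a < h b 1 \<and> h 1 b < h 1 a" if "2 \<le> a" "a < b" "b \<le> n + 1" for a b
    using arr_triple[OF arr, of 1 a b] Z[unfolded ZA_def, rule_format, of a b] that by auto
  show "2 \<le> a \<Longrightarrow> a < b \<Longrightarrow> b \<le> n + 1 \<Longrightarrow> h 1 b < h 1 a" using t by blast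
  show "a \<in> {2..n+1} \<Longrightarrow> b \<in> {2..n+1} \<Longrightarrow> a \<noteq> b \<Longrightarrow> h a b < h a 1"
    using t[of a b] t[of b a] by (cases "a < b") auto
qed

lemma length_2_list: "length xs = 2 \<Longrightarrow> xs = [xs ! 0, xs ! 1]"
  and length_3_list: "length xs = 3 \<Longrightarrow> xs = [xs ! 0, xs ! 1, xs ! 2]"
  by (auto simp: numeral_2_eq_2 numeral_3_eq_3 length_Suc_conv)

text \<open>On every other wire the crossing with n + 1 is the lowest. So an upward wire can lead to
  n + 1 only at the start of the path, and a path that leaves n + 1 for a downward wire has no
  crossing ahead and ends there.\<close>

lemma ZD_paths:
  assumes arr: "arr (n + 1) h" and Z: "ZD h 1 (n + 1)" and bs: "gp h 1 (n + 1) k bs" and mem: "n + 1 \<in> set bs"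
  shows "k < n \<and> bs = [k, n + 1, k + 1] \<or> k = n \<and> bs = [n, n + 1]"
proof -
  note g = gp_nthD[OF bs]
  note o = ZD_orders[OF arr Z]
  have kn: "1 \<le> k" "k \<le> n" using gp_range[OF bs] by auto
  obtain i where i: "i < length bs" "bs ! i = n + 1" using mem by (metis in_set_conv_nth)
  have "i \<noteq> 0"
  proof
    assume "i = 0"
    then show False using i g(1) kn by simp
  qed
  then obtain l where l: "i = Suc l" by (cases i) auto
  define x where "x = bs ! l"
  have x: "x \<in> {1..n}" using g(4)[of l] g(5)[of l] i l by (auto simp: x_def)
  have x1: "l = 0" if "x \<le> k"
  proof (rule ccontr)
    assume "l \<noteq> 0"
    then obtain l' where l': "l = Suc l'" by (cases l) auto
    have "turn h k (bs ! l') x (n + 1)" using g(6)[of l'] i l l' by (simp add: x_def)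
    then have "h x (n + 1) < h x (bs ! l')" using that by (simp add: turn_def)
    moreover have "bs ! l' \<noteq> x" "bs ! l' \<in> {1..n+1}" using g(4)[of l'] g(5)[of l'] i l l' by (auto simp: x_def)
    ultimately show False using o(1)[of x "bs ! l'"] x by (cases "bs ! l' = n + 1") auto
  qed
  show ?thesis
  proof (cases "Suc i < length bs")
    case False
    then have "i = length bs - 1" using i by simp
    then have "k = n" using g(2) i by simp
    moreover from this have "l = 0" using x1 x by simp
    ultimately show ?thesis using length_2_list[of bs] False i l g(1) by auto
  next
    case True
    define c where "c = bs ! Suc i"
    have c: "c \<in> {1..n}" using g(4)[of "Suc i"] g(5)[of i] True i by (auto simp: c_def)
    have "turn h k x (n + 1) c" using g(6)[of l] True i l by (simp add: x_def c_def)
    then have "h (n + 1) x < h (n + 1) c" using kn by (simp add: turn_def)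
    then have xc: "x < c" using o(2)[of c x] x c by (cases c x rule: linorder_cases) auto
    have end_: "\<not> Suc (Suc i) < length bs" if "k < c"
    proof
      assume s: "Suc (Suc i) < length bs"
      define d where "d = bs ! Suc (Suc i)"
      have "turn h k (n + 1) c d" using g(6)[of i] s i by (simp add: c_def d_def)
      then have "h c (n + 1) < h c d" using that by (simp add: turn_def)
      moreover have "d \<noteq> c" "d \<in> {1..n+1}" using g(4)[of "Suc (Suc i)"] g(5)[of "Suc i"] s by (auto simp: c_def d_def)
      ultimately show False using o(1)[of c d] c by (cases "d = n + 1") auto
    qed
    \<comment> \<open>Coming from a downward wire x, the path would leave n + 1 for a larger wire c
      and end on it, which gives k + 1 = c > x > k.\<close>
    have "x \<le> k"
    proof (rule ccontr)
      assume "\<not> x \<le> k"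
      then have "\<not> Suc (Suc i) < length bs" using end_ xc by simp
      then have "c = k + 1" using g(2) True unfolding c_def by (metis Suc_lessI diff_Suc_1)
      then show False using xc \<open>\<not> x \<le> k\<close> by simp
    qed
    then have l0: "l = 0" "x = k" using x1 g(1) by (auto simp: x_def)
    then have "\<not> Suc (Suc i) < length bs" using end_ xc by simp
    then have len: "length bs = 3" using True l l0 by simp
    then have "c = k + 1" using g(2) l l0 by (simp add: c_def numeral_3_eq_3)
    then show ?thesis using length_3_list[OF len] l l0 i g(1) c by (auto simp: c_def numeral_2_eq_2)
  qed
qed

lemma ZA_paths:
  assumes arr: "arr (n + 1) h" and Z: "ZA h 1 (n + 1)" and bs: "gp h 1 (n + 1) k bs" and mem: "1 \<in> set bs"
  shows "2 \<le> k \<and> bs = [k, 1, k + 1] \<or> k = 1 \<and> bs = [1, 2]"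
proof -
  note g = gp_nthD[OF bs]
  note o = ZA_orders[OF arr Z]
  have kn: "1 \<le> k" "k \<le> n" using gp_range[OF bs] by auto
  obtain i where i: "i < length bs" "bs ! i = 1" using mem by (metis in_set_conv_nth)
  have si: "Suc i < length bs"
  proof (rule ccontr)
    assume "\<not> Suc i < length bs"
    then have "i = length bs - 1" using i by simp
    then show False using g(2) i kn by simp
  qed
  define c where "c = bs ! Suc i"
  have c: "c \<in> {2..n+1}" using g(4)[of "Suc i"] g(5)[of i] si i by (auto simp: c_def)
  have end_: "length bs = Suc (Suc i) \<and> c = k + 1" if "k < c"
  proof -
    have "\<not> Suc (Suc i) < length bs"
    proof
      assume s: "Suc (Suc i) < length bs"
      define d where "d = bs ! Suc (Suc i)"
      have "turn h k 1 c d" using g(6)[of i] s i by (simp add: c_def d_def)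
      then have "h c 1 < h c d" using that by (simp add: turn_def)
      moreover have "d \<noteq> c" "d \<in> {1..n+1}" using g(4)[of "Suc (Suc i)"] g(5)[of "Suc i"] s by (auto simp: c_def d_def)
      ultimately show False using o(1)[of c d] c by (cases "d = 1") auto
    qed
    then have "length bs = Suc (Suc i)" using si by simp
    then show ?thesis using g(2) by (simp add: c_def)
  qed
  show ?thesis
  proof (cases i)
    case 0
    then have k: "k = 1" using i g(1) by simp
    then have "length bs = 2" "c = 2" using end_ c 0 by auto
    then show ?thesis using k length_2_list[of bs] i 0 by (simp add: c_def)
  next
    case (Suc l)
    define x where "x = bs ! l"
    have x: "x \<in> {2..n+1}" using g(4)[of l] g(5)[of l] i Suc by (auto simp: x_def)
    have "turn h k x 1 c" using g(6)[of l] si i Suc by (simp add: x_def c_def)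
    then have "h 1 c < h 1 x" using kn by (simp add: turn_def)
    then have xc: "x < c" using o(2)[of c x] x c by (cases c x rule: linorder_cases) auto
    have xk: "x \<le> k" using end_ xc by (cases "k < c") auto
    have "l = 0"
    proof (rule ccontr)
      assume "l \<noteq> 0"
      then obtain l' where l': "l = Suc l'" by (cases l) auto
      have "turn h k (bs ! l') x 1" using g(6)[of l'] i Suc l' by (simp add: x_def)
      then have "h x 1 < h x (bs ! l')" using xk by (simp add: turn_def)
      moreover have "bs ! l' \<noteq> x" "bs ! l' \<in> {1..n+1}" using g(4)[of l'] g(5)[of l'] i Suc l' by (auto simp: x_def)
      ultimately show False using o(1)[of x "bs ! l'"] x by (cases "bs ! l' = 1") auto
    qed
    then have "x = k" using g(1) by (simp add: x_def)
    then have "length bs = 3" "c = k + 1" using end_ xc Suc \<open>l = 0\<close> by auto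
    then show ?thesis using length_3_list[of bs] i Suc \<open>l = 0\<close> g(1) x \<open>x = k\<close> by (auto simp: c_def numeral_2_eq_2)
  qed
qed

lemma swf_cong: "(\<And>a b. a \<in> set bs \<Longrightarrow> b \<in> set bs \<Longrightarrow> a < b \<Longrightarrow> y (nd w a b) = y' (nd w' a b)) \<Longrightarrow>
    val (swf w y) bs = val (swf w' y') bs"
proof (rule val_cong)
  fix a b assume *: "\<And>a b. a \<in> set bs \<Longrightarrow> b \<in> set bs \<Longrightarrow> a < b \<Longrightarrow> y (nd w a b) = y' (nd w' a b)"
    and "a \<in> set bs" "b \<in> set bs"
  then show "swf w y a b = swf w' y' a b"
    using *[of a b] *[of b a] nd_sym[of w a b] nd_sym[of w' a b]
    by (cases a b rule: linorder_cases) (auto simp: swf_def sw_coef_def)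
qed

lemma path_cone_drop_D:
  assumes red: "u @ Dword n \<in> red_w0 n" and n: "1 \<le> n"
  defines "h \<equiv> nd (u @ Dword n)"
  shows "path_cone n (u @ Dword n) y \<longleftrightarrow> path_cone (n - 1) u y \<and>
     (\<forall>k\<in>{1..<n}. y (h (k + 1) (n + 1)) \<le> y (h k (n + 1))) \<and> 0 \<le> y (h n (n + 1))"
proof -
  let ?w = "u @ Dword n"
  interpret w: rword n ?w by unfold_locales (rule red)
  have arr: "arr (n + 1) h" using w.arr_nd by (simp add: h_def)
  have Z: "ZD h 1 (n + 1)" using ZD_Dword_iff[of u n "[]"] red n by (simp add: h_def)
  note o = ZD_orders[OF arr Z]
  have sym: "h a b = h b a" for a b by (simp add: h_def nd_sym)
  have ndu: "nd u a b = h a b" if "a \<in> {1..n}" "b \<in> {1..n}" "a \<noteq> b" for a b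
    using red_w0_drop_Dword(2)[OF red n, of a b] red_w0_drop_Dword(2)[OF red n, of b a] that nd_sym[of u a b] sym[of a b]
    by (cases "a < b") (auto simp: h_def)
  have gpu: "gp (nd u) 1 n k bs \<longleftrightarrow> gp h 1 n k bs" for k bs
    by (rule gp_cong) (simp add: ndu)
  have valu: "val (swf u y) bs = val (swf ?w y) bs" if "gp h 1 n k bs" for k bs
    using that by (intro swf_cong) (auto simp: gp_def ndu subset_iff h_def[symmetric])
  have split: "gp h 1 (n + 1) k bs \<longleftrightarrow> gp h 1 n k bs \<or> k \<in> {1..<n} \<and> bs = [k, n + 1, k + 1] \<or> k = n \<and> bs = [n, n + 1]" for k bs
  proof
    assume g: "gp h 1 (n + 1) k bs"
    show "gp h 1 n k bs \<or> k \<in> {1..<n} \<and> bs = [k, n + 1, k + 1] \<or> k = n \<and> bs = [n, n + 1]"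
    proof (cases "n + 1 \<in> set bs")
      case True
      then show ?thesis using ZD_paths[OF arr Z g] gp_range[OF g] by auto
    next
      case False
      have "{1..n} = {1..n+1} - {n + 1}" by auto
      then show ?thesis using g False by (auto simp: gp_def)
    qed
  next
    assume "gp h 1 n k bs \<or> k \<in> {1..<n} \<and> bs = [k, n + 1, k + 1] \<or> k = n \<and> bs = [n, n + 1]"
    moreover have "turn h k k (n + 1) (k + 1)" if "k \<in> {1..<n}"
    proof -
      have "h (n + 1) k < h (n + 1) (k + 1)" using o(2)[of k "k + 1"] that by auto
      moreover have "\<not> h (n + 1) d < h (n + 1) (k + 1)" if "k < d \<and> d < n + 1" for d
        using o(2)[of "k + 1" d] that by (cases "d = k + 1") auto
      ultimately show ?thesis using that by (simp add: turn_def)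
    qed
    ultimately show "gp h 1 (n + 1) k bs"
      using n gp_mono[of h 1 n k bs 1 "n + 1"] by (auto simp: gp_def)
  qed
  have "val (swf ?w y) [k, n + 1, k + 1] = y (h k (n + 1)) - y (h (k + 1) (n + 1))" if "k \<in> {1..<n}" for k
    using that sym[of "n + 1" "k + 1"] by (simp add: swf_def sw_coef_def h_def)
  moreover have "val (swf ?w y) [n, n + 1] = y (h n (n + 1))" by (simp add: swf_def sw_coef_def h_def)
  moreover have "path_cone (n - 1) u y \<longleftrightarrow> (\<forall>k bs. gp h 1 n k bs \<longrightarrow> 0 \<le> val (swf ?w y) bs)"
  proof -
    have "n - 1 + 1 = n" using n by simp
    then show ?thesis unfolding path_cone_def using gpu valu by metis
  qed
  moreover have "path_cone n ?w y \<longleftrightarrow> (\<forall>k bs. gp h 1 n k bs \<longrightarrow> 0 \<le> val (swf ?w y) bs) \<and>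
      (\<forall>k\<in>{1..<n}. 0 \<le> val (swf ?w y) [k, n + 1, k + 1]) \<and> 0 \<le> val (swf ?w y) [n, n + 1]"
    unfolding path_cone_def h_def[symmetric] split by blast
  ultimately show ?thesis by simp
qed

lemma path_cone_drop_A:
  assumes red: "u @ Aword n \<in> red_w0 n" and n: "1 \<le> n"
  defines "h \<equiv> nd (u @ Aword n)"
  shows "path_cone n (u @ Aword n) y \<longleftrightarrow> path_cone (n - 1) (map (\<lambda>a. a - 1) u) y \<and>
     (\<forall>k\<in>{2..n}. y (h 1 k) \<le> y (h 1 (k + 1))) \<and> 0 \<le> y (h 1 2)"
proof -
  let ?w = "u @ Aword n" and ?x = "map (\<lambda>a. a - 1) u"
  interpret w: rword n ?w by unfold_locales (rule red)
  have arr: "arr (n + 1) h" using w.arr_nd by (simp add: h_def)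
  have Z: "ZA h 1 (n + 1)" using ZA_Aword_iff[of u n "[]"] red n by (simp add: h_def)
  note o = ZA_orders[OF arr Z]
  have sym: "h a b = h b a" for a b by (simp add: h_def nd_sym)
  have ndx: "nd ?x a b = h (Suc a) (Suc b)" if "a \<in> {1..n}" "b \<in> {1..n}" "a \<noteq> b" for a b
    using red_w0_drop_Aword(2)[OF red n, of a b] red_w0_drop_Aword(2)[OF red n, of b a] that nd_sym[of ?x a b] sym[of "Suc a" "Suc b"]
    by (cases "a < b") (auto simp: h_def)
  have gpx: "gp (nd ?x) 1 n k bs \<longleftrightarrow> gp h 2 (n + 1) (Suc k) (map Suc bs)" for k bs
  proof -
    have "gp (nd ?x) 1 n k bs \<longleftrightarrow> gp (\<lambda>a b. h (Suc a) (Suc b)) 1 n k bs"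
    proof (rule gp_cong)
      fix b c d assume "b \<in> {1..n}" "c \<in> {1..n}" "d \<in> {1..n}" "b \<noteq> c" "b \<noteq> d"
      then have "nd ?x b c = h (Suc b) (Suc c)" "nd ?x b d = h (Suc b) (Suc d)" using ndx by blast+
      then show "nd ?x b c < nd ?x b d \<longleftrightarrow> h (Suc b) (Suc c) < h (Suc b) (Suc d)" by (simp only:)
    qed
    then show ?thesis using gp_shift[of h 1 n k bs] by (simp add: numeral_2_eq_2)
  qed
  have valx: "val (swf ?x y) bs = val (swf ?w y) (map Suc bs)" if "gp (nd ?x) 1 n k bs" for k bs
  proof -
    have s: "set bs \<subseteq> {1..n}" using that by (simp add: gp_def)
    have "swf ?x y a b = swf ?w y (Suc a) (Suc b)" if "a \<in> set bs" "b \<in> set bs" for a b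
    proof (cases "a = b")
      case False
      then have "nd ?x a b = h (Suc a) (Suc b)" using that s by (intro ndx) auto
      then show ?thesis by (simp add: swf_def sw_coef_def h_def)
    qed (simp add: swf_def sw_coef_def)
    then show ?thesis unfolding val_map by (rule val_cong)
  qed
  have sur: "\<exists>l cs. k = Suc l \<and> bs = map Suc cs" if "gp h 2 (n + 1) k bs" for k bs
  proof -
    have s: "set bs \<subseteq> {2..n+1}" using that by (simp add: gp_def)
    have "2 \<le> k" using gp_range[OF that] by simp
    moreover have "bs = map Suc (map (\<lambda>a. a - 1) bs)"
      using s by (auto simp: map_idI comp_def intro!: map_idI[symmetric])
    ultimately show ?thesis by (metis Suc_eq_plus1 add.commute le_add_diff_inverse numeral_2_eq_2 plus_1_eq_Suc Suc_le_D)
  qed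
  have split: "gp h 1 (n + 1) k bs \<longleftrightarrow> gp h 2 (n + 1) k bs \<or> k \<in> {2..n} \<and> bs = [k, 1, k + 1] \<or> k = 1 \<and> bs = [1, 2]" for k bs
  proof
    assume g: "gp h 1 (n + 1) k bs"
    show "gp h 2 (n + 1) k bs \<or> k \<in> {2..n} \<and> bs = [k, 1, k + 1] \<or> k = 1 \<and> bs = [1, 2]"
    proof (cases "1 \<in> set bs")
      case True
      then show ?thesis using ZA_paths[OF arr Z g] gp_range[OF g] by auto
    next
      case False
      have "{2..n+1} = {1..n+1} - {1}" by auto
      then show ?thesis using g False by (auto simp: gp_def)
    qed
  next
    assume "gp h 2 (n + 1) k bs \<or> k \<in> {2..n} \<and> bs = [k, 1, k + 1] \<or> k = 1 \<and> bs = [1, 2]"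
    moreover have "turn h k k 1 (k + 1)" if "k \<in> {2..n}"
    proof -
      have "h 1 (k + 1) < h 1 k" using o(2)[of k "k + 1"] that by auto
      moreover have "\<not> h 1 d < h 1 k" if "1 < d \<and> d \<le> k" for d
        using o(2)[of d k] that \<open>k \<in> {2..n}\<close> by (cases "d = k") auto
      ultimately show ?thesis using that by (simp add: turn_def)
    qed
    ultimately show "gp h 1 (n + 1) k bs"
      using n gp_mono[of h 2 "n + 1" k bs 1 "n + 1"] by (auto simp: gp_def)
  qed
  have "val (swf ?w y) [k, 1, k + 1] = y (h 1 (k + 1)) - y (h 1 k)" if "k \<in> {2..n}" for k
    using that sym[of k 1] by (simp add: swf_def sw_coef_def h_def)
  moreover have "val (swf ?w y) [1, 2] = y (h 1 2)" by (simp add: swf_def sw_coef_def h_def)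
  moreover have "path_cone (n - 1) ?x y \<longleftrightarrow> (\<forall>k bs. gp h 2 (n + 1) k bs \<longrightarrow> 0 \<le> val (swf ?w y) bs)"
    using n gpx valx sur unfolding path_cone_def by (metis le_add_diff_inverse2)
  moreover have "path_cone n ?w y \<longleftrightarrow> (\<forall>k bs. gp h 2 (n + 1) k bs \<longrightarrow> 0 \<le> val (swf ?w y) bs) \<and>
      (\<forall>k\<in>{2..n}. 0 \<le> val (swf ?w y) [k, 1, k + 1]) \<and> 0 \<le> val (swf ?w y) [1, 2]"
    unfolding path_cone_def h_def[symmetric] split by blast
  ultimately show ?thesis by simp
qed

text \<open>Locates the crossings of the last wire: they come in a known order and fill the block,
  which leaves only one possible height for each.\<close>

lemma strict_mono_onto_interval:
  fixes f :: "nat \<Rightarrow> nat"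
  assumes f: "\<And>a b. 1 \<le> a \<Longrightarrow> a < b \<Longrightarrow> b \<le> n \<Longrightarrow> f a < f b" and r: "\<And>a. a \<in> {1..n} \<Longrightarrow> L \<le> f a \<and> f a < L + n"
    and a: "a \<in> {1..n}"
  shows "f a + 1 = L + a"
proof -
  have lo: "d + 1 \<le> n \<Longrightarrow> L + d \<le> f (d + 1)" for d
  proof (induction d)
    case (Suc d)
    then show ?case using f[of "d + 1" "Suc d + 1"] by simp
  qed (use r[of 1] a in auto)
  have hi: "d < n \<Longrightarrow> f (n - d) + d < L + n" for d
  proof (induction d)
    case (Suc d)
    have "1 \<le> n - Suc d" "n - Suc d < n - d" using Suc.prems by auto
    then show ?case using f[of "n - Suc d" "n - d"] Suc by simp
  qed (use r[of n] a in auto)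
  show ?thesis using lo[of "a - 1"] hi[of "n - a"] a by simp
qed

lemma nd_Dword:
  assumes red: "u @ Dword n \<in> red_w0 n" and a: "a \<in> {1..n}"
  shows "nd (u @ Dword n) a (n + 1) + 1 = length u + a"
proof -
  interpret w: rword n "u @ Dword n" by unfold_locales (rule red)
  have Z: "ZD (nd (u @ Dword n)) 1 (n + 1)" using ZD_Dword_iff[of u n "[]"] red a by simp
  show ?thesis
    by (rule strict_mono_onto_interval[of n "\<lambda>a. nd (u @ Dword n) a (n + 1)"])
      (use ZD_orders(2)[OF w.arr_nd Z] D_block[of u n "[]"] red a nd_sym in auto)
qed

lemma nd_Aword:
  assumes red: "u @ Aword n \<in> red_w0 n" and a: "a \<in> {2..n+1}"
  shows "nd (u @ Aword n) 1 a + a = length u + n + 1"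
proof -
  interpret w: rword n "u @ Aword n" by unfold_locales (rule red)
  have Z: "ZA (nd (u @ Aword n)) 1 (n + 1)" using ZA_Aword_iff[of u n "[]"] red a by simp
  have r: "length u \<le> nd (u @ Aword n) 1 (n + 2 - b) \<and> nd (u @ Aword n) 1 (n + 2 - b) < length u + n" if "b \<in> {1..n}" for b
  proof -
    have "n + 2 - b \<in> {2..n+1}" using that by auto
    then show ?thesis using A_block[of u n "[]" "n + 2 - b"] red by simp
  qed
  have "nd (u @ Aword n) 1 (n + 2 - (n + 2 - a)) + 1 = length u + (n + 2 - a)"
    by (rule strict_mono_onto_interval[of n "\<lambda>b. nd (u @ Aword n) 1 (n + 2 - b)"])
      (use ZA_orders(2)[OF w.arr_nd Z] r a in auto)
  then show ?thesis using a by simp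
qed

section \<open>The lambda-inequalities of a word ending in a full wire\<close>

definition Lam :: "nat \<Rightarrow> (nat \<Rightarrow> real) \<Rightarrow> nat \<Rightarrow> real" where
  "Lam n lam j = (\<Sum>i\<in>{j..n}. lam i)"

lemma Lam_diff: "j \<le> n \<Longrightarrow> Lam n lam j - Lam n lam (Suc j) = lam j"
  by (simp add: Lam_def sum.atLeast_Suc_atMost[of j n])

text \<open>Minus the Cartan matrix of type A.\<close>

definition cartan :: "nat \<Rightarrow> nat \<Rightarrow> real" where
  "cartan i l = (if l = i + 1 \<or> i = l + 1 then 1 else if l = i then -2 else 0)"

lemma lam_coef_cartan: "lam_coef w j k = cartan (w ! j) (w ! k)"
  by (simp add: lam_coef_def cartan_def)

text \<open>Extending S by 0 at both ends gives the second difference the same form for all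
  i.\<close>

lemma cartan_sum:
  assumes "S 0 = 0" "S (n + 1) = 0" "1 \<le> i" "i \<le> n"
  shows "(\<Sum>l\<in>{1..n}. cartan i l * S l) = S (i - 1) + S (i + 1) - 2 * S i"
proof -
  have "(\<Sum>l\<in>{1..n}. cartan i l * S l) = (\<Sum>l\<in>{0..n+1}. cartan i l * S l)"
  proof (rule sum.mono_neutral_left)
    have "{0..n+1} - {1..n} = {0, n+1}" by auto
    then show "\<forall>l\<in>{0..n+1} - {1..n}. cartan i l * S l = 0" using assms by simp
  qed auto
  also have "\<dots> = (\<Sum>l\<in>{i - 1, i, i + 1}. cartan i l * S l)"
    by (rule sum.mono_neutral_right) (use assms in \<open>auto simp: cartan_def\<close>)
  also have "\<dots> = S (i - 1) + S (i + 1) - 2 * S i"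
  proof -
    have "i - 1 \<notin> {i, i + 1}" "i \<notin> {i + 1}" using assms(3) by auto
    moreover have "cartan i (i - 1) = 1" "cartan i i = -2" "cartan i (i + 1) = 1"
      using assms(3) by (auto simp: cartan_def)
    ultimately show ?thesis by simp
  qed
  finally show ?thesis .
qed

lemma cartan_sum_below: "S 0 = 0 \<Longrightarrow> 1 \<le> l \<Longrightarrow> (\<Sum>i\<in>{1..<l}. cartan l i * S i) = S (l - 1)"
proof (cases "l = 1")
  case False
  assume "S 0 = 0" "1 \<le> l"
  then have "(\<Sum>i\<in>{1..<l}. cartan l i * S i) = (\<Sum>i\<in>{l - 1}. cartan l i * S i)"
    using False by (intro sum.mono_neutral_right) (auto simp: cartan_def)
  then show ?thesis using False \<open>1 \<le> l\<close> by (simp add: cartan_def)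
qed simp

lemma cartan_sum_above: "S (n + 1) = 0 \<Longrightarrow> l \<le> n \<Longrightarrow> (\<Sum>i\<in>{l<..n}. cartan l i * S i) = S (l + 1)"
proof (cases "l = n")
  case False
  assume "S (n + 1) = 0" "l \<le> n"
  then have "(\<Sum>i\<in>{l<..n}. cartan l i * S i) = (\<Sum>i\<in>{l + 1}. cartan l i * S i)"
    using False by (intro sum.mono_neutral_right) (auto simp: cartan_def)
  then show ?thesis by (simp add: cartan_def)
qed simp

text \<open>\<open>S l\<close> is the coordinate of the block node in column l. A node before the
  block sees the whole block, through the second difference of \<open>S\<close>, which acts as a
  change of the weight. A node of the block sees only the later letters l - 1, ..., 1, and just l -
  1 is a neighbour of l.\<close>

lemma lam_cone_Dword:
  fixes y :: "nat \<Rightarrow> real"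
  assumes red: "u @ Dword n \<in> red_w0 n" and n: "1 \<le> n"
  defines "S \<equiv> \<lambda>l. if 1 \<le> l \<and> l \<le> n then y (length u + n - l) else 0"
  shows "lam_cone (u @ Dword n) lam y \<longleftrightarrow>
     lam_cone u (\<lambda>i. lam i + S (i - 1) + S (i + 1) - 2 * S i) y \<and> (\<forall>l\<in>{1..n}. S l \<le> lam l + S (l - 1))"
proof -
  let ?w = "u @ Dword n"
  define L where "L = length u"
  have S0: "S 0 = 0" "S (n + 1) = 0" by (auto simp: S_def)
  have nu: "?w ! j = u ! j" if "j < L" for j using that by (simp add: L_def nth_append)
  have nD: "?w ! (L + n - l) = l" if "l \<in> {1..n}" for l
  proof -
    have "?w ! (L + (n - l)) = n - (n - l)" unfolding L_def nth_append_length_plus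
      using Dword_nth[of "n - l" n] that by simp
    moreover have "L + (n - l) = L + n - l" "n - (n - l) = l" using that by auto
    ultimately show ?thesis by simp
  qed
  have yS: "y (L + n - l) = S l" if "l \<in> {1..n}" for l using that by (simp add: S_def L_def)
  have re: "(\<Sum>k\<in>{L + n + 1 - l..<L + n}. lam_coef ?w j k * y k) = (\<Sum>i\<in>{1..<l}. cartan (?w ! j) i * S i)"
    if "l \<le> n + 1" for j l
  proof (rule sum.reindex_bij_witness[of _ "\<lambda>i. L + n - i" "\<lambda>k. L + n - k"])
    fix k assume k: "k \<in> {L + n + 1 - l..<L + n}"
    then have "L + n - k \<in> {1..n}" "L + n - (L + n - k) = k" using that by auto
    then show "cartan (?w ! j) (L + n - k) * S (L + n - k) = lam_coef ?w j k * y k"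
      using nD[of "L + n - k"] yS[of "L + n - k"] by (simp add: lam_coef_cartan)
  qed (use that in auto)
  have ui: "1 \<le> u ! j \<and> u ! j \<le> n" if "j < L" for j
  proof -
    interpret w: rword n ?w by unfold_locales (rule red)
    show ?thesis using w.letter[of j] nu[OF that] that by (simp add: L_def)
  qed
  have lo: "(\<Sum>k\<in>{j<..<L + n}. lam_coef ?w j k * y k) =
      (\<Sum>k\<in>{j<..<L}. lam_coef u j k * y k) + (S (u ! j - 1) + S (u ! j + 1) - 2 * S (u ! j))" if j: "j < L" for j
  proof -
    have e: "{j<..<L + n} = {j<..<L} \<union> {L + n + 1 - (n + 1)..<L + n}" using j by auto
    have "(\<Sum>k\<in>{j<..<L + n}. lam_coef ?w j k * y k) =
        (\<Sum>k\<in>{j<..<L}. lam_coef ?w j k * y k) + (\<Sum>k\<in>{L + n + 1 - (n + 1)..<L + n}. lam_coef ?w j k * y k)"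
      unfolding e by (rule sum.union_disjoint) auto
    also have "(\<Sum>k\<in>{j<..<L}. lam_coef ?w j k * y k) = (\<Sum>k\<in>{j<..<L}. lam_coef u j k * y k)"
      using j by (intro sum.cong) (auto simp: lam_coef_cartan nu)
    also have "(\<Sum>k\<in>{L + n + 1 - (n + 1)..<L + n}. lam_coef ?w j k * y k) = S (u ! j - 1) + S (u ! j + 1) - 2 * S (u ! j)"
    proof -
      have "{1..<n+1} = {1..n}" by auto
      then show ?thesis
        unfolding re[OF le_refl] using cartan_sum[of S n "u ! j", OF S0] ui[OF j] nu[OF j] by simp
    qed
    finally show ?thesis .
  qed
  have hi: "(\<Sum>k\<in>{L + n - l<..<L + n}. lam_coef ?w (L + n - l) k * y k) = S (l - 1)" if "l \<in> {1..n}" for l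
  proof -
    have "{L + n - l<..<L + n} = {L + n + 1 - l..<L + n}" using that by auto
    then show ?thesis using re[of l "L + n - l"] cartan_sum_below[of S l] S0 nD[OF that] that by simp
  qed
  have ball: "(\<forall>j<L + n. P j) \<longleftrightarrow> (\<forall>j<L. P j) \<and> (\<forall>l\<in>{1..n}. P (L + n - l))" for P
  proof (intro iffI conjI allI impI)
    fix j assume a: "(\<forall>j<L. P j) \<and> (\<forall>l\<in>{1..n}. P (L + n - l))" and j: "j < L + n"
    show "P j"
    proof (cases "j < L")
      case False
      then have "L + n - j \<in> {1..n}" "L + n - (L + n - j) = j" using j by auto
      then show ?thesis using a by metis
    qed (use a in blast)
  qed (use n in auto)
  have "length ?w = L + n" by (simp add: L_def)
  then have "lam_cone ?w lam y \<longleftrightarrow>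
      (\<forall>j<L + n. y j \<le> lam (?w ! j) + (\<Sum>k\<in>{j<..<L + n}. lam_coef ?w j k * y k))"
    by (simp add: lam_cone_def)
  also have "\<dots> \<longleftrightarrow> (\<forall>j<L. y j \<le> (lam (u ! j) + S (u ! j - 1) + S (u ! j + 1) - 2 * S (u ! j)) + (\<Sum>k\<in>{j<..<L}. lam_coef u j k * y k)) \<and>
      (\<forall>l\<in>{1..n}. S l \<le> lam l + S (l - 1))"
    unfolding ball
  proof (intro arg_cong2[where f = "(\<and>)"] all_cong1 imp_cong refl ball_cong)
    fix j assume j: "j < L"
    show "y j \<le> lam (?w ! j) + (\<Sum>k\<in>{j<..<L + n}. lam_coef ?w j k * y k) \<longleftrightarrow>
      y j \<le> (lam (u ! j) + S (u ! j - 1) + S (u ! j + 1) - 2 * S (u ! j)) + (\<Sum>k\<in>{j<..<L}. lam_coef u j k * y k)"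
      unfolding nu[OF j] lo[OF j] by (rule iffI; linarith)
  next
    fix l assume l: "l \<in> {1..n}"
    show "y (L + n - l) \<le> lam (?w ! (L + n - l)) + (\<Sum>k\<in>{L + n - l<..<L + n}. lam_coef ?w (L + n - l) k * y k) \<longleftrightarrow>
      S l \<le> lam l + S (l - 1)"
      unfolding nD[OF l] hi[OF l] yS[OF l] ..
  qed
  finally show ?thesis by (simp add: lam_cone_def L_def)
qed

text \<open>After l the block continues with l + 1, ..., n, so \<open>S (l + 1)\<close> takes the
  place of \<open>S (l - 1)\<close>. The indices of the new weight are shifted by one because the
  letters of \<open>u\<close> are lowered.\<close>

lemma lam_cone_Aword:
  fixes y :: "nat \<Rightarrow> real"
  assumes red: "u @ Aword n \<in> red_w0 n" and n: "1 \<le> n"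
  defines "S \<equiv> \<lambda>l. if 1 \<le> l \<and> l \<le> n then y (length u + l - 1) else 0"
  shows "lam_cone (u @ Aword n) lam y \<longleftrightarrow>
     lam_cone (map (\<lambda>a. a - 1) u) (\<lambda>i. lam (i + 1) + S i + S (i + 2) - 2 * S (i + 1)) y \<and>
     (\<forall>l\<in>{1..n}. S l \<le> lam l + S (l + 1))"
proof -
  let ?w = "u @ Aword n" and ?x = "map (\<lambda>a. a - 1) u"
  define L where "L = length u"
  have S0: "S 0 = 0" "S (n + 1) = 0" by (auto simp: S_def)
  have nu: "?w ! j = u ! j" if "j < L" for j using that by (simp add: L_def nth_append)
  have nA: "?w ! (L + l - 1) = l" if "l \<in> {1..n}" for l
    using Aword_nth[of "l - 1" n] that by (auto simp: L_def nth_append)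
  have yS: "y (L + l - 1) = S l" if "l \<in> {1..n}" for l using that by (simp add: S_def L_def)
  have re: "(\<Sum>k\<in>{L + l - 1..<L + n}. lam_coef ?w j k * y k) = (\<Sum>i\<in>{l..n}. cartan (?w ! j) i * S i)"
    if "1 \<le> l" for j l
  proof (rule sum.reindex_bij_witness[of _ "\<lambda>i. L + i - 1" "\<lambda>k. k + 1 - L"])
    fix k assume k: "k \<in> {L + l - 1..<L + n}"
    then have "k + 1 - L \<in> {1..n}" "L + (k + 1 - L) - 1 = k" using that by auto
    then show "cartan (?w ! j) (k + 1 - L) * S (k + 1 - L) = lam_coef ?w j k * y k"
      using nA[of "k + 1 - L"] yS[of "k + 1 - L"] by (simp add: lam_coef_cartan)
  qed (use that in auto)
  have ui: "2 \<le> u ! j \<and> u ! j \<le> n" if "j < L" for j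
    using red_w0_drop_Aword(3)[OF red n] nth_mem[of j u] that by (fastforce simp: L_def)
  have lo: "(\<Sum>k\<in>{j<..<L + n}. lam_coef ?w j k * y k) =
      (\<Sum>k\<in>{j<..<L}. lam_coef ?x j k * y k) + (S (u ! j - 1) + S (u ! j + 1) - 2 * S (u ! j))" if j: "j < L" for j
  proof -
    have e: "{j<..<L + n} = {j<..<L} \<union> {L + 1 - 1..<L + n}" using j by auto
    have "(\<Sum>k\<in>{j<..<L + n}. lam_coef ?w j k * y k) =
        (\<Sum>k\<in>{j<..<L}. lam_coef ?w j k * y k) + (\<Sum>k\<in>{L + 1 - 1..<L + n}. lam_coef ?w j k * y k)"
      unfolding e by (rule sum.union_disjoint) auto
    also have "(\<Sum>k\<in>{j<..<L}. lam_coef ?w j k * y k) = (\<Sum>k\<in>{j<..<L}. lam_coef ?x j k * y k)"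
    proof (rule sum.cong)
      fix k assume "k \<in> {j<..<L}"
      then have "2 \<le> u ! j" "2 \<le> u ! k" "k < L" using ui j by auto
      then show "lam_coef ?w j k * y k = lam_coef ?x j k * y k"
        using j nu[of j] nu[of k] by (auto simp: lam_coef_cartan L_def cartan_def)
    qed simp
    also have "(\<Sum>k\<in>{L + 1 - 1..<L + n}. lam_coef ?w j k * y k) = S (u ! j - 1) + S (u ! j + 1) - 2 * S (u ! j)"
      unfolding re[OF le_refl] using cartan_sum[of S n "u ! j", OF S0] ui[OF j] nu[OF j] by simp
    finally show ?thesis .
  qed
  have hi: "(\<Sum>k\<in>{L + l - 1<..<L + n}. lam_coef ?w (L + l - 1) k * y k) = S (l + 1)" if l: "l \<in> {1..n}" for l
  proof -
    have "{L + l - 1<..<L + n} = {L + (l + 1) - 1..<L + n}" "{l + 1..n} = {l<..n}" using l by auto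
    then show ?thesis using re[of "l + 1" "L + l - 1"] cartan_sum_above[of S n l] S0 nA[OF l] l by simp
  qed
  have ball: "(\<forall>j<L + n. P j) \<longleftrightarrow> (\<forall>j<L. P j) \<and> (\<forall>l\<in>{1..n}. P (L + l - 1))" for P
  proof (intro iffI conjI allI impI)
    fix j assume a: "(\<forall>j<L. P j) \<and> (\<forall>l\<in>{1..n}. P (L + l - 1))" and j: "j < L + n"
    show "P j"
    proof (cases "j < L")
      case False
      then have "j + 1 - L \<in> {1..n}" "L + (j + 1 - L) - 1 = j" using j by auto
      then show ?thesis using a by metis
    qed (use a in blast)
  qed auto
  have "length ?w = L + n" by (simp add: L_def)
  then have "lam_cone ?w lam y \<longleftrightarrow>
      (\<forall>j<L + n. y j \<le> lam (?w ! j) + (\<Sum>k\<in>{j<..<L + n}. lam_coef ?w j k * y k))"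
    by (simp add: lam_cone_def)
  also have "\<dots> \<longleftrightarrow> (\<forall>j<L. y j \<le> (lam (u ! j) + S (u ! j - 1) + S (u ! j + 1) - 2 * S (u ! j)) + (\<Sum>k\<in>{j<..<L}. lam_coef ?x j k * y k)) \<and>
      (\<forall>l\<in>{1..n}. S l \<le> lam l + S (l + 1))"
    unfolding ball
  proof (intro arg_cong2[where f = "(\<and>)"] all_cong1 imp_cong refl ball_cong)
    fix j assume j: "j < L"
    show "y j \<le> lam (?w ! j) + (\<Sum>k\<in>{j<..<L + n}. lam_coef ?w j k * y k) \<longleftrightarrow>
      y j \<le> (lam (u ! j) + S (u ! j - 1) + S (u ! j + 1) - 2 * S (u ! j)) + (\<Sum>k\<in>{j<..<L}. lam_coef ?x j k * y k)"
      unfolding nu[OF j] lo[OF j] by (rule iffI; linarith)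
  next
    fix l assume l: "l \<in> {1..n}"
    show "y (L + l - 1) \<le> lam (?w ! (L + l - 1)) + (\<Sum>k\<in>{L + l - 1<..<L + n}. lam_coef ?w (L + l - 1) k * y k) \<longleftrightarrow>
      S l \<le> lam l + S (l + 1)"
      unfolding nA[OF l] hi[OF l] yS[OF l] ..
  qed
  also have "(\<forall>j<L. y j \<le> (lam (u ! j) + S (u ! j - 1) + S (u ! j + 1) - 2 * S (u ! j)) + (\<Sum>k\<in>{j<..<L}. lam_coef ?x j k * y k)) \<longleftrightarrow>
      lam_cone ?x (\<lambda>i. lam (i + 1) + S i + S (i + 2) - 2 * S (i + 1)) y"
  proof -
    have "?x ! j + 1 = u ! j \<and> ?x ! j = u ! j - 1 \<and> ?x ! j + 2 = u ! j + 1" if "j < L" for j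
      using ui[OF that] that by (auto simp: L_def)
    then show ?thesis unfolding lam_cone_def length_map L_def[symmetric] by (metis (no_types, lifting))
  qed
  finally show ?thesis .
qed

text \<open>
  The coordinates of the last \<open>n\<close> nodes become the row \<open>n\<close> of a Gelfand-Cetlin pattern; its
  successive differences are the weight for the contracted word.
\<close>

definition row_D :: "nat \<Rightarrow> nat \<Rightarrow> nat \<Rightarrow> (nat \<Rightarrow> real) \<Rightarrow> (nat \<Rightarrow> real) \<Rightarrow> real" where
  "row_D n L j lam y = Lam n lam j - (y (L + n - j) - (if j \<le> 1 then 0 else y (L + n - (j - 1))))"

definition row_A :: "nat \<Rightarrow> nat \<Rightarrow> nat \<Rightarrow> (nat \<Rightarrow> real) \<Rightarrow> (nat \<Rightarrow> real) \<Rightarrow> real" where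
  "row_A n L j lam y = Lam n lam (j + 1) + (y (L + j - 1) - (if n \<le> j then 0 else y (L + j)))"

lemma lam_cone_cong:
  assumes "\<And>j. j < length w \<Longrightarrow> lam (w ! j) = lam' (w ! j)" "\<And>j. j < length w \<Longrightarrow> y j = y' j"
  shows "lam_cone w lam y \<longleftrightarrow> lam_cone w lam' y'"
proof -
  have "(\<Sum>k\<in>{j<..<length w}. lam_coef w j k * y k) = (\<Sum>k\<in>{j<..<length w}. lam_coef w j k * y' k)" for j
    by (rule sum.cong) (use assms in auto)
  then show ?thesis using assms by (simp add: lam_cone_def)
qed

text \<open>With \<open>S\<close> as in the preceding lemmas, R j equals Lam j - (S j - S (j - 1)).
  The chain inequalities are then the upper bounds on the R j and the lambda-inequalities of the
  block the lower ones, while the changed weight is exactly the sequence of differences of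
  R.\<close>

lemma polytope_Dword:
  assumes red: "u @ Dword n \<in> red_w0 n" and n: "1 \<le> n"
  defines "R \<equiv> row_D n (length u)"
  shows "path_cone n (u @ Dword n) y \<and> lam_cone (u @ Dword n) lam y \<longleftrightarrow>
     (\<forall>j\<in>{1..n}. Lam n lam (j + 1) \<le> R j lam y \<and> R j lam y \<le> Lam n lam j) \<and>
     path_cone (n - 1) u y \<and> lam_cone u (\<lambda>i. R i lam y - R (i + 1) lam y) y"
proof -
  define L where "L = length u"
  define S where "S = (\<lambda>l. if 1 \<le> l \<and> l \<le> n then y (L + n - l) else 0)"
  have RS: "R j lam y = Lam n lam j - (S j - S (j - 1))" if "j \<in> {1..n}" for j
    using that by (auto simp: R_def row_D_def S_def L_def)
  have nd: "y (nd (u @ Dword n) a (n + 1)) = S (n + 1 - a)" if "a \<in> {1..n}" for a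
  proof -
    have "nd (u @ Dword n) a (n + 1) = L + n - (n + 1 - a)" using nd_Dword[OF red that] that by (auto simp: L_def)
    then show ?thesis using that by (auto simp: S_def)
  qed
  have ch: "(\<forall>k\<in>{1..<n}. y (nd (u @ Dword n) (k + 1) (n + 1)) \<le> y (nd (u @ Dword n) k (n + 1))) \<and>
      0 \<le> y (nd (u @ Dword n) n (n + 1)) \<longleftrightarrow> (\<forall>l\<in>{1..n}. S (l - 1) \<le> S l)"
  proof
    assume a: "(\<forall>k\<in>{1..<n}. y (nd (u @ Dword n) (k + 1) (n + 1)) \<le> y (nd (u @ Dword n) k (n + 1))) \<and>
      0 \<le> y (nd (u @ Dword n) n (n + 1))"
    show "\<forall>l\<in>{1..n}. S (l - 1) \<le> S l"
    proof
      fix l assume l: "l \<in> {1..n}"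
      show "S (l - 1) \<le> S l"
      proof (cases "l = 1")
        case True
        then show ?thesis using a nd[of n] n by (simp add: S_def)
      next
        case False
        then have "n + 1 - l \<in> {1..<n}" "n + 1 - (n + 1 - l + 1) = l - 1" "n + 1 - (n + 1 - l) = l" using l by auto
        then show ?thesis using a nd[of "n + 1 - l"] nd[of "n + 1 - l + 1"] by force
      qed
    qed
  next
    assume a: "\<forall>l\<in>{1..n}. S (l - 1) \<le> S l"
    have "y (nd (u @ Dword n) (k + 1) (n + 1)) \<le> y (nd (u @ Dword n) k (n + 1))" if "k \<in> {1..<n}" for k
    proof -
      have "n + 1 - k \<in> {1..n}" "n + 1 - k - 1 = n + 1 - (k + 1)" using that by auto
      then show ?thesis using a nd[of k] nd[of "k + 1"] that by (metis Suc_eq_plus1 Suc_leI atLeastAtMost_iff atLeastLessThan_iff le_add2 less_imp_le)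
    qed
    moreover have "S 0 \<le> S 1" using a n by force
    ultimately show "(\<forall>k\<in>{1..<n}. y (nd (u @ Dword n) (k + 1) (n + 1)) \<le> y (nd (u @ Dword n) k (n + 1))) \<and>
      0 \<le> y (nd (u @ Dword n) n (n + 1))" using nd[of n] n by (simp add: S_def)
  qed
  have rows: "(\<forall>j\<in>{1..n}. Lam n lam (j + 1) \<le> R j lam y \<and> R j lam y \<le> Lam n lam j) \<longleftrightarrow>
      (\<forall>l\<in>{1..n}. S (l - 1) \<le> S l) \<and> (\<forall>l\<in>{1..n}. S l \<le> lam l + S (l - 1))"
  proof -
    have "Lam n lam (j + 1) \<le> R j lam y \<and> R j lam y \<le> Lam n lam j \<longleftrightarrow> S (j - 1) \<le> S j \<and> S j \<le> lam j + S (j - 1)"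
      if "j \<in> {1..n}" for j
      using RS[OF that] Lam_diff[of j n lam] that by auto
    then show ?thesis by blast
  qed
  have "lam_cone u (\<lambda>i. lam i + S (i - 1) + S (i + 1) - 2 * S i) y \<longleftrightarrow> lam_cone u (\<lambda>i. R i lam y - R (i + 1) lam y) y"
  proof (rule lam_cone_cong)
    fix j assume j: "j < length u"
    interpret u: rword "n - 1" u by unfold_locales (rule red_w0_drop_Dword(1)[OF red n])
    have "u ! j \<in> {1..n}" "u ! j + 1 \<in> {1..n}" "u ! j \<le> n" using u.letter[OF j] n by auto
    then show "lam (u ! j) + S (u ! j - 1) + S (u ! j + 1) - 2 * S (u ! j) = R (u ! j) lam y - R (u ! j + 1) lam y"
      using RS[of "u ! j"] RS[of "u ! j + 1"] Lam_diff[of "u ! j" n lam] by simp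
  qed simp
  moreover have "lam_cone (u @ Dword n) lam y \<longleftrightarrow>
     lam_cone u (\<lambda>i. lam i + S (i - 1) + S (i + 1) - 2 * S i) y \<and> (\<forall>l\<in>{1..n}. S l \<le> lam l + S (l - 1))"
    using lam_cone_Dword[OF red n, of lam y] by (simp only: S_def L_def)
  ultimately show ?thesis
    unfolding path_cone_drop_D[OF red n] rows ch by blast
qed

lemma polytope_Aword:
  assumes red: "u @ Aword n \<in> red_w0 n" and n: "1 \<le> n"
  defines "R \<equiv> row_A n (length u)"
  shows "path_cone n (u @ Aword n) y \<and> lam_cone (u @ Aword n) lam y \<longleftrightarrow>
     (\<forall>j\<in>{1..n}. Lam n lam (j + 1) \<le> R j lam y \<and> R j lam y \<le> Lam n lam j) \<and>
     path_cone (n - 1) (map (\<lambda>a. a - 1) u) y \<and> lam_cone (map (\<lambda>a. a - 1) u) (\<lambda>i. R i lam y - R (i + 1) lam y) y"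
proof -
  let ?x = "map (\<lambda>a. a - 1) u"
  define L where "L = length u"
  define S where "S = (\<lambda>l. if 1 \<le> l \<and> l \<le> n then y (L + l - 1) else 0)"
  have RS: "R j lam y = Lam n lam (j + 1) + (S j - S (j + 1))" if "j \<in> {1..n}" for j
    using that by (auto simp: R_def row_A_def S_def L_def)
  have nd: "y (nd (u @ Aword n) 1 a) = S (n + 2 - a)" if "a \<in> {2..n+1}" for a
  proof -
    have "nd (u @ Aword n) 1 a = L + (n + 2 - a) - 1" using nd_Aword[OF red that] that by (auto simp: L_def)
    then show ?thesis using that by (auto simp: S_def)
  qed
  have ch: "(\<forall>k\<in>{2..n}. y (nd (u @ Aword n) 1 k) \<le> y (nd (u @ Aword n) 1 (k + 1))) \<and>
      0 \<le> y (nd (u @ Aword n) 1 2) \<longleftrightarrow> (\<forall>l\<in>{1..n}. S (l + 1) \<le> S l)"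
  proof
    assume a: "(\<forall>k\<in>{2..n}. y (nd (u @ Aword n) 1 k) \<le> y (nd (u @ Aword n) 1 (k + 1))) \<and> 0 \<le> y (nd (u @ Aword n) 1 2)"
    show "\<forall>l\<in>{1..n}. S (l + 1) \<le> S l"
    proof
      fix l assume l: "l \<in> {1..n}"
      show "S (l + 1) \<le> S l"
      proof (cases "l = n")
        case True
        then show ?thesis using a nd[of 2] n by (simp add: S_def)
      next
        case False
        then have "n + 1 - l \<in> {2..n}" "n + 2 - (n + 1 - l + 1) = l" "n + 2 - (n + 1 - l) = l + 1" using l by auto
        then show ?thesis using a nd[of "n + 1 - l"] nd[of "n + 1 - l + 1"] by force
      qed
    qed
  next
    assume a: "\<forall>l\<in>{1..n}. S (l + 1) \<le> S l"
    have "y (nd (u @ Aword n) 1 k) \<le> y (nd (u @ Aword n) 1 (k + 1))" if k: "k \<in> {2..n}" for k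
    proof -
      have "n + 1 - k \<in> {1..n}" "n + 1 - k + 1 = n + 2 - k" "n + 2 - (k + 1) = n + 1 - k" using k by auto
      moreover have "k \<in> {2..n+1}" "k + 1 \<in> {2..n+1}" using k by auto
      ultimately show ?thesis using a nd[of k] nd[of "k + 1"] by metis
    qed
    moreover have "S (n + 1) \<le> S n" using a n by force
    ultimately show "(\<forall>k\<in>{2..n}. y (nd (u @ Aword n) 1 k) \<le> y (nd (u @ Aword n) 1 (k + 1))) \<and>
      0 \<le> y (nd (u @ Aword n) 1 2)" using nd[of 2] n by (simp add: S_def)
  qed
  have rows: "(\<forall>j\<in>{1..n}. Lam n lam (j + 1) \<le> R j lam y \<and> R j lam y \<le> Lam n lam j) \<longleftrightarrow>
      (\<forall>l\<in>{1..n}. S (l + 1) \<le> S l) \<and> (\<forall>l\<in>{1..n}. S l \<le> lam l + S (l + 1))"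
  proof -
    have "Lam n lam (j + 1) \<le> R j lam y \<and> R j lam y \<le> Lam n lam j \<longleftrightarrow> S (j + 1) \<le> S j \<and> S j \<le> lam j + S (j + 1)"
      if "j \<in> {1..n}" for j
      using RS[OF that] Lam_diff[of j n lam] that by auto
    then show ?thesis by blast
  qed
  have "lam_cone ?x (\<lambda>i. lam (i + 1) + S i + S (i + 2) - 2 * S (i + 1)) y \<longleftrightarrow> lam_cone ?x (\<lambda>i. R i lam y - R (i + 1) lam y) y"
  proof (rule lam_cone_cong)
    fix j assume j: "j < length ?x"
    interpret x: rword "n - 1" ?x by unfold_locales (rule red_w0_drop_Aword(1)[OF red n])
    define i where "i = ?x ! j"
    have "i \<in> {1..n}" "i + 1 \<in> {1..n}" "i + 1 \<le> n" using x.letter[OF j] n unfolding i_def by auto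
    then have "lam (i + 1) + S i + S (i + 2) - 2 * S (i + 1) = R i lam y - R (i + 1) lam y"
      using RS[of i] RS[of "i + 1"] Lam_diff[of "i + 1" n lam] by simp
    then show "lam (?x ! j + 1) + S (?x ! j) + S (?x ! j + 2) - 2 * S (?x ! j + 1) = R (?x ! j) lam y - R (?x ! j + 1) lam y"
      unfolding i_def .
  qed simp
  moreover have "lam_cone (u @ Aword n) lam y \<longleftrightarrow>
     lam_cone ?x (\<lambda>i. lam (i + 1) + S i + S (i + 2) - 2 * S (i + 1)) y \<and> (\<forall>l\<in>{1..n}. S l \<le> lam l + S (l + 1))"
    using lam_cone_Aword[OF red n, of lam y] by (simp only: S_def L_def)
  ultimately show ?thesis
    unfolding path_cone_drop_A[OF red n] rows ch by blast
qed

section \<open>Unimodular equivalence with the Gelfand-Cetlin polytope\<close>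

text \<open>Integral forms in the weight and the coordinates jointly. Treating the weight as a
  variable lets another form be substituted for it, as the induction requires; at a fixed integral
  weight such a form is an integral affine function.\<close>

definition int_lin :: "nat \<Rightarrow> nat \<Rightarrow> ((nat \<Rightarrow> real) \<Rightarrow> (nat \<Rightarrow> real) \<Rightarrow> real) \<Rightarrow> bool" where
  "int_lin n N \<phi> \<longleftrightarrow> (\<exists>c d :: nat \<Rightarrow> int. \<forall>lam y.
     \<phi> lam y = (\<Sum>i\<in>{1..n}. of_int (c i) * lam i) + (\<Sum>j<N. of_int (d j) * y j))"

lemma int_lin_lam: "i \<in> {1..n} \<Longrightarrow> int_lin n N (\<lambda>lam y. lam i)"
  unfolding int_lin_def
  by (intro exI[of _ "\<lambda>l. if l = i then 1 else 0"] exI[of _ "\<lambda>_. 0"]) (auto simp: if_distrib if_distribR cong: if_cong)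

lemma int_lin_y: "j < N \<Longrightarrow> int_lin n N (\<lambda>lam y. y j)"
  unfolding int_lin_def
  by (intro exI[of _ "\<lambda>_. 0"] exI[of _ "\<lambda>l. if l = j then 1 else 0"]) (auto simp: if_distrib if_distribR cong: if_cong)

lemma int_lin_0: "int_lin n N (\<lambda>lam y. 0)"
  unfolding int_lin_def by (intro exI[of _ "\<lambda>_. 0"]) simp

lemma int_lin_add: "int_lin n N \<phi> \<Longrightarrow> int_lin n N \<psi> \<Longrightarrow> int_lin n N (\<lambda>lam y. \<phi> lam y + \<psi> lam y)"
proof -
  assume "int_lin n N \<phi>" "int_lin n N \<psi>"
  then obtain c d c' d' where
    "\<And>lam y. \<phi> lam y = (\<Sum>i\<in>{1..n}. of_int (c i) * lam i) + (\<Sum>j<N. of_int (d j) * y j)"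
    "\<And>lam y. \<psi> lam y = (\<Sum>i\<in>{1..n}. of_int (c' i) * lam i) + (\<Sum>j<N. of_int (d' j) * y j)"
    unfolding int_lin_def by blast
  then show ?thesis unfolding int_lin_def
    by (intro exI[of _ "\<lambda>i. c i + c' i"] exI[of _ "\<lambda>i. d i + d' i"])
      (simp add: distrib_right sum.distrib)
qed

lemma int_lin_mult: "int_lin n N \<phi> \<Longrightarrow> int_lin n N (\<lambda>lam y. of_int k * \<phi> lam y)"
proof -
  assume "int_lin n N \<phi>"
  then obtain c d where
    "\<And>lam y. \<phi> lam y = (\<Sum>i\<in>{1..n}. of_int (c i) * lam i) + (\<Sum>j<N. of_int (d j) * y j)"
    unfolding int_lin_def by blast
  then show ?thesis unfolding int_lin_def
    by (intro exI[of _ "\<lambda>i. k * c i"] exI[of _ "\<lambda>i. k * d i"])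
      (simp add: distrib_left sum_distrib_left mult.assoc)
qed

lemma int_lin_diff: "int_lin n N \<phi> \<Longrightarrow> int_lin n N \<psi> \<Longrightarrow> int_lin n N (\<lambda>lam y. \<phi> lam y - \<psi> lam y)"
  using int_lin_add[OF _ int_lin_mult[of n N \<psi> "-1"]] by simp

lemma int_lin_sum: "(\<And>i. i \<in> I \<Longrightarrow> int_lin n N (\<phi> i)) \<Longrightarrow> int_lin n N (\<lambda>lam y. \<Sum>i\<in>I. \<phi> i lam y)"
proof (induction I rule: infinite_finite_induct)
  case (insert i I)
  then show ?case using int_lin_add[of n N "\<phi> i" "\<lambda>lam y. \<Sum>i\<in>I. \<phi> i lam y"] by simp
qed (simp_all add: int_lin_0)

lemma int_lin_comp:
  assumes "int_lin n' N' \<phi>" "\<And>i. i \<in> {1..n'} \<Longrightarrow> int_lin n N (\<alpha> i)" "\<And>j. j < N' \<Longrightarrow> int_lin n N (\<beta> j)"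
  shows "int_lin n N (\<lambda>lam y. \<phi> (\<lambda>i. \<alpha> i lam y) (\<lambda>j. \<beta> j lam y))"
proof -
  obtain c d where \<phi>: "\<And>lam y. \<phi> lam y = (\<Sum>i\<in>{1..n'}. of_int (c i) * lam i) + (\<Sum>j<N'. of_int (d j) * y j)"
    using assms(1) unfolding int_lin_def by blast
  show ?thesis unfolding \<phi>
    by (intro int_lin_add int_lin_sum int_lin_mult assms(2,3)) auto
qed

lemma int_lin_cong:
  assumes "int_lin n N \<phi>" "\<And>i. i \<in> {1..n} \<Longrightarrow> lam i = lam' i" "\<And>j. j < N \<Longrightarrow> y j = y' j"
  shows "\<phi> lam y = \<phi> lam' y'"
proof -
  obtain c d where \<phi>: "\<And>lam y. \<phi> lam y = (\<Sum>i\<in>{1..n}. of_int (c i) * lam i) + (\<Sum>j<N. of_int (d j) * y j)"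
    using assms(1) unfolding int_lin_def by blast
  show ?thesis unfolding \<phi> using assms(2,3) by (intro arg_cong2[where f = "(+)"] sum.cong) auto
qed

lemma int_lin_Lam: "1 \<le> j \<Longrightarrow> int_lin n N (\<lambda>lam y. Lam n lam j)"
  unfolding Lam_def by (intro int_lin_sum int_lin_lam) auto

section \<open>Gelfand-Cetlin patterns with real weights\<close>

definition gcv :: "nat \<Rightarrow> (nat \<Rightarrow> real) \<Rightarrow> (nat \<Rightarrow> real) \<Rightarrow> nat \<Rightarrow> nat \<Rightarrow> real" where
  "gcv n lam z k j = (if k = n + 1 then Lam n lam j else z (gc_idx k j))"

definition gc_pattern :: "nat \<Rightarrow> (nat \<Rightarrow> real) \<Rightarrow> (nat \<Rightarrow> real) \<Rightarrow> bool" where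
  "gc_pattern n lam z \<longleftrightarrow> (\<forall>k\<in>{1..n}. \<forall>j\<in>{1..k}.
      gcv n lam z (k + 1) (j + 1) \<le> gcv n lam z k j \<and> gcv n lam z k j \<le> gcv n lam z (k + 1) j)"

lemma gc_pattern_cong:
  assumes "\<And>j. j < n * (n + 1) div 2 \<Longrightarrow> z j = z' j"
  shows "gc_pattern n lam z \<longleftrightarrow> gc_pattern n lam z'"
proof -
  have "gcv n lam z k j = gcv n lam z' k j" if "1 \<le> j" "j \<le> k" "k \<le> n + 1" for k j
    using that assms gc_idx_less[of j k n] by (auto simp: gcv_def)
  then show ?thesis by (simp add: gc_pattern_def)
qed

lemma gc_idx_top: "1 \<le> n \<Longrightarrow> 1 \<le> j \<Longrightarrow> gc_idx n j = (n - 1) * (n - 1 + 1) div 2 + (j - 1)"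
  by (simp add: gc_idx_def)

text \<open>The rows from n downward form a pattern whose top row is R. The weight of differences
  determines that row only up to a constant, normalized by last entry 0; hence the shift by
  \<open>R n\<close>.\<close>

lemma gc_pattern_rec:
  assumes n: "1 \<le> n"
    and row: "\<And>j. j \<in> {1..n} \<Longrightarrow> z (gc_idx n j) = R j"
    and z: "\<And>i. i < (n - 1) * (n - 1 + 1) div 2 \<Longrightarrow> z i = z' i + R n"
  shows "gc_pattern n lam z \<longleftrightarrow> (\<forall>j\<in>{1..n}. Lam n lam (j + 1) \<le> R j \<and> R j \<le> Lam n lam j) \<and>
     gc_pattern (n - 1) (\<lambda>i. R i - R (i + 1)) z'"
proof -
  have Rn: "R n + Lam (n - 1) (\<lambda>i. R i - R (i + 1)) j = R j" if "j \<in> {1..n}" for j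
    using sum_Suc_diff'[of j n "\<lambda>i. - R i"] that n atLeastLessThanSuc_atLeastAtMost[of j "n - 1"]
    by (simp add: Lam_def)
  have g: "gcv n lam z k j = gcv (n - 1) (\<lambda>i. R i - R (i + 1)) z' k j + R n" if "1 \<le> j" "j \<le> k" "k \<le> n" for k j
  proof (cases "k = n")
    case True
    then show ?thesis using row[of j] Rn[of j] that n by (simp add: gcv_def)
  next
    case False
    then show ?thesis using that z[OF gc_idx_less[of j k "n - 1"]] by (simp add: gcv_def)
  qed
  have top: "gcv n lam z (n + 1) j = Lam n lam j" for j by (simp add: gcv_def)
  have rown: "gcv n lam z n j = R j" if "j \<in> {1..n}" for j using row[OF that] by (simp add: gcv_def)
  have s: "{1..n} = insert n {1..n-1}" using n by auto
  have "gc_pattern n lam z \<longleftrightarrow>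
      (\<forall>j\<in>{1..n}. Lam n lam (j + 1) \<le> R j \<and> R j \<le> Lam n lam j) \<and>
      (\<forall>k\<in>{1..n-1}. \<forall>j\<in>{1..k}.
      gcv n lam z (k + 1) (j + 1) \<le> gcv n lam z k j \<and> gcv n lam z k j \<le> gcv n lam z (k + 1) j)"
    unfolding gc_pattern_def by (subst s) (simp add: top[simplified] rown)
  also have "(\<forall>k\<in>{1..n-1}. \<forall>j\<in>{1..k}.
      gcv n lam z (k + 1) (j + 1) \<le> gcv n lam z k j \<and> gcv n lam z k j \<le> gcv n lam z (k + 1) j) \<longleftrightarrow>
      gc_pattern (n - 1) (\<lambda>i. R i - R (i + 1)) z'"
    unfolding gc_pattern_def
  proof (intro ball_cong refl)
    fix k j assume kj: "k \<in> {1..n-1}" "j \<in> {1..k}"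
    then have "1 \<le> j" "j \<le> k" "k \<le> n" "j + 1 \<le> k + 1" "k + 1 \<le> n" "j \<le> k + 1" by auto
    then show "(gcv n lam z (k + 1) (j + 1) \<le> gcv n lam z k j \<and> gcv n lam z k j \<le> gcv n lam z (k + 1) j) \<longleftrightarrow>
       (gcv (n - 1) (\<lambda>i. R i - R (i + 1)) z' (k + 1) (j + 1) \<le> gcv (n - 1) (\<lambda>i. R i - R (i + 1)) z' k j \<and>
        gcv (n - 1) (\<lambda>i. R i - R (i + 1)) z' k j \<le> gcv (n - 1) (\<lambda>i. R i - R (i + 1)) z' (k + 1) j)"
      using g[of j k] g[of "j + 1" "k + 1"] g[of j "k + 1"] by simp
  qed
  finally show ?thesis .
qed

text \<open>
  The equivalence is required for all real weights, and to depend integrally on the weight, since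
  in the induction the weight of the contracted polytope varies with the point.
\<close>

definition gc_equiv :: "nat \<Rightarrow> nat list \<Rightarrow> bool" where
  "gc_equiv n w \<longleftrightarrow> (\<exists>T T'.
     (\<forall>j<n * (n + 1) div 2. int_lin n (n * (n + 1) div 2) (\<lambda>lam y. T lam y j)) \<and>
     (\<forall>j<n * (n + 1) div 2. int_lin n (n * (n + 1) div 2) (\<lambda>lam y. T' lam y j)) \<and>
     (\<forall>lam y. \<forall>j<n * (n + 1) div 2. T' lam (T lam y) j = y j) \<and>
     (\<forall>lam z. \<forall>j<n * (n + 1) div 2. T lam (T' lam z) j = z j) \<and>
     (\<forall>lam y. path_cone n w y \<and> lam_cone w lam y \<longleftrightarrow> gc_pattern n lam (T lam y)))"

text \<open>The last n coordinates are exchanged for the row n (\<open>R\<close>, with inverse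
  \<open>Y\<close>); the others are transformed by the equivalence for x at the weight given by the
  differences of this row, then shifted by its last entry. The map is block triangular, so its
  inverse is integral too.\<close>

lemma gc_equiv_step:
  assumes n: "1 \<le> n" and x: "gc_equiv (n - 1) x" and L: "L = (n - 1) * (n - 1 + 1) div 2"
    and R: "\<And>j. j \<in> {1..n} \<Longrightarrow> int_lin n (L + n) (R j)"
    and Y: "\<And>i. L \<le> i \<Longrightarrow> i < L + n \<Longrightarrow> int_lin n (L + n) (Y i)"
    and YR: "\<And>lam y z i. (\<And>j. j \<in> {1..n} \<Longrightarrow> z (L + (j - 1)) = R j lam y) \<Longrightarrow> L \<le> i \<Longrightarrow> i < L + n \<Longrightarrow> Y i lam z = y i"
    and RY: "\<And>lam y z j. (\<And>i. L \<le> i \<Longrightarrow> i < L + n \<Longrightarrow> y i = Y i lam z) \<Longrightarrow> j \<in> {1..n} \<Longrightarrow> R j lam y = z (L + (j - 1))"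
    and P: "\<And>lam y. path_cone n w y \<and> lam_cone w lam y \<longleftrightarrow>
     (\<forall>j\<in>{1..n}. Lam n lam (j + 1) \<le> R j lam y \<and> R j lam y \<le> Lam n lam j) \<and>
     path_cone (n - 1) x y \<and> lam_cone x (\<lambda>i. R i lam y - R (i + 1) lam y) y"
  shows "gc_equiv n w"
proof -
  have N: "n * (n + 1) div 2 = L + n" using tri_diff[OF n] L by simp
  obtain T T' where
    T: "\<And>j. j < L \<Longrightarrow> int_lin (n - 1) L (\<lambda>lam y. T lam y j)" and
    T': "\<And>j. j < L \<Longrightarrow> int_lin (n - 1) L (\<lambda>lam y. T' lam y j)" and
    T'T: "\<And>lam y j. j < L \<Longrightarrow> T' lam (T lam y) j = y j" and
    TT': "\<And>lam z j. j < L \<Longrightarrow> T lam (T' lam z) j = z j" and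
    TP: "\<And>lam y. path_cone (n - 1) x y \<and> lam_cone x lam y \<longleftrightarrow> gc_pattern (n - 1) lam (T lam y)"
    using x unfolding gc_equiv_def L[symmetric] by blast
  define U where "U lam y i = (if i < L then T (\<lambda>i. R i lam y - R (i + 1) lam y) y i + R n lam y
      else R (i - L + 1) lam y)" for lam y i
  \<comment> \<open>The inverse reads the weight of the smaller polytope off row n of z and undoes
    the shift by the last entry of that row.\<close>
  define V where "V lam z i = (if i < L then T' (\<lambda>i. z (L + (i - 1)) - z (L + i)) (\<lambda>i. z i - z (L + (n - 1))) i
      else Y i lam z)" for lam z i
  have Urow: "U lam y (L + (j - 1)) = R j lam y" if "j \<in> {1..n}" for lam y j
  proof -
    have "\<not> L + (j - 1) < L" "L + (j - 1) - L + 1 = j" using that by auto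
    then show ?thesis unfolding U_def by (simp only: if_False)
  qed
  have nn: "n \<in> {1..n}" using n by simp
  have U: "int_lin n (L + n) (\<lambda>lam y. U lam y i)" if i: "i < L + n" for i
  proof (cases "i < L")
    case True
    then show ?thesis unfolding U_def
      by (simp, intro int_lin_add int_lin_comp[OF T[OF True]] int_lin_diff R int_lin_y) (use n in auto)
  next
    case False
    then have "i - L + 1 \<in> {1..n}" using i by auto
    then show ?thesis unfolding U_def using False R by simp
  qed
  have V: "int_lin n (L + n) (\<lambda>lam z. V lam z i)" if i: "i < L + n" for i
  proof (cases "i < L")
    case True
    then show ?thesis unfolding V_def
      by (simp, intro int_lin_comp[OF T'[OF True]] int_lin_diff int_lin_y) (use n in auto)
  next
    case False
    then show ?thesis unfolding V_def using Y i by simp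
  qed
  have VU: "V lam (U lam y) i = y i" if i: "i < L + n" for lam y i
  proof (cases "i < L")
    case True
    have "V lam (U lam y) i = T' (\<lambda>i. U lam y (L + (i - 1)) - U lam y (L + i)) (\<lambda>i. U lam y i - U lam y (L + (n - 1))) i"
      using True by (simp add: V_def)
    also have "\<dots> = T' (\<lambda>i. R i lam y - R (i + 1) lam y) (T (\<lambda>i. R i lam y - R (i + 1) lam y) y) i"
    proof (rule int_lin_cong[OF T'[OF True]])
      fix l assume "l \<in> {1..n-1}"
      then show "U lam y (L + (l - 1)) - U lam y (L + l) = R l lam y - R (l + 1) lam y"
        using Urow[of l lam y] Urow[of "l + 1" lam y] by auto
    next
      fix l assume "l < L"
      then show "U lam y l - U lam y (L + (n - 1)) = T (\<lambda>i. R i lam y - R (i + 1) lam y) y l"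
        using Urow[OF nn, of lam y] by (simp add: U_def)
    qed
    also have "\<dots> = y i" by (rule T'T[OF True])
    finally show ?thesis .
  next
    case False
    have "Y i lam (U lam y) = y i" by (rule YR) (use Urow False i in auto)
    then show ?thesis using False by (simp add: V_def)
  qed
  have Vrow: "R j lam (V lam z) = z (L + (j - 1))" if "j \<in> {1..n}" for lam z j
    by (rule RY) (use that in \<open>auto simp: V_def\<close>)
  have UV: "U lam (V lam z) i = z i" if i: "i < L + n" for lam z i
  proof (cases "i < L")
    case True
    have "U lam (V lam z) i = T (\<lambda>i. R i lam (V lam z) - R (i + 1) lam (V lam z)) (V lam z) i + z (L + (n - 1))"
      using True Vrow[OF nn] by (simp add: U_def)
    also have "T (\<lambda>i. R i lam (V lam z) - R (i + 1) lam (V lam z)) (V lam z) i =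
        T (\<lambda>i. z (L + (i - 1)) - z (L + i)) (T' (\<lambda>i. z (L + (i - 1)) - z (L + i)) (\<lambda>i. z i - z (L + (n - 1)))) i"
    proof (rule int_lin_cong[OF T[OF True]])
      fix l assume "l \<in> {1..n-1}"
      then show "R l lam (V lam z) - R (l + 1) lam (V lam z) = z (L + (l - 1)) - z (L + l)"
        using Vrow[of l lam z] Vrow[of "l + 1" lam z] by auto
    qed (simp add: V_def)
    also have "\<dots> = z i - z (L + (n - 1))" by (rule TT'[OF True])
    finally show ?thesis by simp
  next
    case False
    then have "i - L + 1 \<in> {1..n}" "L + (i - L + 1 - 1) = i" using i by auto
    then show ?thesis using False Vrow[of "i - L + 1" lam z] by (simp add: U_def)
  qed
  have "path_cone n w y \<and> lam_cone w lam y \<longleftrightarrow> gc_pattern n lam (U lam y)" for lam y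
  proof -
    have "gc_pattern n lam (U lam y) \<longleftrightarrow> (\<forall>j\<in>{1..n}. Lam n lam (j + 1) \<le> R j lam y \<and> R j lam y \<le> Lam n lam j) \<and>
     gc_pattern (n - 1) (\<lambda>i. R i lam y - R (i + 1) lam y) (T (\<lambda>i. R i lam y - R (i + 1) lam y) y)"
    proof (rule gc_pattern_rec[OF n])
      fix j assume "j \<in> {1..n}"
      then show "U lam y (gc_idx n j) = R j lam y" using Urow[of j lam y] gc_idx_top[OF n, of j] L by simp
    next
      fix i assume "i < (n - 1) * (n - 1 + 1) div 2"
      then show "U lam y i = T (\<lambda>i. R i lam y - R (i + 1) lam y) y i + R n lam y"
        unfolding L[symmetric] by (simp add: U_def)
    qed
    then show ?thesis using P TP by simp
  qed
  then show ?thesis unfolding gc_equiv_def N using U V VU UV by blast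
qed

lemma gc_equiv_Dword:
  assumes red: "u @ Dword n \<in> red_w0 n" and n: "1 \<le> n" and u: "gc_equiv (n - 1) u"
  shows "gc_equiv n (u @ Dword n)"
proof -
  define L where "L = length u"
  interpret u: rword "n - 1" u by unfold_locales (rule red_w0_drop_Dword(1)[OF red n])
  have L: "L = (n - 1) * (n - 1 + 1) div 2" using u.length_w by (simp add: L_def)
  \<comment> \<open>The row contains the increments of the block coordinates read from column 1;
    partial sums recover the coordinates.\<close>
  define Y where "Y i lam z = (\<Sum>j\<in>{1..L + n - i}. Lam n lam j - z (L + (j - 1)))" for i :: nat and lam z :: "nat \<Rightarrow> real"
  show ?thesis
  proof (rule gc_equiv_step[OF n u L, of "row_D n L" Y])
    fix j assume "j \<in> {1..n}"
    then show "int_lin n (L + n) (row_D n L j)"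
      unfolding row_D_def[abs_def]
      by (cases "j \<le> 1") (auto intro!: int_lin_diff int_lin_Lam int_lin_y int_lin_0)
  next
    fix i assume "L \<le> i" "i < L + n"
    then show "int_lin n (L + n) (Y i)" unfolding Y_def[abs_def]
      by (intro int_lin_sum int_lin_diff int_lin_Lam int_lin_y) auto
  next
    fix lam y z i assume z: "\<And>j. j \<in> {1..n} \<Longrightarrow> z (L + (j - 1)) = row_D n L j lam y" and i: "L \<le> i" "i < L + n"
    define S where "S l = (if l = 0 then 0 else y (L + n - l))" for l
    have "Y i lam z = (\<Sum>j\<in>{1..L + n - i}. S j - S (j - 1))"
      unfolding Y_def by (rule sum.cong) (use z i in \<open>auto simp: row_D_def S_def\<close>)
    also have "\<dots> = (\<Sum>j\<in>{0..<L + n - i}. S (Suc j) - S j)"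
      by (rule sum.reindex_bij_witness[of _ Suc "\<lambda>j. j - 1"]) auto
    also have "\<dots> = S (L + n - i) - S 0" by (rule sum_Suc_diff') simp
    also have "\<dots> = y i" using i by (simp add: S_def)
    finally show "Y i lam z = y i" .
  next
    fix lam y z j assume y: "\<And>i. L \<le> i \<Longrightarrow> i < L + n \<Longrightarrow> y i = Y i lam z" and j: "j \<in> {1..n}"
    have yl: "y (L + n - l) = (\<Sum>j\<in>{1..l}. Lam n lam j - z (L + (j - 1)))" if "1 \<le> l" "l \<le> n" for l
      using y[of "L + n - l"] that by (simp add: Y_def)
    have "y (L + n - j) - (if j \<le> 1 then 0 else y (L + n - (j - 1))) = Lam n lam j - z (L + (j - 1))"
    proof (cases "j = 1")
      case True
      then show ?thesis using yl[of 1] j by simp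
    next
      case False
      then have "{1..j} = insert j {1..j - 1}" "1 \<le> j - 1" "j - 1 \<le> n" "\<not> j \<le> 1" "j \<notin> {1..j-1}" using j by auto
      then show ?thesis using yl[of j] yl[of "j - 1"] j by simp
    qed
    then show "row_D n L j lam y = z (L + (j - 1))" by (simp add: row_D_def)
  next
    show "path_cone n (u @ Dword n) y \<and> lam_cone (u @ Dword n) lam y \<longleftrightarrow>
     (\<forall>j\<in>{1..n}. Lam n lam (j + 1) \<le> row_D n L j lam y \<and> row_D n L j lam y \<le> Lam n lam j) \<and>
     path_cone (n - 1) u y \<and> lam_cone u (\<lambda>i. row_D n L i lam y - row_D n L (i + 1) lam y) y" for lam y
      unfolding L_def by (rule polytope_Dword[OF red n])
  qed
qed

lemma gc_equiv_Aword:
  assumes red: "u @ Aword n \<in> red_w0 n" and n: "1 \<le> n" and u: "gc_equiv (n - 1) (map (\<lambda>a. a - 1) u)"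
  shows "gc_equiv n (u @ Aword n)"
proof -
  define L where "L = length u"
  interpret u: rword "n - 1" "map (\<lambda>a. a - 1) u" by unfold_locales (rule red_w0_drop_Aword(1)[OF red n])
  have L: "L = (n - 1) * (n - 1 + 1) div 2" using u.length_w by (simp add: L_def)
  \<comment> \<open>Here the increments start from the virtual column n + 1, so the sums run from
    the right end.\<close>
  define Y where "Y i lam z = (\<Sum>j\<in>{i - L + 1..n}. z (L + (j - 1)) - Lam n lam (j + 1))" for i :: nat and lam z :: "nat \<Rightarrow> real"
  show ?thesis
  proof (rule gc_equiv_step[OF n u L, of "row_A n L" Y])
    fix j assume "j \<in> {1..n}"
    then show "int_lin n (L + n) (row_A n L j)"
      unfolding row_A_def[abs_def]
      by (cases "n \<le> j") (auto intro!: int_lin_add int_lin_diff int_lin_Lam int_lin_y int_lin_0)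
  next
    fix i assume "L \<le> i" "i < L + n"
    then show "int_lin n (L + n) (Y i)" unfolding Y_def[abs_def]
      by (intro int_lin_sum int_lin_diff int_lin_Lam int_lin_y) auto
  next
    fix lam y z i assume z: "\<And>j. j \<in> {1..n} \<Longrightarrow> z (L + (j - 1)) = row_A n L j lam y" and i: "L \<le> i" "i < L + n"
    define S where "S l = (if n < l then 0 else y (L + l - 1))" for l
    have "Y i lam z = (\<Sum>j\<in>{i - L + 1..n}. S j - S (j + 1))"
      unfolding Y_def by (rule sum.cong) (use z i in \<open>auto simp: row_A_def S_def\<close>)
    also have "\<dots> = (\<Sum>j\<in>{i - L + 1..<n + 1}. (- S (Suc j)) - (- S j))"
      by (rule sum.cong) auto
    also have "\<dots> = - S (n + 1) - (- S (i - L + 1))" by (rule sum_Suc_diff') (use i in simp)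
    also have "\<dots> = y i" using i by (simp add: S_def)
    finally show "Y i lam z = y i" .
  next
    fix lam y z j assume y: "\<And>i. L \<le> i \<Longrightarrow> i < L + n \<Longrightarrow> y i = Y i lam z" and j: "j \<in> {1..n}"
    have yl: "y (L + l - 1) = (\<Sum>j\<in>{l..n}. z (L + (j - 1)) - Lam n lam (j + 1))" if "1 \<le> l" "l \<le> n" for l
    proof -
      have "L \<le> L + l - 1" "L + l - 1 < L + n" "L + l - 1 - L + 1 = l" using that by auto
      then show ?thesis using y[of "L + l - 1"] by (simp add: Y_def)
    qed
    have "y (L + j - 1) - (if n \<le> j then 0 else y (L + j)) = z (L + (j - 1)) - Lam n lam (j + 1)"
    proof (cases "j = n")
      case True
      then show ?thesis using yl[of n] j by simp
    next
      case False
      then have "{j..n} = insert j {j + 1..n}" "j + 1 \<le> n" "\<not> n \<le> j" using j by auto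
      then show ?thesis using yl[of j] yl[of "j + 1"] j by simp
    qed
    then show "row_A n L j lam y = z (L + (j - 1))" by (simp add: row_A_def)
  next
    show "path_cone n (u @ Aword n) y \<and> lam_cone (u @ Aword n) lam y \<longleftrightarrow>
     (\<forall>j\<in>{1..n}. Lam n lam (j + 1) \<le> row_A n L j lam y \<and> row_A n L j lam y \<le> Lam n lam j) \<and>
     path_cone (n - 1) (map (\<lambda>a. a - 1) u) y \<and> lam_cone (map (\<lambda>a. a - 1) u) (\<lambda>i. row_A n L i lam y - row_A n L (i + 1) lam y) y" for lam y
      unfolding L_def by (rule polytope_Aword[OF red n])
  qed
qed

lemma path_cone_cong:
  assumes "w \<in> red_w0 n" "\<And>j. j < length w \<Longrightarrow> y j = y' j"
  shows "path_cone n w y \<longleftrightarrow> path_cone n w y'"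
proof -
  interpret rword n w by unfold_locales (rule assms(1))
  have "val (swf w y) bs = val (swf w y') bs" if "gp (nd w) 1 (n + 1) k bs" for k bs
    by (rule swf_cong) (use that assms(2) nd_less(1) in \<open>auto simp: gp_def subset_iff\<close>)
  then show ?thesis by (simp add: path_cone_def)
qed

lemma same_diagram_path_cone:
  assumes "same_diagram n \<pi> u v"
  shows "path_cone n v y \<longleftrightarrow> path_cone n u (y \<circ> \<pi>)"
proof -
  have nd: "nd v b c = \<pi> (nd u b c)" if "b \<in> {1..n+1}" "c \<in> {1..n+1}-{b}" for b c
    using assms that unfolding same_diagram_def by blast
  have "gp (nd v) 1 (n + 1) k bs \<longleftrightarrow> gp (nd u) 1 (n + 1) k bs" for k bs
  proof (rule gp_cong)
    fix b c d assume "b \<in> {1..n+1}" "c \<in> {1..n+1}" "d \<in> {1..n+1}" "b \<noteq> c" "b \<noteq> d"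
    then show "nd v b c < nd v b d \<longleftrightarrow> nd u b c < nd u b d" using assms unfolding same_diagram_def by blast
  qed
  moreover have "val (swf v y) bs = val (swf u (y \<circ> \<pi>)) bs" if "gp (nd u) 1 (n + 1) k bs" for k bs
    by (rule swf_cong) (use that nd in \<open>auto simp: gp_def subset_iff\<close>)
  ultimately show ?thesis by (simp add: path_cone_def)
qed

text \<open>Renumbering the nodes by \<pi> permutes the coordinates, which is unimodular and does
  not involve the weight.\<close>

lemma gc_equiv_same_diagram:
  assumes s: "same_diagram n \<pi> u v" and v: "gc_equiv n v"
  shows "gc_equiv n u"
proof -
  define N where "N = n * (n + 1) div 2"
  have u: "u \<in> red_w0 n" using s by (simp add: same_diagram_def)
  have len: "length u = N" using u by (simp add: red_w0_def N_def)
  have bij: "bij_betw \<pi> {..<N} {..<N}" using s len by (simp add: same_diagram_def)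
  have lc: "\<forall>lam y. lam_cone v lam y \<longleftrightarrow> lam_cone u lam (y \<circ> \<pi>)"
    using s unfolding same_diagram_def by (elim conjE)
  define \<rho> where "\<rho> = inv_into {..<N} \<pi>"
  have \<rho>\<pi>: "\<rho> (\<pi> j) = j" "\<pi> j < N" and \<pi>\<rho>: "\<pi> (\<rho> j) = j" "\<rho> j < N" if "j < N" for j
    using bij that bij_betwE[OF bij] bij_betw_inv_into[OF bij] unfolding \<rho>_def
    by (auto simp: bij_betw_inv_into_left[OF bij] bij_betw_inv_into_right[OF bij] dest: bij_betwE)
  obtain T T' where
    T: "\<And>j. j < N \<Longrightarrow> int_lin n N (\<lambda>lam y. T lam y j)" and
    T': "\<And>j. j < N \<Longrightarrow> int_lin n N (\<lambda>lam y. T' lam y j)" and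
    T'T: "\<And>lam y j. j < N \<Longrightarrow> T' lam (T lam y) j = y j" and
    TT': "\<And>lam z j. j < N \<Longrightarrow> T lam (T' lam z) j = z j" and
    TP: "\<And>lam y. path_cone n v y \<and> lam_cone v lam y \<longleftrightarrow> gc_pattern n lam (T lam y)"
    using v unfolding gc_equiv_def N_def[symmetric] by blast
  define U where "U lam y = T lam (y \<circ> \<rho>)" for lam y
  define V where "V lam z = T' lam z \<circ> \<pi>" for lam z
  have U: "int_lin n N (\<lambda>lam y. U lam y j)" if "j < N" for j
    using int_lin_comp[OF T[OF that], of n N "\<lambda>i lam y. lam i" "\<lambda>j lam y. y (\<rho> j)"] \<pi>\<rho> int_lin_lam int_lin_y
    by (simp add: U_def comp_def)
  have V: "int_lin n N (\<lambda>lam z. V lam z j)" if "j < N" for j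
    using T'[of "\<pi> j"] \<rho>\<pi> that by (simp add: V_def)
  have VU: "V lam (U lam y) j = y j" if "j < N" for lam y j
    using T'T[of "\<pi> j" lam "y \<circ> \<rho>"] \<rho>\<pi> that by (simp add: U_def V_def)
  have UV: "U lam (V lam z) j = z j" if "j < N" for lam z j
  proof -
    have "T lam ((T' lam z \<circ> \<pi>) \<circ> \<rho>) j = T lam (T' lam z) j"
      by (rule int_lin_cong[OF T[OF that]]) (use \<pi>\<rho> in auto)
    then show ?thesis using TT'[OF that] by (simp add: U_def V_def)
  qed
  have "path_cone n u y \<and> lam_cone u lam y \<longleftrightarrow> gc_pattern n lam (U lam y)" for lam y
  proof -
    have "path_cone n u y \<longleftrightarrow> path_cone n u ((y \<circ> \<rho>) \<circ> \<pi>)"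
      by (rule path_cone_cong[OF u]) (use \<rho>\<pi> len in auto)
    then have 1: "path_cone n u y \<longleftrightarrow> path_cone n v (y \<circ> \<rho>)"
      using same_diagram_path_cone[OF s, of "y \<circ> \<rho>"] by (simp only:)
    have "lam_cone u lam y \<longleftrightarrow> lam_cone u lam ((y \<circ> \<rho>) \<circ> \<pi>)"
      by (rule lam_cone_cong) (use \<rho>\<pi> len in auto)
    then have 2: "lam_cone u lam y \<longleftrightarrow> lam_cone v lam (y \<circ> \<rho>)"
      using lc[THEN spec, of lam, THEN spec, of "y \<circ> \<rho>"] by (simp only:)
    show ?thesis unfolding 1 2 U_def by (rule TP)
  qed
  then show ?thesis unfolding gc_equiv_def N_def[symmetric] using U V VU UV by blast
qed

section \<open>Descent along the contractions\<close>

lemma contr_from_Suc: "k \<le> m \<Longrightarrow> contr_from \<sigma> (Suc m) k w = contr_from \<sigma> m k (contr (\<sigma> (Suc m)) (Suc m) w)"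
  by (simp add: contr_from_def)

lemma contr_from_self: "contr_from \<sigma> n n w = w"
  by (simp add: contr_from_def)

lemma contr_from_cong: "(\<And>j. j \<le> n \<Longrightarrow> \<sigma> j = \<sigma>' j) \<Longrightarrow> contr_from \<sigma> n k w = contr_from \<sigma>' n k w"
  unfolding contr_from_def by (rule fold_cong) auto

lemma gc_equiv_of_indices:
  "w \<in> red_w0 n \<Longrightarrow> (\<forall>k\<in>{1..n}. ind (\<sigma> k) k (contr_from \<sigma> n k w) = 0) \<Longrightarrow> gc_equiv n w"
proof (induction n arbitrary: w)
  case 0
  have "path_cone 0 w y" "lam_cone w lam y" for lam y
    using 0 gp_range by (fastforce simp: path_cone_def lam_cone_def red_w0_def)+
  then show ?case unfolding gc_equiv_def
    by (intro exI[of _ "\<lambda>lam y. y"]) (simp add: gc_pattern_def)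
next
  case (Suc m)
  interpret rword "Suc m" w by unfold_locales (rule Suc.prems)
  define x where "x = contr (\<sigma> (Suc m)) (Suc m) w"
  have i: "ind (\<sigma> (Suc m)) (Suc m) w = 0" using Suc.prems(2) contr_from_self[of \<sigma> "Suc m" w] by (metis atLeastAtMost_iff le_add1 le_refl plus_1_eq_Suc)
  have x: "\<forall>k\<in>{1..m}. ind (\<sigma> k) k (contr_from \<sigma> m k x) = 0"
  proof
    fix k assume "k \<in> {1..m}"
    then have "k \<in> {1..Suc m}" "k \<le> m" by auto
    then show "ind (\<sigma> k) k (contr_from \<sigma> m k x) = 0"
      using Suc.prems(2) contr_from_Suc[of k m \<sigma> w] by (metis x_def)
  qed
  show ?case
  proof (cases "\<sigma> (Suc m)")
    case D
    then have c: "comm_eq w (x @ Dword (Suc m))" using contr_D i ind_D_iff by (simp add: x_def)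
    then obtain \<pi> where s: "same_diagram (Suc m) \<pi> w (x @ Dword (Suc m))" using comm_eq_same_diagram Suc.prems by blast
    then have r: "x @ Dword (Suc m) \<in> red_w0 (Suc m)" by (simp add: same_diagram_def)
    have "gc_equiv m x" using Suc.IH[OF _ x] red_w0_drop_Dword(1)[OF r] by simp
    then show ?thesis using gc_equiv_same_diagram[OF s gc_equiv_Dword[OF r]] by simp
  next
    case A
    then obtain u where c: "comm_eq w (u @ Aword (Suc m))" "x = map (\<lambda>a. a - 1) u"
      using contr_A i ind_A_iff by (auto simp: x_def)
    then obtain \<pi> where s: "same_diagram (Suc m) \<pi> w (u @ Aword (Suc m))" using comm_eq_same_diagram Suc.prems by blast
    then have r: "u @ Aword (Suc m) \<in> red_w0 (Suc m)" by (simp add: same_diagram_def)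
    have "gc_equiv m x" using Suc.IH[OF _ x] red_w0_drop_Aword(1)[OF r] c by simp
    then show ?thesis using gc_equiv_same_diagram[OF s gc_equiv_Aword[OF r]] c by simp
  qed
qed

text \<open>The contraction deletes the last wire, or the first wire with a shift of the remaining
  labels. Intervals of the remaining wires are intervals of the old ones, so the dichotomy is
  inherited and can choose the letter at every stage.\<close>

lemma indices_of_intervals:
  "w \<in> red_w0 n \<Longrightarrow> (\<And>p q. 1 \<le> p \<Longrightarrow> p \<le> q \<Longrightarrow> q \<le> n + 1 \<Longrightarrow> ZD (nd w) p q \<or> ZA (nd w) p q) \<Longrightarrow>
    \<exists>\<sigma>. \<forall>k\<in>{1..n}. ind (\<sigma> k) k (contr_from \<sigma> n k w) = 0"
proof (induction n arbitrary: w)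
  case (Suc m)
  interpret rword "Suc m" w by unfold_locales (rule Suc.prems)
  have step: "\<exists>\<sigma>. \<forall>k\<in>{1..Suc m}. ind (\<sigma> k) k (contr_from \<sigma> (Suc m) k w) = 0"
    if \<sigma>: "\<forall>k\<in>{1..m}. ind (\<sigma> k) k (contr_from \<sigma> m k (contr s (Suc m) w)) = 0" and s: "ind s (Suc m) w = 0" for \<sigma> s
  proof (intro exI[of _ "\<sigma>(Suc m := s)"] ballI)
    fix k assume k: "k \<in> {1..Suc m}"
    show "ind ((\<sigma>(Suc m := s)) k) k (contr_from (\<sigma>(Suc m := s)) (Suc m) k w) = 0"
    proof (cases "k = Suc m")
      case True
      then show ?thesis using s contr_from_self by simp
    next
      case False
      then have "contr_from (\<sigma>(Suc m := s)) (Suc m) k w = contr_from (\<sigma>(Suc m := s)) m k (contr s (Suc m) w)"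
        using k contr_from_Suc[of k m "\<sigma>(Suc m := s)" w] by simp
      also have "\<dots> = contr_from \<sigma> m k (contr s (Suc m) w)" by (rule contr_from_cong) simp
      finally show ?thesis using \<sigma> k False by simp
    qed
  qed
  have "ZD (nd w) 1 (Suc m + 1) \<or> ZA (nd w) 1 (Suc m + 1)" by (rule Suc.prems(2)) auto
  then show ?case
  proof
    assume Z: "ZD (nd w) 1 (Suc m + 1)"
    define x where "x = contr D (Suc m) w"
    have "comm_eq w (x @ Dword (Suc m))" using contr_D Z by (simp add: x_def)
    then obtain \<pi> where s: "same_diagram (Suc m) \<pi> w (x @ Dword (Suc m))" using comm_eq_same_diagram red by blast
    then have r: "x @ Dword (Suc m) \<in> red_w0 (Suc m)" by (simp add: same_diagram_def)
    note dr = red_w0_drop_Dword[OF r, simplified]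
    have ndx: "nd x a b = nd (x @ Dword (Suc m)) a b" if "a \<in> {1..m+1}" "b \<in> {1..m+1}" "a \<noteq> b" for a b
      using dr(2)[of a b] dr(2)[of b a] that nd_sym[of x a b] nd_sym[of "x @ Dword (Suc m)" a b] by (cases "a < b") auto
    have "ZD (nd x) p q \<or> ZA (nd x) p q" if pq: "1 \<le> p" "p \<le> q" "q \<le> m + 1" for p q
    proof -
      let ?y = "x @ Dword (Suc m)"
      have "nd x a b < nd x a q \<longleftrightarrow> nd ?y a b < nd ?y a q" if "p \<le> a \<and> a < b \<and> b < q" for a b
        using ndx[of a b] ndx[of a q] that pq by auto
      then have "ZD (nd x) p q \<longleftrightarrow> ZD (nd ?y) p q" unfolding ZD_def by blast
      moreover have "nd x b c < nd x b p \<longleftrightarrow> nd ?y b c < nd ?y b p" if "p < b \<and> b < c \<and> c \<le> q" for b c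
        using ndx[of b c] ndx[of b p] that pq by auto
      then have "ZA (nd x) p q \<longleftrightarrow> ZA (nd ?y) p q" unfolding ZA_def by blast
      ultimately show ?thesis
        using Suc.prems(2)[of p q] pq same_diagram_ZD[OF s, of p q] same_diagram_ZA[OF s, of p q] by auto
    qed
    then obtain \<sigma> where "\<forall>k\<in>{1..m}. ind (\<sigma> k) k (contr_from \<sigma> m k x) = 0"
      using Suc.IH[OF dr(1)] by blast
    then show ?thesis using step[of \<sigma> D] ind_D_iff Z by (simp add: x_def)
  next
    assume Z: "ZA (nd w) 1 (Suc m + 1)"
    define x where "x = contr A (Suc m) w"
    obtain u where u: "comm_eq w (u @ Aword (Suc m))" "x = map (\<lambda>a. a - 1) u" using contr_A Z by (auto simp: x_def)
    then obtain \<pi> where s: "same_diagram (Suc m) \<pi> w (u @ Aword (Suc m))" using comm_eq_same_diagram red by blast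
    then have r: "u @ Aword (Suc m) \<in> red_w0 (Suc m)" by (simp add: same_diagram_def)
    have xr: "x \<in> red_w0 m" using red_w0_drop_Aword(1)[OF r] u by simp
    have dr: "nd x a b = nd (u @ Aword (Suc m)) (a + 1) (b + 1)" if "1 \<le> a" "a < b" "b \<le> m + 1" for a b
      using red_w0_drop_Aword(2)[OF r, of a b] u that by simp
    have ndx: "nd x a b = nd (u @ Aword (Suc m)) (a + 1) (b + 1)" if "a \<in> {1..m+1}" "b \<in> {1..m+1}" "a \<noteq> b" for a b
      using dr[of a b] dr[of b a] that nd_sym[of x a b] nd_sym[of "u @ Aword (Suc m)" "a + 1" "b + 1"] by (cases "a < b") auto
    have "ZD (nd x) p q \<or> ZA (nd x) p q" if pq: "1 \<le> p" "p \<le> q" "q \<le> m + 1" for p q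
    proof -
      let ?y = "u @ Aword (Suc m)"
      have "ZD (nd x) p q" if Z: "ZD (nd ?y) (p + 1) (q + 1)"
        unfolding ZD_def
      proof (intro allI impI)
        fix a b assume ab: "p \<le> a \<and> a < b \<and> b < q"
        then show "nd x a b < nd x a q"
          using Z[unfolded ZD_def, rule_format, of "a + 1" "b + 1"] ndx[of a b] ndx[of a q] pq by auto
      qed
      moreover have "ZA (nd x) p q" if Z: "ZA (nd ?y) (p + 1) (q + 1)"
        unfolding ZA_def
      proof (intro allI impI)
        fix b c assume bc: "p < b \<and> b < c \<and> c \<le> q"
        then show "nd x b c < nd x b p"
          using Z[unfolded ZA_def, rule_format, of "b + 1" "c + 1"] ndx[of b c] ndx[of b p] pq by auto
      qed
      ultimately show ?thesis
        using Suc.prems(2)[of "p + 1" "q + 1"] pq same_diagram_ZD[OF s, of "p + 1" "q + 1"] same_diagram_ZA[OF s, of "p + 1" "q + 1"] by auto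
    qed
    then obtain \<sigma> where "\<forall>k\<in>{1..m}. ind (\<sigma> k) k (contr_from \<sigma> m k x) = 0"
      using Suc.IH[OF xr] by blast
    then show ?thesis using step[of \<sigma> A] ind_A_iff Z by (simp add: x_def)
  qed
qed simp

section \<open>Integral matrices and the conclusion\<close>

context scoords
begin

lemma unimod_equiv_of_gc_equiv:
  assumes "gc_equiv n w"
  shows "unimod_equiv (string_polytope n w lam e) (GC_polytope n lam e)"
proof -
  define \<Lambda> where "\<Lambda> i = real_of_int (lam i)" for i
  define co where "co x j = x $ e j" for x :: "real^'m" and j
  obtain T T' where
    T: "\<And>j. j < N \<Longrightarrow> int_lin n N (\<lambda>lam y. T lam y j)" and
    T': "\<And>j. j < N \<Longrightarrow> int_lin n N (\<lambda>lam y. T' lam y j)" and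
    T'T: "\<And>lam y j. j < N \<Longrightarrow> T' lam (T lam y) j = y j" and
    TT': "\<And>lam z j. j < N \<Longrightarrow> T lam (T' lam z) j = z j" and
    TP: "\<And>lam y. path_cone n w y \<and> lam_cone w lam y \<longleftrightarrow> gc_pattern n lam (T lam y)"
    using assms unfolding gc_equiv_def N_def[symmetric] by blast
  \<comment> \<open>At the fixed weight, the coordinate part of the forms gives the matrix, and the
    weight part the translation vector, which is integral because \<open>lam\<close> is.\<close>
  have affine: "\<exists>M v. int_matrix M \<and> (\<forall>i. v $ i \<in> \<int>) \<and> (\<forall>x. vof (F \<Lambda> (co x)) = M *v x + v)"
    if F: "\<And>j. j < N \<Longrightarrow> int_lin n N (\<lambda>lam y. F lam y j)" for F :: "(nat \<Rightarrow> real) \<Rightarrow> (nat \<Rightarrow> real) \<Rightarrow> nat \<Rightarrow> real"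
  proof -
    obtain c d :: "nat \<Rightarrow> nat \<Rightarrow> int" where
      cd: "\<And>j lam y. j < N \<Longrightarrow> F lam y j = (\<Sum>i\<in>{1..n}. of_int (c j i) * lam i) + (\<Sum>l<N. of_int (d j l) * y l)"
      using F unfolding int_lin_def by metis
    define ei where "ei = the_inv_into {..<N} e"
    have ei: "ei (e j) = j" if "j < N" for j
      using bij_e the_inv_into_f_f[of e "{..<N}" j] that by (simp add: ei_def bij_betw_def)
    define M :: "real^'m^'m" where "M = (\<chi> i l. of_int (d (ei i) (ei l)))"
    define v :: "real^'m" where "v = vof (\<lambda>j. \<Sum>i\<in>{1..n}. of_int (c j i) * \<Lambda> i)"
    have "vof (F \<Lambda> (co x)) = M *v x + v" for x
      unfolding vec_eq_e_iff
    proof (intro allI impI)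
      fix j assume j: "j < N"
      have "(M *v x) $ e j = (\<Sum>l\<in>UNIV. of_int (d j (ei l)) * x $ l)"
        by (simp add: matrix_vector_mult_def M_def ei[OF j])
      also have "\<dots> = (\<Sum>l<N. of_int (d j (ei (e l))) * x $ e l)"
        by (rule sum.reindex_bij_betw[OF bij_e, symmetric])
      also have "\<dots> = (\<Sum>l<N. of_int (d j l) * co x l)" by (rule sum.cong) (auto simp: ei co_def)
      finally show "vof (F \<Lambda> (co x)) $ e j = (M *v x + v) $ e j" using j by (simp add: cd v_def)
    qed
    moreover have "int_matrix M" by (simp add: int_matrix_def M_def)
    moreover have "v $ i \<in> \<int>" for i
    proof -
      obtain j where "j < N" "i = e j" using e_surj by blast
      then show ?thesis by (auto simp: v_def \<Lambda>_def intro!: Ints_sum Ints_mult)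
    qed
    ultimately show ?thesis by blast
  qed
  obtain M v where M: "int_matrix M" "\<forall>i. v $ i \<in> \<int>" "\<And>x. vof (T \<Lambda> (co x)) = M *v x + v"
    using affine[of T] T by blast
  obtain M' v' where M': "int_matrix M'" "\<And>x. vof (T' \<Lambda> (co x)) = M' *v x + v'"
    using affine[of T'] T' by blast
  have co_vof: "co (vof y) j = y j" if "j < N" for y j using that by (simp add: co_def)
  have inv1: "M' *v (M *v x + v) + v' = x" for x
  proof -
    have "vof (T' \<Lambda> (co (vof (T \<Lambda> (co x))))) = x" unfolding vec_eq_e_iff
    proof (intro allI impI)
      fix j assume j: "j < N"
      have "T' \<Lambda> (co (vof (T \<Lambda> (co x)))) j = T' \<Lambda> (T \<Lambda> (co x)) j"
        by (rule int_lin_cong[OF T'[OF j]]) (auto simp: co_vof)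
      then show "vof (T' \<Lambda> (co (vof (T \<Lambda> (co x))))) $ e j = x $ e j" using j T'T by (simp add: co_def)
    qed
    then show ?thesis by (simp add: M(3) M'(2))
  qed
  have inv2: "M *v (M' *v x + v') + v = x" for x
  proof -
    have "vof (T \<Lambda> (co (vof (T' \<Lambda> (co x))))) = x" unfolding vec_eq_e_iff
    proof (intro allI impI)
      fix j assume j: "j < N"
      have "T \<Lambda> (co (vof (T' \<Lambda> (co x)))) j = T \<Lambda> (T' \<Lambda> (co x)) j"
        by (rule int_lin_cong[OF T[OF j]]) (auto simp: co_vof)
      then show "vof (T \<Lambda> (co (vof (T' \<Lambda> (co x))))) $ e j = x $ e j" using j TT' by (simp add: co_def)
    qed
    then show ?thesis by (simp add: M(3) M'(2))
  qed
  \<comment> \<open>The affine maps are inverse to each other; subtracting the values at 0 gives the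
    same for their linear parts.\<close>
  have "M' ** M = mat 1"
  proof -
    have "M' *v (M *v x) = x" for x
      using inv1[of x] inv1[of 0] by (simp add: matrix_vector_right_distrib) (metis add.right_neutral add_diff_cancel_left' add.assoc)
    then show ?thesis by (simp add: matrix_eq matrix_vector_mul_assoc[symmetric])
  qed
  moreover have "M ** M' = mat 1"
  proof -
    have "M *v (M' *v x) = x" for x
      using inv2[of x] inv2[of 0] by (simp add: matrix_vector_right_distrib) (metis add.right_neutral add_diff_cancel_left' add.assoc)
    then show ?thesis by (simp add: matrix_eq matrix_vector_mul_assoc[symmetric])
  qed
  moreover have "(\<lambda>x. M *v x + v) ` string_polytope n w lam e = GC_polytope n lam e"
  proof -
    have iff: "x \<in> string_polytope n w lam e \<longleftrightarrow> M *v x + v \<in> GC_polytope n lam e" for x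
    proof -
      have "x \<in> string_cone n w e \<longleftrightarrow> (\<forall>k bs. gpw k bs \<longrightarrow> 0 \<le> pvec bs \<bullet> x)"
        by (auto simp: string_cone_eq cone_at_def pvecs_def)
      then have "x \<in> string_cone n w e \<longleftrightarrow> path_cone n w (co x)"
        by (simp add: path_cone_def pvec_inner co_def[abs_def])
      then have "x \<in> string_polytope n w lam e \<longleftrightarrow> path_cone n w (co x) \<and> lam_cone w \<Lambda> (co x)"
        by (simp add: string_polytope_def lam_cone_def co_def \<Lambda>_def)
      also have "\<dots> \<longleftrightarrow> gc_pattern n \<Lambda> (T \<Lambda> (co x))" by (rule TP)
      also have "\<dots> \<longleftrightarrow> gc_pattern n \<Lambda> (co (M *v x + v))"
      proof (rule gc_pattern_cong)
        fix j assume "j < n * (n + 1) div 2"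
        then have "j < N" unfolding N_def .
        then show "T \<Lambda> (co x) j = co (M *v x + v) j" by (simp add: M(3)[symmetric] co_vof)
      qed
      also have "\<dots> \<longleftrightarrow> M *v x + v \<in> GC_polytope n lam e"
        by (simp add: gc_pattern_def GC_polytope_def gcv_def gc_val_def Lam_def \<Lambda>_def co_def)
      finally show ?thesis .
    qed
    show ?thesis
    proof (intro equalityI subsetI)
      fix z assume "z \<in> GC_polytope n lam e"
      then have "M' *v z + v' \<in> string_polytope n w lam e" using iff inv2[of z] by simp
      then show "z \<in> (\<lambda>x. M *v x + v) ` string_polytope n w lam e" using inv2[of z] by (metis image_eqI)
    qed (use iff in auto)
  qed
  ultimately show ?thesis unfolding unimod_equiv_def using M M' by blast
qed

end

theorem theoremA:
  fixes n :: nat and w :: "nat list" and lam :: "nat \<Rightarrow> int" and e :: "nat \<Rightarrow> 'm::finite"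
  assumes "1 \<le> n"
    and "w \<in> red_w0 n"
    and "\<forall>i\<in>{1..n}. 0 < lam i"
    and "bij_betw e {..<n * (n + 1) div 2} (UNIV :: 'm set)"
  shows "(unimod_equiv (string_polytope n w lam e) (GC_polytope n lam e)
            \<longleftrightarrow> num_facets (string_polytope n w lam e) = n * (n + 1))
       \<and> (num_facets (string_polytope n w lam e) = n * (n + 1)
            \<longleftrightarrow> num_facets (string_cone n w e) = n * (n + 1) div 2)
       \<and> (num_facets (string_cone n w e) = n * (n + 1) div 2
            \<longleftrightarrow> (\<exists>\<sigma>. \<forall>k\<in>{1..n}. ind (\<sigma> k) k (contr_from \<sigma> n k w) = 0))"
proof -
  interpret scoords n w e by unfold_locales (use assms in auto)
  have even: "N + N = n * (n + 1)"
  proof -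
    have "even (n * (n + 1))" by simp
    then have "2 * N = n * (n + 1)" unfolding N_def by (rule dvd_mult_div_cancel)
    then show ?thesis by linarith
  qed
  have "num_facets (string_polytope n w lam e) = n * (n + 1)"
    if "unimod_equiv (string_polytope n w lam e) (GC_polytope n lam e)"
    using num_facets_unimod_equiv[OF that] num_facets_GC[OF assms(3)] by simp
  moreover have "num_facets (string_polytope n w lam e) = n * (n + 1) \<longleftrightarrow> num_facets (string_cone n w e) = N"
    using num_facets_string_polytope[OF assms(3)] even by linarith
  moreover have "\<exists>\<sigma>. \<forall>k\<in>{1..n}. ind (\<sigma> k) k (contr_from \<sigma> n k w) = 0" if "num_facets (string_cone n w e) = N"
    using indices_of_intervals[OF assms(2)] simplicial_imp_ZD_or_ZA[OF that] by blast
  moreover have "unimod_equiv (string_polytope n w lam e) (GC_polytope n lam e)"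
    if "\<exists>\<sigma>. \<forall>k\<in>{1..n}. ind (\<sigma> k) k (contr_from \<sigma> n k w) = 0"
    using that gc_equiv_of_indices[OF assms(2)] unimod_equiv_of_gc_equiv by blast
  ultimately show ?thesis unfolding N_def by blast
qed

end
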